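(* Let $\ell>0$ and let $f\in W^{1,2}(0,\ell)$ be complex-valued with $f(x)\neq0$ for all $x\in[0,\ell]$ and $f(0)=1$. Then $\mathbf{T}_f(W^{2,2}(-\ell,\ell))\subset\mathscr{D}_2(\mathbf{S}_f)$ and $$\mathbf{S}_f\mathbf{T}_fy=-\mathbf{T}_fy''\qquad\forall y\in W^{2,2}(-\ell,\ell).$$
   Context: All functions are complex-valued. $\mathcal{T}_\ell=\{(x,t): 0\le x\le\ell,\ |t|\le x\}$. $\mathbf{D}_f y:=f(y/f)'=y'-\frac{f'}{f}y$, $\mathbf{D}_{\frac1f}y:=\frac1f(fy)'=y'+\frac{f'}{f}y$. $\mathbf{S}_f$ is the Schrödinger operator $-y''+q_fy$ on $(0,\ell)$ with distributional potential $q_f=f''/f\in W^{-1,2}(0,\ell)$; its domain is $\mathscr{D}_2(\mathbf{S}_f)=\{y\in W^{1,2}(0,\ell):\mathbf{D}_fy\in W^{1,2}(0,\ell)\}$ and there $\mathbf{S}_fy=-\mathbf{D}_{\frac1f}\mathbf{D}_fy\in L^2(0,\ell)$. For $\rho\in\mathbb{C}$, $e_f(\rho,\cdot)\in\mathscr{D}_2(\mathbf{S}_f)$ is the unique solution of $\mathbf{S}_fy=\rho^2y$ with $y(0)=1$, $\mathbf{D}_fy(0)=i\rho$. $K_f\in L^2(\mathcal{T}_\ell)$ is the kernel with $K_f(x,\cdot)\in L^2(-x,x)$ and $e_f(\rho,x)=e^{i\rho x}+\int_{-x}^xK_f(x,t)e^{i\rho t}dt$ for all $\rho\in\mathbb{C}$,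 $x\in(0,\ell]$ (such a kernel exists and is unique up to null sets). The operator $\mathbf{T}_f:L^2(-\ell,\ell)\to L^2(0,\ell)$ is $\mathbf{T}_fy(x)=y(x)+\int_{-x}^xK_f(x,t)y(t)\,dt$. *)

theory Defs
  imports "HOL-Analysis.Analysis"
begin

text \<open>
  Elements of Lebesgue and Sobolev spaces are represented by functions, not by classes of almost
  everywhere equal functions; equations between such elements are stated almost everywhere.
\<close>

definition L2_on :: "'a::euclidean_space set \<Rightarrow> ('a \<Rightarrow> complex) set" where
  "L2_on S = {u. u \<in> borel_measurable (lebesgue_on S) \<and>
                 integrable (lebesgue_on S) (\<lambda>x. (norm (u x))\<^sup>2)}"

definition test_functions :: "real \<Rightarrow> real \<Rightarrow> (real \<Rightarrow> real) set" where
  "test_functions a b = {\<phi>. (\<forall>n. (deriv ^^ n) \<phi> differentiable_on UNIV) \<and>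
     (\<exists>c d. a < c \<and> d < b \<and> (\<forall>x. x \<notin> {c..d} \<longrightarrow> \<phi> x = 0))}"

definition locally_integrable :: "real \<Rightarrow> real \<Rightarrow> (real \<Rightarrow> complex) \<Rightarrow> bool" where
  "locally_integrable a b u \<longleftrightarrow>
     (\<forall>c d. a < c \<longrightarrow> d < b \<longrightarrow> u absolutely_integrable_on {c..d})"

text \<open>
  Real-valued test functions suffice for complex-valued \<open>u\<close>, the defining identity being
  complex linear in the test function.
\<close>

definition has_weak_deriv ::
    "real \<Rightarrow> real \<Rightarrow> (real \<Rightarrow> complex) \<Rightarrow> (real \<Rightarrow> complex) \<Rightarrow> bool" where
  "has_weak_deriv a b u g \<longleftrightarrow>
     locally_integrable a b u \<and> locally_integrable a b g \<and>
     (\<forall>\<phi>\<in>test_functions a b.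
        (LINT x:{a<..<b}|lebesgue. u x * of_real (deriv \<phi> x)) =
        - (LINT x:{a<..<b}|lebesgue. g x * of_real (\<phi> x)))"

text \<open>The weak derivative is unique up to null sets; an arbitrary representative is chosen.\<close>

definition weak_deriv :: "real \<Rightarrow> real \<Rightarrow> (real \<Rightarrow> complex) \<Rightarrow> real \<Rightarrow> complex" where
  "weak_deriv a b u = (SOME g. has_weak_deriv a b u g)"

text \<open>\<open>sobolev k a b\<close> is \<open>W\<^sup>k\<^sup>,\<^sup>2(a,b)\<close>.\<close>

primrec sobolev :: "nat \<Rightarrow> real \<Rightarrow> real \<Rightarrow> (real \<Rightarrow> complex) set" where
  "sobolev 0 a b = L2_on {a<..<b}"
| "sobolev (Suc k) a b = {u \<in> L2_on {a<..<b}. \<exists>g\<in>sobolev k a b. has_weak_deriv a b u g}"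

text \<open>
  \<open>darboux l f y = f (y/f)'\<close> on \<open>(0,l)\<close>. With \<open>1/f\<close> in place of \<open>f\<close>
  it is \<open>(1/f) (f y)'\<close>.
\<close>

definition darboux :: "real \<Rightarrow> (real \<Rightarrow> complex) \<Rightarrow> (real \<Rightarrow> complex) \<Rightarrow> real \<Rightarrow> complex" where
  "darboux l f y = (\<lambda>x. f x * weak_deriv 0 l (\<lambda>t. y t / f t) x)"

definition schroedinger_dom :: "real \<Rightarrow> (real \<Rightarrow> complex) \<Rightarrow> (real \<Rightarrow> complex) set" where
  "schroedinger_dom l f = {y \<in> sobolev 1 0 l. darboux l f y \<in> sobolev 1 0 l}"

definition schroedinger ::
    "real \<Rightarrow> (real \<Rightarrow> complex) \<Rightarrow> (real \<Rightarrow> complex) \<Rightarrow> real \<Rightarrow> complex" where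
  "schroedinger l f y = (\<lambda>x. - darboux l (\<lambda>t. 1 / f t) (darboux l f y) x)"

text \<open>
  The value of a Sobolev function at an end point is that of its continuous representative:
  \<open>y\<close> itself is taken continuous, while \<open>darboux l f y\<close>, being determined only almost
  everywhere, is evaluated at 0 through its continuous representative \<open>v\<close>.
\<close>

definition is_exp_solution ::
    "real \<Rightarrow> (real \<Rightarrow> complex) \<Rightarrow> complex \<Rightarrow> (real \<Rightarrow> complex) \<Rightarrow> bool" where
  "is_exp_solution l f \<rho> y \<longleftrightarrow>
     y \<in> schroedinger_dom l f \<and> continuous_on {0..l} y \<and>
     (AE x in lebesgue_on {0<..<l}. schroedinger l f y x = \<rho>\<^sup>2 * y x) \<and>
     y 0 = 1 \<and>
     (\<exists>v. continuous_on {0..l} v \<and>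
          (AE x in lebesgue_on {0<..<l}. v x = darboux l f y x) \<and>
          v 0 = \<i> * \<rho>)"

definition triangle :: "real \<Rightarrow> (real \<times> real) set" where
  "triangle l = {(x, t). 0 \<le> x \<and> x \<le> l \<and> \<bar>t\<bar> \<le> x}"

definition is_transmutation_kernel ::
    "real \<Rightarrow> (complex \<Rightarrow> real \<Rightarrow> complex) \<Rightarrow> (real \<times> real \<Rightarrow> complex) \<Rightarrow> bool" where
  "is_transmutation_kernel l e K \<longleftrightarrow>
     K \<in> L2_on (triangle l) \<and>
     (\<forall>x\<in>{0<..l}. (\<lambda>t. K (x, t)) \<in> L2_on {-x<..<x}) \<and>
     (\<forall>\<rho>. \<forall>x\<in>{0<..l}. e \<rho> x =
        exp (\<i> * \<rho> * of_real x) +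
        (LINT t:{-x..x}|lebesgue. K (x, t) * exp (\<i> * \<rho> * of_real t)))"

definition transmutation ::
    "(real \<times> real \<Rightarrow> complex) \<Rightarrow> (real \<Rightarrow> complex) \<Rightarrow> real \<Rightarrow> complex" where
  "transmutation K y = (\<lambda>x. y x + (LINT t:{-x..x}|lebesgue. K (x, t) * y t))"

end

theory Submission
  imports Defs
begin

text \<open>
  On \<open>(0,l)\<close>, integrating \<open>\<^bold>S\<^sub>f u = - w\<close> twice turns it into the Volterra formula
  \<open>u(x) = f(x) (a + \<integral>\<^sub>0\<^sup>x f(s)\<^sup>-\<^sup>2 (b + \<integral>\<^sub>0\<^sup>s f(r) w(r) dr) ds)\<close> with \<open>a = u(0)\<close>, \<open>b = \<^bold>D\<^sub>f u(0)\<close>, and conversely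
  every such \<open>u\<close> lies in the domain and solves the equation. So the claim is this formula for
  \<open>u = \<^bold>T\<^sub>f y\<close>, \<open>w = \<^bold>T\<^sub>f y''\<close>, \<open>a = y(0)\<close>, \<open>b = y'(0)\<close>. For \<open>y(t) = e\<^sup>c\<^sup>t\<close> it is the defining property of
  \<open>e\<^sub>f(-ic, \<cdot>)\<close>. It is linear in \<open>y\<close> and, since \<open>K\<^sub>f\<close> is square integrable, stable under convergence of
  \<open>y(0)\<close>, \<open>y'(0)\<close> and of \<open>y''\<close> in \<open>L\<^sup>2(-l,l)\<close>. Hence it holds for \<open>y(t) = t\<close>, the limit of \<open>n (e\<^sup>t\<^sup>/\<^sup>n - 1)\<close>,
  and then for every \<open>y\<close>, because the functions \<open>\<Sum>\<^sub>j c\<^sub>j e\<^sup>j\<^sup>t\<close> with \<open>j \<ge> 1\<close>, which can be integrated twice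
  without leaving their span, are dense in \<open>L\<^sup>2(-l,l)\<close>.
\<close>

section \<open>Square integrable functions on an interval\<close>

text \<open>Since f has a single square integrable derivative, f''/f is only a distribution and the
  equation has no classical reading. The Volterra form contains f but no derivative of f, and
  reaching it takes only a product rule and a reciprocal rule for primitives of L^2 functions. The
  Sobolev spaces of the statement are built instead on weak derivatives, chosen by
  \<open>SOME\<close> and known almost everywhere. Joining the two worlds requires the fundamental
  lemma of the calculus of variations, hence test functions, which are made from exp(-1/x).

  Exponentials come first because the kernel is defined by its action on them, and \<rho> = -ic
  makes them real. With s = e^t, combinations of them become polynomials on the compact interval
  from e^(-l) to e^l, where Stone-Weierstrass applies. Second antiderivatives of the approximants
  have wrong values and slopes at 0; adding the solutions 1 and t of y'' = 0 repairs this, which is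
  why y(t) = t is treated separately. The kernel being only square integrable, its sections are
  controlled for almost every x only, so the identities are carried almost everywhere.\<close>

lemma AE_lebesgue_on_Ioo_iff:
  fixes a b :: real
  shows "(AE x in lebesgue_on {a<..<b}. P x) \<longleftrightarrow> (AE x in lebesgue_on {a..b}. P x)"
proof -
  have "negligible {a, b}" by simp
  then have "AE x in lebesgue. x \<notin> {a, b}"
    by (intro AE_not_in) (simp only: negligible_iff_null_sets)
  then have "(AE x in lebesgue. x \<in> {a<..<b} \<longrightarrow> P x) \<longleftrightarrow> (AE x in lebesgue. x \<in> {a..b} \<longrightarrow> P x)"
    by (rule eventually_subst[OF eventually_mono]) auto
  then show ?thesis by (simp add: AE_restrict_space_iff)
qed

lemma integrable_lebesgue_on_iff_absolutely:
  fixes u :: "real \<Rightarrow> 'b::euclidean_space"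
  assumes "S \<in> sets lebesgue"
  shows "integrable (lebesgue_on S) u \<longleftrightarrow> u absolutely_integrable_on S"
  using assms by (simp add: integrable_restrict_space set_integrable_def)

text \<open>Rests on completeness of Lebesgue measure: after extension by zero, a change on a null
  set keeps measurability.\<close>

lemma borel_measurable_lebesgue_on_cong_AE:
  fixes u v :: "real \<Rightarrow> 'b::euclidean_space"
  assumes S: "S \<in> sets lebesgue" and u: "u \<in> borel_measurable (lebesgue_on S)"
    and ae: "AE x in lebesgue_on S. u x = v x"
  shows "v \<in> borel_measurable (lebesgue_on S)"
proof -
  have "AE x in lebesgue. x \<in> S \<longrightarrow> u x = v x"
    using ae S by (subst (asm) AE_restrict_space_iff) auto
  then have "AE x in lebesgue. (if x \<in> S then u x else 0) = (if x \<in> S then v x else 0)"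
    by (rule eventually_mono) simp
  then show ?thesis
    using borel_measurable_AE[OF borel_measurable_if[OF S, THEN iffD2, OF u]]
      borel_measurable_if[OF S, of v] by (simp only:)
qed

lemma integrable_lebesgue_on_cong_AE:
  fixes u v :: "real \<Rightarrow> 'b::euclidean_space"
  assumes S: "S \<in> sets lebesgue" and u: "integrable (lebesgue_on S) u"
    and ae: "AE x in lebesgue_on S. u x = v x"
  shows "integrable (lebesgue_on S) v"
  by (rule integrable_cong_AE_imp[OF u borel_measurable_lebesgue_on_cong_AE[OF S _ ae] ae])
     (use u in auto)

lemma borel_measurable_lebesgue_on_Ioo_iff:
  fixes u :: "real \<Rightarrow> 'b::euclidean_space"
  shows "u \<in> borel_measurable (lebesgue_on {a<..<b}) \<longleftrightarrow> u \<in> borel_measurable (lebesgue_on {a..b})"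
proof -
  have "negligible {a, b}" by simp
  then have "AE x in lebesgue. x \<notin> {a, b}"
    by (intro AE_not_in) (simp only: negligible_iff_null_sets)
  then have ae: "AE x in lebesgue. (if x \<in> {a<..<b} then u x else 0) = (if x \<in> {a..b} then u x else 0)"
    by (rule eventually_mono) auto
  then have ae': "AE x in lebesgue. (if x \<in> {a..b} then u x else 0) = (if x \<in> {a<..<b} then u x else 0)"
    by (rule eventually_mono) auto
  have "(\<lambda>x. if x \<in> {a<..<b} then u x else 0) \<in> borel_measurable lebesgue \<longleftrightarrow>
     (\<lambda>x. if x \<in> {a..b} then u x else 0) \<in> borel_measurable lebesgue"
    using borel_measurable_AE[OF _ ae] borel_measurable_AE[OF _ ae'] by blast
  then show ?thesis
    using borel_measurable_if[of "{a<..<b}" u] borel_measurable_if[of "{a..b}" u] by auto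
qed

lemma integrable_lebesgue_on_Ioo_iff:
  fixes u :: "real \<Rightarrow> 'b::euclidean_space"
  shows "integrable (lebesgue_on {a<..<b}) u \<longleftrightarrow> integrable (lebesgue_on {a..b}) u"
  using absolutely_integrable_on_open_interval[of a b u]
  by (simp add: integrable_lebesgue_on_iff_absolutely box_real cbox_interval)

text \<open>End points form a null set. This trades the open intervals in \<open>sobolev\<close> for
  compact ones, on which continuous functions are bounded.\<close>

lemma L2_on_Ioo_eq: "L2_on {a<..<b} = L2_on {a..b::real}"
  unfolding L2_on_def borel_measurable_lebesgue_on_Ioo_iff integrable_lebesgue_on_Ioo_iff ..

lemma L2_on_cong_AE:
  fixes u v :: "real \<Rightarrow> complex"
  assumes S: "S \<in> sets lebesgue" and u: "u \<in> L2_on S"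
    and ae: "AE x in lebesgue_on S. u x = v x"
  shows "v \<in> L2_on S"
  unfolding L2_on_def
proof safe
  show "v \<in> borel_measurable (lebesgue_on S)"
    using borel_measurable_lebesgue_on_cong_AE[OF S _ ae] u by (auto simp: L2_on_def)
  show "integrable (lebesgue_on S) (\<lambda>x. (norm (v x))\<^sup>2)"
  proof (rule integrable_lebesgue_on_cong_AE[OF S])
    show "integrable (lebesgue_on S) (\<lambda>x. (norm (u x))\<^sup>2)" using u by (simp add: L2_on_def)
    show "AE x in lebesgue_on S. (norm (u x))\<^sup>2 = (norm (v x))\<^sup>2"
      by (rule eventually_mono[OF ae]) simp
  qed
qed

lemma L2_on_measurableD [dest]: "u \<in> L2_on S \<Longrightarrow> u \<in> borel_measurable (lebesgue_on S)"
  by (simp add: L2_on_def)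

text \<open>Integrability comes from |uv| <= |u|^2 + |v|^2. The inequality is the one for
  nonnegative extended integrals, applied to the norms, where every integral is now known to be
  finite.\<close>

lemma Cauchy_Schwarz_integral:
  fixes u v :: "'a \<Rightarrow> complex"
  assumes u [measurable]: "u \<in> borel_measurable M" and v [measurable]: "v \<in> borel_measurable M"
    and u2: "integrable M (\<lambda>x. (norm (u x))\<^sup>2)" and v2: "integrable M (\<lambda>x. (norm (v x))\<^sup>2)"
  shows "integrable M (\<lambda>x. u x * v x)"
    and "(LINT x|M. norm (u x * v x))\<^sup>2 \<le> (LINT x|M. (norm (u x))\<^sup>2) * (LINT x|M. (norm (v x))\<^sup>2)"
proof -
  have "integrable M (\<lambda>x. (norm (u x))\<^sup>2 + (norm (v x))\<^sup>2)" using u2 v2 by simp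
  then show uv: "integrable M (\<lambda>x. u x * v x)"
  proof (rule Bochner_Integration.integrable_bound)
    have "norm (u x * v x) \<le> (norm (u x))\<^sup>2 + (norm (v x))\<^sup>2" for x
    proof -
      have "0 \<le> (norm (u x) - norm (v x))\<^sup>2" by simp
      then have "2 * (norm (u x) * norm (v x)) \<le> (norm (u x))\<^sup>2 + (norm (v x))\<^sup>2"
        by (simp add: power2_diff)
      moreover have "0 \<le> norm (u x) * norm (v x)" by simp
      ultimately show ?thesis unfolding norm_mult by linarith
    qed
    then show "AE x in M. norm (u x * v x) \<le> norm ((norm (u x))\<^sup>2 + (norm (v x))\<^sup>2)"
      by (intro AE_I2) simp
  qed measurable
  have 1: "(\<integral>\<^sup>+x. ennreal (norm (u x)) * ennreal (norm (v x)) \<partial>M) = ennreal (LINT x|M. norm (u x * v x))"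
    using integrable_norm[OF uv]
    by (subst nn_integral_eq_integral[symmetric]) (auto simp: norm_mult ennreal_mult)
  have 2: "(\<integral>\<^sup>+x. ennreal (norm (w x)) ^ 2 \<partial>M) = ennreal (LINT x|M. (norm (w x))\<^sup>2)"
    if "integrable M (\<lambda>x. (norm (w x))\<^sup>2)" for w :: "'a \<Rightarrow> complex"
    using that by (subst nn_integral_eq_integral[symmetric]) (auto simp: ennreal_power)
  show "(LINT x|M. norm (u x * v x))\<^sup>2 \<le> (LINT x|M. (norm (u x))\<^sup>2) * (LINT x|M. (norm (v x))\<^sup>2)"
    using Cauchy_Schwarz_nn_integral[of "\<lambda>x. ennreal (norm (u x))" M "\<lambda>x. ennreal (norm (v x))"]
    unfolding 1 2[OF u2] 2[OF v2]
    by (simp add: ennreal_power ennreal_mult[symmetric] integral_nonneg_AE)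
qed

text \<open>Cauchy-Schwarz against the constant 1. The second part is what later turns L^2
  convergence into L^1 convergence.\<close>

lemma L2_on_imp_integrable:
  fixes u :: "real \<Rightarrow> complex"
  assumes "u \<in> L2_on {a..b}"
  shows "integrable (lebesgue_on {a..b}) u"
    and "(LINT x|lebesgue_on {a..b}. norm (u x))\<^sup>2 \<le> \<bar>b - a\<bar> * (LINT x|lebesgue_on {a..b}. (norm (u x))\<^sup>2)"
proof -
  have u: "u \<in> borel_measurable (lebesgue_on {a..b})" "integrable (lebesgue_on {a..b}) (\<lambda>x. (norm (u x))\<^sup>2)"
    using assms by (simp_all add: L2_on_def)
  have 1: "integrable (lebesgue_on {a..b}) (\<lambda>x. (norm (1::complex))\<^sup>2)"
    by (rule Lebesgue_Measure.integrable_const_ivl)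
  note * = Cauchy_Schwarz_integral[OF borel_measurable_const u(1) 1 u(2)]
  show "integrable (lebesgue_on {a..b}) u"
    using *(1) by simp
  have "measure (lebesgue_on {a..b}) {a..b} \<le> \<bar>b - a\<bar>"
    by (subst measure_restrict_space) auto
  moreover have "(LINT x|lebesgue_on {a..b}. norm (u x))\<^sup>2 \<le> measure (lebesgue_on {a..b}) {a..b} * (LINT x|lebesgue_on {a..b}. (norm (u x))\<^sup>2)"
    using *(2) by simp
  ultimately show "(LINT x|lebesgue_on {a..b}. norm (u x))\<^sup>2 \<le> \<bar>b - a\<bar> * (LINT x|lebesgue_on {a..b}. (norm (u x))\<^sup>2)"
    by (smt (verit) mult_right_mono integral_nonneg_AE AE_I2 zero_le_power2)
qed

lemma L2_on_bounded_mult: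
  fixes u v :: "real \<Rightarrow> complex"
  assumes u: "u \<in> L2_on {a..b}" and v: "v \<in> borel_measurable (lebesgue_on {a..b})"
    and B: "\<And>x. x \<in> {a..b} \<Longrightarrow> norm (v x) \<le> B"
  shows "(\<lambda>x. v x * u x) \<in> L2_on {a..b}"
  unfolding L2_on_def
proof safe
  show m: "(\<lambda>x. v x * u x) \<in> borel_measurable (lebesgue_on {a..b})"
    using u v by (auto simp: L2_on_def)
  have "integrable (lebesgue_on {a..b}) (\<lambda>x. B\<^sup>2 * (norm (u x))\<^sup>2)"
    using u by (auto simp: L2_on_def)
  then show "integrable (lebesgue_on {a..b}) (\<lambda>x. (norm (v x * u x))\<^sup>2)"
  proof (rule Bochner_Integration.integrable_bound)
    show "AE x in lebesgue_on {a..b}. norm ((norm (v x * u x))\<^sup>2) \<le> norm (B\<^sup>2 * (norm (u x))\<^sup>2)"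
      using B by (intro AE_I2) (auto simp: norm_mult power_mult_distrib intro!: mult_right_mono power_mono)
  qed (use m in measurable)
qed

lemma L2_on_continuous:
  fixes v :: "real \<Rightarrow> complex"
  assumes "continuous_on {a..b} v"
  shows "v \<in> L2_on {a..b}"
  unfolding L2_on_def
proof safe
  show "v \<in> borel_measurable (lebesgue_on {a..b})"
    by (rule continuous_imp_measurable_on_sets_lebesgue[OF assms]) simp
  show "integrable (lebesgue_on {a..b}) (\<lambda>x. (norm (v x))\<^sup>2)"
    by (rule continuous_imp_integrable_real) (intro continuous_intros assms)
qed

lemma L2_on_continuous_mult:
  fixes u v :: "real \<Rightarrow> complex"
  assumes u: "u \<in> L2_on {a..b}" and v: "continuous_on {a..b} v"
  shows "(\<lambda>x. v x * u x) \<in> L2_on {a..b}"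
proof -
  have "bounded (v ` {a..b})" by (intro compact_imp_bounded compact_continuous_image v) simp
  then obtain B where "\<And>x. x \<in> {a..b} \<Longrightarrow> norm (v x) \<le> B" unfolding bounded_iff by blast
  then show ?thesis
    using L2_on_bounded_mult[OF u] L2_on_continuous[OF v] by auto
qed

lemma L2_on_add:
  fixes u v :: "'a::euclidean_space \<Rightarrow> complex"
  assumes u: "u \<in> L2_on S" and v: "v \<in> L2_on S"
  shows "(\<lambda>x. u x + v x) \<in> L2_on S"
  unfolding L2_on_def
proof safe
  show m: "(\<lambda>x. u x + v x) \<in> borel_measurable (lebesgue_on S)"
    using u v by (auto simp: L2_on_def)
  have "integrable (lebesgue_on S) (\<lambda>x. 2 * (norm (u x))\<^sup>2 + 2 * (norm (v x))\<^sup>2)"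
    using u v by (auto simp: L2_on_def)
  then show "integrable (lebesgue_on S) (\<lambda>x. (norm (u x + v x))\<^sup>2)"
  proof (rule Bochner_Integration.integrable_bound)
    have "(norm (u x + v x))\<^sup>2 \<le> 2 * (norm (u x))\<^sup>2 + 2 * (norm (v x))\<^sup>2" for x
    proof -
      have "(norm (u x + v x))\<^sup>2 \<le> (norm (u x) + norm (v x))\<^sup>2"
        by (intro power_mono norm_triangle_ineq) simp
      also have "\<dots> \<le> 2 * (norm (u x))\<^sup>2 + 2 * (norm (v x))\<^sup>2"
        using zero_le_power2[of "norm (u x) - norm (v x)"] by (simp add: power2_sum power2_diff)
      finally show ?thesis .
    qed
    then show "AE x in lebesgue_on S. norm ((norm (u x + v x))\<^sup>2) \<le> norm (2 * (norm (u x))\<^sup>2 + 2 * (norm (v x))\<^sup>2)"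
      by (intro AE_I2) simp
  qed (use m in measurable)
qed

lemma L2_on_cmult: "u \<in> L2_on S \<Longrightarrow> (\<lambda>x. c * u x) \<in> L2_on S"
  by (auto simp: L2_on_def norm_mult power_mult_distrib)

lemma L2_on_diff: "u \<in> L2_on S \<Longrightarrow> v \<in> L2_on S \<Longrightarrow> (\<lambda>x. u x - v x) \<in> L2_on S"
  using L2_on_add[of u S "\<lambda>x. (-1) * v x"] L2_on_cmult[of v S "-1"] by simp

text \<open>Measurability already provides continuous functions converging off a null set. Composing
  them with the nearest point projection onto the ball of radius N enforces the bound and leaves the
  limit unchanged, so that dominated convergence becomes available.\<close>

lemma bounded_measurable_AE_lim_continuous:
  fixes h :: "real \<Rightarrow> complex"
  assumes h: "h \<in> borel_measurable (lebesgue_on {a..b})"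
    and N: "0 \<le> N" "\<And>x. x \<in> {a..b} \<Longrightarrow> norm (h x) \<le> N"
  obtains p where "\<And>n. continuous_on UNIV (p n)" "\<And>n x. norm (p n x) \<le> N"
    "AE x in lebesgue_on {a..b}. (\<lambda>n. p n x) \<longlonglongrightarrow> h x"
proof -
  have "h measurable_on {a..b}" using h by (simp add: measurable_on_iff_borel_measurable)
  then obtain Z g where Z: "negligible Z" and g: "\<And>n. continuous_on UNIV (g n)"
    and lim: "\<And>x. x \<notin> Z \<Longrightarrow> (\<lambda>n. g n x) \<longlonglongrightarrow> (if x \<in> {a..b} then h x else 0)"
    unfolding measurable_on_def by blast
  define q where "q = closest_point (cball (0::complex) N)"
  have q: "continuous_on UNIV q" "norm (q z) \<le> N" "norm z \<le> N \<Longrightarrow> q z = z" for z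
    unfolding q_def using N(1) closest_point_in_set[of "cball (0::complex) N" z]
    by (auto intro!: continuous_on_closest_point closest_point_self)
  show thesis
  proof
    show "continuous_on UNIV (\<lambda>x. q (g n x))" for n
      by (rule continuous_on_compose2[OF q(1) g]) simp
    show "norm (q (g n x)) \<le> N" for n x by (rule q)
    have "AE x in lebesgue. x \<notin> Z"
      using Z by (intro AE_not_in) (simp add: negligible_iff_null_sets)
    then have "AE x in lebesgue. x \<in> {a..b} \<longrightarrow> (\<lambda>n. q (g n x)) \<longlonglongrightarrow> h x"
    proof (rule eventually_mono, intro impI)
      fix x assume x: "x \<notin> Z" "x \<in> {a..b}"
      have "(\<lambda>n. q (g n x)) \<longlonglongrightarrow> q (h x)"
        using continuous_on_tendsto_compose[OF q(1), of "\<lambda>n. g n x" "h x" sequentially] lim[OF x(1)] x(2) by simp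
      then show "(\<lambda>n. q (g n x)) \<longlonglongrightarrow> h x" using q(3) N(2) x by simp
    qed
    then show "AE x in lebesgue_on {a..b}. (\<lambda>n. q (g n x)) \<longlonglongrightarrow> h x"
      by (simp add: AE_restrict_space_iff)
  qed
qed

text \<open>Two dominated limits: u is cut to 0 where |u| > N (dominated by |u|^2), then the bounded
  truncation is approximated by continuous functions with the same bound N (dominated by (2N)^2).
  Each squared error is below e/4, and |a + b|^2 <= 2|a|^2 + 2|b|^2 yields e.\<close>

lemma L2_on_approx_continuous:
  fixes u :: "real \<Rightarrow> complex"
  assumes u: "u \<in> L2_on {a..b}" and e: "0 < e"
  obtains p where "continuous_on UNIV p" "(LINT x|lebesgue_on {a..b}. (norm (p x - u x))\<^sup>2) < e"
proof -
  let ?M = "lebesgue_on {a..b}"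
  have um [measurable]: "u \<in> borel_measurable ?M" and u2: "integrable ?M (\<lambda>x. (norm (u x))\<^sup>2)"
    using u by (simp_all add: L2_on_def)
  define v where "v = (\<lambda>N::nat. \<lambda>x. if norm (u x) \<le> real N then u x else 0)"
  have vm [measurable]: "v N \<in> borel_measurable ?M" for N unfolding v_def by measurable
  have vN: "norm (v N x) \<le> real N" for N x by (simp add: v_def)
  have "(\<lambda>N. LINT x|?M. (norm (v N x - u x))\<^sup>2) \<longlonglongrightarrow> (LINT x|?M. 0)"
  proof (rule integral_dominated_convergence[OF _ _ u2])
    show "AE x in ?M. (\<lambda>N. (norm (v N x - u x))\<^sup>2) \<longlonglongrightarrow> 0"
    proof (intro AE_I2 tendsto_eventually)
      fix x
      show "\<forall>\<^sub>F N in sequentially. (norm (v N x - u x))\<^sup>2 = 0"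
        using eventually_ge_at_top[of "nat \<lceil>norm (u x)\<rceil>"]
        by (rule eventually_mono) (simp add: v_def nat_ceiling_le_eq)
    qed
    show "AE x in ?M. norm ((norm (v N x - u x))\<^sup>2) \<le> (norm (u x))\<^sup>2" for N
      by (intro AE_I2) (simp add: v_def)
  qed measurable
  then have "\<forall>\<^sub>F N in sequentially. (LINT x|?M. (norm (v N x - u x))\<^sup>2) < e / 4"
    using e by (intro order_tendstoD) auto
  then obtain N where N: "(LINT x|?M. (norm (v N x - u x))\<^sup>2) < e / 4"
    using eventually_happens by fastforce
  obtain p where p: "\<And>n. continuous_on UNIV (p n)" "\<And>n x. norm (p n x) \<le> real N"
    "AE x in ?M. (\<lambda>n. p n x) \<longlonglongrightarrow> v N x"
    using bounded_measurable_AE_lim_continuous[OF vm, of "real N" N] vN by auto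
  have pm [measurable]: "p n \<in> borel_measurable ?M" for n
    by (rule continuous_imp_measurable_on_sets_lebesgue) (use continuous_on_subset[OF p(1)[of n]] in auto)
  have "(\<lambda>n. LINT x|?M. (norm (p n x - v N x))\<^sup>2) \<longlonglongrightarrow> (LINT x|?M. 0)"
  proof (rule integral_dominated_convergence)
    show "integrable ?M (\<lambda>x. (2 * real N)\<^sup>2)" by (rule Lebesgue_Measure.integrable_const_ivl)
    show "AE x in ?M. (\<lambda>n. (norm (p n x - v N x))\<^sup>2) \<longlonglongrightarrow> 0"
      using p(3)
    proof (rule eventually_mono)
      fix x assume "(\<lambda>n. p n x) \<longlonglongrightarrow> v N x"
      then have "(\<lambda>n. (norm (p n x - v N x))\<^sup>2) \<longlonglongrightarrow> (norm (v N x - v N x))\<^sup>2" by (intro tendsto_intros)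
      then show "(\<lambda>n. (norm (p n x - v N x))\<^sup>2) \<longlonglongrightarrow> 0" by simp
    qed
    show "AE x in ?M. norm ((norm (p n x - v N x))\<^sup>2) \<le> (2 * real N)\<^sup>2" for n
    proof (intro AE_I2)
      fix x
      have "norm (p n x - v N x) \<le> 2 * real N"
        using norm_triangle_ineq4[of "p n x" "v N x"] p(2)[of n x] vN[of N x] by linarith
      then show "norm ((norm (p n x - v N x))\<^sup>2) \<le> (2 * real N)\<^sup>2"
        using power_mono[of "norm (p n x - v N x)" "2 * real N" 2] by simp
    qed
  qed measurable
  then have "\<forall>\<^sub>F n in sequentially. (LINT x|?M. (norm (p n x - v N x))\<^sup>2) < e / 4"
    using e by (intro order_tendstoD) auto
  then obtain n where n: "(LINT x|?M. (norm (p n x - v N x))\<^sup>2) < e / 4"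
    using eventually_happens by fastforce
  have cont: "continuous_on {a..b} (p n)" by (rule continuous_on_subset[OF p(1)]) simp
  have vL: "v N \<in> L2_on {a..b}"
    using L2_on_bounded_mult[OF L2_on_continuous[OF continuous_on_const[of _ 1]] vm vN, of N] by simp
  note L = L2_on_diff[OF L2_on_continuous[OF cont] vL] L2_on_diff[OF vL u]
  have i: "integrable ?M (\<lambda>x. (norm (p n x - v N x))\<^sup>2)" "integrable ?M (\<lambda>x. (norm (v N x - u x))\<^sup>2)"
    "integrable ?M (\<lambda>x. (norm (p n x - u x))\<^sup>2)"
    using L L2_on_diff[OF L2_on_continuous[OF cont] u] by (simp_all add: L2_on_def)
  have "(LINT x|?M. (norm (p n x - u x))\<^sup>2) \<le>
      (LINT x|?M. 2 * (norm (p n x - v N x))\<^sup>2 + 2 * (norm (v N x - u x))\<^sup>2)"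
  proof (rule integral_mono)
    fix x
    have "(norm (p n x - u x))\<^sup>2 \<le> (norm (p n x - v N x) + norm (v N x - u x))\<^sup>2"
      using norm_triangle_ineq[of "p n x - v N x" "v N x - u x"] by (intro power_mono) auto
    also have "\<dots> \<le> 2 * (norm (p n x - v N x))\<^sup>2 + 2 * (norm (v N x - u x))\<^sup>2"
      using zero_le_power2[of "norm (p n x - v N x) - norm (v N x - u x)"] by (simp add: power2_sum power2_diff)
    finally show "(norm (p n x - u x))\<^sup>2 \<le> 2 * (norm (p n x - v N x))\<^sup>2 + 2 * (norm (v N x - u x))\<^sup>2" .
  qed (use i in auto)
  also have "\<dots> < e" using n N i by simp
  finally show thesis using that p(1) by blast
qed

section \<open>Primitives of square integrable functions\<close>

lemma integrable_lebesgue_on_Icc_integrable_on: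
  fixes h :: "real \<Rightarrow> complex"
  assumes "integrable (lebesgue_on {a..b}) h" "{c..d} \<subseteq> {a..b}"
  shows "h integrable_on {c..d}" "integrable (lebesgue_on {c..d}) h"
proof -
  have "h absolutely_integrable_on {a..b}"
    using assms by (simp add: integrable_lebesgue_on_iff_absolutely)
  then have "h absolutely_integrable_on {c..d}"
    using absolutely_integrable_on_subinterval assms(2) by blast
  then show "h integrable_on {c..d}" "integrable (lebesgue_on {c..d}) h"
    by (simp_all add: integrable_lebesgue_on_iff_absolutely absolutely_integrable_on_def)
qed

lemma norm_integral_le_L1:
  fixes h :: "real \<Rightarrow> complex"
  assumes h: "integrable (lebesgue_on {a..b}) h" and cd: "{c..d} \<subseteq> {a..b}"
  shows "norm (integral {c..d} h) \<le> (LINT x|lebesgue_on {a..b}. norm (h x))"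
proof -
  have h': "h absolutely_integrable_on {a..b}"
    using h by (simp add: integrable_lebesgue_on_iff_absolutely)
  have "h absolutely_integrable_on {c..d}"
    using absolutely_integrable_on_subinterval h' cd by blast
  then have "norm (integral {c..d} h) \<le> integral {c..d} (\<lambda>x. norm (h x))"
    by (intro integral_norm_bound_integral) (auto simp: absolutely_integrable_on_def)
  also have "\<dots> \<le> integral {a..b} (\<lambda>x. norm (h x))"
    using h' \<open>h absolutely_integrable_on {c..d}\<close>
    by (intro integral_subset_le cd) (auto simp: absolutely_integrable_on_def)
  also have "\<dots> = (LINT x|lebesgue_on {a..b}. norm (h x))"
    by (rule lebesgue_integral_eq_integral[symmetric]) (use h in auto)
  finally show ?thesis .
qed

lemma integral_cong_AE_lebesgue_on:
  fixes g h :: "real \<Rightarrow> complex"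
  assumes ae: "AE x in lebesgue_on {a..b}. g x = h x" and cd: "{c..d} \<subseteq> {a..b}"
  shows "integral {c..d} g = integral {c..d} h"
proof -
  have "AE x in lebesgue. x \<in> {a..b} \<longrightarrow> g x = h x"
    using ae by (subst (asm) AE_restrict_space_iff) auto
  then obtain N where N: "N \<in> null_sets lebesgue" "\<And>x. x \<in> space lebesgue - N \<Longrightarrow> x \<in> {a..b} \<longrightarrow> g x = h x"
    by (rule AE_E3) blast
  show ?thesis
    by (rule integral_spike[of N]) (use N cd in \<open>auto simp: negligible_iff_null_sets\<close>)
qed

text \<open>The absolutely continuous functions with square integrable derivative, that is, the
  continuous representatives of W^{1,2}. The identity is demanded at every point of the closed
  interval, so values at end points make sense.\<close>

definition primitive_on :: "real \<Rightarrow> real \<Rightarrow> (real \<Rightarrow> complex) \<Rightarrow> (real \<Rightarrow> complex) \<Rightarrow> bool" where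
  "primitive_on a b u g \<longleftrightarrow> g \<in> L2_on {a..b} \<and> (\<forall>x\<in>{a..b}. u x = u a + integral {a..x} g)"

lemma primitive_onI:
  assumes "g \<in> L2_on {a..b}" "\<And>x. x \<in> {a..b} \<Longrightarrow> u x = c + integral {a..x} g"
  shows "primitive_on a b u g"
  unfolding primitive_on_def
proof safe
  fix x assume x: "x \<in> {a..b}"
  have "u a = c" using assms(2)[of a] x by simp
  then show "u x = u a + integral {a..x} g" using assms(2)[OF x] by simp
qed (rule assms(1))

lemma primitive_on_L2: "primitive_on a b u g \<Longrightarrow> g \<in> L2_on {a..b}"
  and primitive_on_eq: "primitive_on a b u g \<Longrightarrow> x \<in> {a..b} \<Longrightarrow> u x = u a + integral {a..x} g"
  unfolding primitive_on_def by blast+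

lemma primitive_on_cong:
  assumes "primitive_on a b u g" "\<And>x. x \<in> {a..b} \<Longrightarrow> u x = v x"
    and ae: "AE x in lebesgue_on {a..b}. g x = h x"
  shows "primitive_on a b v h"
  unfolding primitive_on_def
proof safe
  show "h \<in> L2_on {a..b}" using L2_on_cong_AE[OF _ primitive_on_L2[OF assms(1)] ae] by simp
  fix x assume x: "x \<in> {a..b}"
  then have "integral {a..x} h = integral {a..x} g"
    using integral_cong_AE_lebesgue_on[OF ae, of a x] by auto
  then show "v x = v a + integral {a..x} h"
    using primitive_on_eq[OF assms(1) x] assms(2)[OF x] assms(2)[of a] x by simp
qed

lemma primitive_on_continuous:
  assumes "primitive_on a b u g"
  shows "continuous_on {a..b} u"
proof -
  have "g integrable_on {a..b}"
    using integrable_lebesgue_on_Icc_integrable_on(1)[OF L2_on_imp_integrable(1)[OF primitive_on_L2[OF assms]]] by simp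
  then have "continuous_on {a..b} (\<lambda>x. u a + integral {a..x} g)"
    by (intro continuous_intros indefinite_integral_continuous_1)
  then show ?thesis
    by (rule continuous_on_eq) (rule primitive_on_eq[OF assms, symmetric])
qed

lemma primitive_on_has_vector_derivative:
  assumes "continuous_on {a..b} g"
    and "\<And>x. x \<in> {a..b} \<Longrightarrow> (u has_vector_derivative g x) (at x within {a..b})"
  shows "primitive_on a b u g"
  unfolding primitive_on_def
proof safe
  show "g \<in> L2_on {a..b}" by (rule L2_on_continuous[OF assms(1)])
  fix x assume x: "x \<in> {a..b}"
  have "(g has_integral u x - u a) {a..x}"
  proof (rule fundamental_theorem_of_calculus)
    show "(u has_vector_derivative g t) (at t within {a..x})" if "t \<in> {a..x}" for t
      by (rule has_vector_derivative_within_subset[OF assms(2)]) (use that x in auto)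
  qed (use x in auto)
  then show "u x = u a + integral {a..x} g" by (simp add: integral_unique)
qed

lemma primitive_on_add:
  assumes "primitive_on a b u g" "primitive_on a b v h"
  shows "primitive_on a b (\<lambda>x. u x + v x) (\<lambda>x. g x + h x)"
  unfolding primitive_on_def
proof safe
  note gh = primitive_on_L2[OF assms(1)] primitive_on_L2[OF assms(2)]
  show "(\<lambda>x. g x + h x) \<in> L2_on {a..b}" by (intro L2_on_add gh)
  fix x assume x: "x \<in> {a..b}"
  have "g integrable_on {a..x}" "h integrable_on {a..x}"
    using gh[THEN L2_on_imp_integrable(1), THEN integrable_lebesgue_on_Icc_integrable_on(1)] x by auto
  then show "u x + v x = u a + v a + integral {a..x} (\<lambda>x. g x + h x)"
    using primitive_on_eq[OF assms(1) x] primitive_on_eq[OF assms(2) x] by (simp add: Henstock_Kurzweil_Integration.integral_add)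
qed

lemma primitive_on_cmult:
  assumes "primitive_on a b u g"
  shows "primitive_on a b (\<lambda>x. c * u x) (\<lambda>x. c * g x)"
  unfolding primitive_on_def
proof safe
  show "(\<lambda>x. c * g x) \<in> L2_on {a..b}" by (intro L2_on_cmult primitive_on_L2[OF assms])
  fix x assume x: "x \<in> {a..b}"
  show "c * u x = c * u a + integral {a..x} (\<lambda>x. c * g x)"
    by (subst primitive_on_eq[OF assms x]) (simp add: algebra_simps)
qed

text \<open>Integrating continuous approximations of g from a, with the same initial value, gives
  C^1 functions; their distance to u is at most the L^1 distance of the derivatives, uniformly in x.
  Classical differentiation rules are carried over to L^2 derivatives along these sequences.\<close>

lemma primitive_on_approx:
  assumes "primitive_on a b u g"
  obtains p w where "\<And>n. continuous_on {a..b} (p n)"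
    "\<And>n x. x \<in> {a..b} \<Longrightarrow> (w n has_vector_derivative p n x) (at x within {a..b})"
    "(\<lambda>n::nat. LINT x|lebesgue_on {a..b}. norm (p n x - g x)) \<longlonglongrightarrow> 0"
    "\<And>n. w n a = u a" "uniform_limit {a..b} w u sequentially"
proof -
  let ?M = "lebesgue_on {a..b}"
  have g: "g \<in> L2_on {a..b}" and u: "\<And>x. x \<in> {a..b} \<Longrightarrow> u x = u a + integral {a..x} g"
    using primitive_on_L2[OF assms] primitive_on_eq[OF assms] .
  have "\<exists>p. continuous_on UNIV p \<and> (LINT x|?M. (norm (p x - g x))\<^sup>2) < inverse (real (Suc n))" for n
    using L2_on_approx_continuous[OF g, of "inverse (real (Suc n))"] by (metis inverse_positive_iff_positive of_nat_0_less_iff zero_less_Suc)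
  then obtain p where p: "\<And>n. continuous_on UNIV (p n)"
    and pn: "\<And>n. (LINT x|?M. (norm (p n x - g x))\<^sup>2) < inverse (real (Suc n))" by metis
  have pc: "continuous_on {a..b} (p n)" for n by (rule continuous_on_subset[OF p]) simp
  have pL: "(\<lambda>x. p n x - g x) \<in> L2_on {a..b}" for n
    by (intro L2_on_diff g L2_on_continuous pc)
  define \<epsilon> where "\<epsilon> n = (LINT x|?M. norm (p n x - g x))" for n
  have e0: "0 \<le> \<epsilon> n" for n unfolding \<epsilon>_def by simp
  have "(\<lambda>n. (\<epsilon> n)\<^sup>2) \<longlonglongrightarrow> 0"
  proof (rule tendsto_sandwich[of "\<lambda>_. 0" _ _ "\<lambda>n. \<bar>b - a\<bar> * inverse (real (Suc n))"])
    show "(\<lambda>n. \<bar>b - a\<bar> * inverse (real (Suc n))) \<longlonglongrightarrow> 0"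
      using tendsto_mult_left[OF LIMSEQ_inverse_real_of_nat, of "\<bar>b - a\<bar>"] by simp
    have "(\<epsilon> n)\<^sup>2 \<le> \<bar>b - a\<bar> * inverse (real (Suc n))" for n
      using L2_on_imp_integrable(2)[OF pL[of n]] mult_left_mono[OF less_imp_le[OF pn[of n]], of "\<bar>b - a\<bar>"]
      unfolding \<epsilon>_def by simp
    then show "\<forall>\<^sub>F n in sequentially. (\<epsilon> n)\<^sup>2 \<le> \<bar>b - a\<bar> * inverse (real (Suc n))" by simp
  qed simp_all
  then have elim: "\<epsilon> \<longlonglongrightarrow> 0"
    using tendsto_real_sqrt[of "\<lambda>n. (\<epsilon> n)\<^sup>2" 0 sequentially] e0 by simp
  define w where "w n x = u a + integral {a..x} (p n)" for n x
  show thesis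
  proof
    show "continuous_on {a..b} (p n)" for n by (rule pc)
    show "(w n has_vector_derivative p n x) (at x within {a..b})" if "x \<in> {a..b}" for n x
      unfolding w_def using integral_has_vector_derivative[OF pc that]
      by (auto intro!: derivative_eq_intros)
    show "(\<lambda>n::nat. LINT x|lebesgue_on {a..b}. norm (p n x - g x)) \<longlonglongrightarrow> 0"
      using elim unfolding \<epsilon>_def .
    show "w n a = u a" for n by (simp add: w_def)
    show "uniform_limit {a..b} w u sequentially"
    proof (rule uniform_limitI)
      fix e :: real assume "0 < e"
      then have "\<forall>\<^sub>F n in sequentially. \<epsilon> n < e" using elim by (intro order_tendstoD) auto
      then show "\<forall>\<^sub>F n in sequentially. \<forall>x\<in>{a..b}. dist (w n x) (u x) < e"
      proof (rule eventually_mono, intro ballI)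
        fix n x assume n: "\<epsilon> n < e" and x: "x \<in> {a..b}"
        have "p n integrable_on {a..x}" "g integrable_on {a..x}"
          using L2_on_continuous[OF pc[of n]] g x
          by (auto dest!: L2_on_imp_integrable(1) intro!: integrable_lebesgue_on_Icc_integrable_on(1)[of a b])
        then have "w n x - u x = integral {a..x} (\<lambda>x. p n x - g x)"
          unfolding w_def using u[OF x] by (simp add: Henstock_Kurzweil_Integration.integral_diff)
        also have "norm \<dots> \<le> \<epsilon> n"
          unfolding \<epsilon>_def by (rule norm_integral_le_L1[OF L2_on_imp_integrable(1)[OF pL]]) (use x in auto)
        finally show "dist (w n x) (u x) < e" using n by (simp add: dist_norm)
      qed
    qed
  qed
qed

text \<open>Split m p - k g = m (p - g) + (m - k) g: the first term is small because m is uniformly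
  bounded and p converges in L^1, the second because m converges uniformly and g is
  integrable.\<close>

lemma tendsto_integral_L1_uniform:
  fixes p m :: "nat \<Rightarrow> real \<Rightarrow> complex" and g k :: "real \<Rightarrow> complex"
  assumes p: "\<And>n. continuous_on {a..b} (p n)" and g: "integrable (lebesgue_on {a..b}) g"
    and pg: "(\<lambda>n. LINT x|lebesgue_on {a..b}. norm (p n x - g x)) \<longlonglongrightarrow> 0"
    and m: "\<And>n. continuous_on {a..b} (m n)" and mk: "uniform_limit {a..b} m k sequentially"
    and x: "x \<in> {a..b}"
  shows "(\<lambda>n. integral {a..x} (\<lambda>t. m n t * p n t)) \<longlonglongrightarrow> integral {a..x} (\<lambda>t. k t * g t)"
proof -
  let ?M = "lebesgue_on {a..b}"
  have k: "continuous_on {a..b} k"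
    by (rule uniform_limit_theorem[OF _ mk]) (use m in auto)
  have "bounded (k ` {a..b})" by (intro compact_imp_bounded compact_continuous_image k) simp
  then obtain B where B: "\<And>x. x \<in> {a..b} \<Longrightarrow> norm (k x) \<le> B" unfolding bounded_iff by blast
  have cm: "v \<in> borel_measurable ?M" if "continuous_on {a..b} v" for v :: "real \<Rightarrow> complex"
    by (rule continuous_imp_measurable_on_sets_lebesgue[OF that]) simp
  have cI: "integrable ?M v" if "continuous_on {a..b} v" for v :: "real \<Rightarrow> complex"
    by (rule L2_on_imp_integrable(1)[OF L2_on_continuous[OF that]])
  have bI: "integrable ?M (\<lambda>t. v t * h t)"
    if v: "continuous_on {a..b} v" and h: "integrable ?M h" for v h :: "real \<Rightarrow> complex"
  proof -
    have "bounded (v ` {a..b})" by (intro compact_imp_bounded compact_continuous_image v) simp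
    then show ?thesis
      using absolutely_integrable_bounded_measurable_product[OF bilinear_times cm[OF v], of h] h
      by (simp add: integrable_lebesgue_on_iff_absolutely)
  qed
  define G where "G = (LINT t|?M. norm (g t))"
  have G0: "0 \<le> G" by (simp add: G_def)
  define \<epsilon> where "\<epsilon> n = (LINT x|?M. norm (p n x - g x))" for n
  have "(\<lambda>n. integral {a..x} (\<lambda>t. m n t * p n t) - integral {a..x} (\<lambda>t. k t * g t)) \<longlonglongrightarrow> 0"
  proof (rule LIMSEQ_I)
    fix r :: real assume r: "0 < r"
    \<comment> \<open>The bound 1 keeps |m n| below B + 1; the other bound makes s G at most r/2.
      The extra 1 in G + 1 avoids a division by zero.\<close>
    define s where "s = min 1 (r / (2 * (G + 1)))"
    have s: "0 < s" "s \<le> 1" "s \<le> r / (2 * (G + 1))"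
      using r G0 by (auto simp: s_def)
    then have s2: "s * (G + 1) \<le> r / 2"
      using G0 by (simp add: field_simps)
    have B0: "0 \<le> B" using B[OF x] norm_ge_zero order_trans by blast
    have "\<forall>\<^sub>F n in sequentially. \<forall>t\<in>{a..b}. dist (m n t) (k t) < s"
      using mk s(1) by (rule uniform_limitD)
    moreover have "\<forall>\<^sub>F n in sequentially. \<epsilon> n < r / (2 * (B + 1))"
      using pg r B0 unfolding \<epsilon>_def by (intro order_tendstoD) auto
    ultimately have "\<forall>\<^sub>F n in sequentially.
      norm (integral {a..x} (\<lambda>t. m n t * p n t) - integral {a..x} (\<lambda>t. k t * g t)) < r"
    proof (rule eventually_elim2)
      fix n assume mn: "\<forall>t\<in>{a..b}. dist (m n t) (k t) < s" and en: "\<epsilon> n < r / (2 * (B + 1))"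
      have i: "integrable ?M (\<lambda>t. m n t * p n t)" "integrable ?M (\<lambda>t. k t * g t)"
        by (intro bI m k g cI p)+
      then have i': "(\<lambda>t. m n t * p n t) integrable_on {a..x}" "(\<lambda>t. k t * g t) integrable_on {a..x}"
        using x by (auto intro!: integrable_lebesgue_on_Icc_integrable_on(1)[of a b])
      have i2: "integrable ?M (\<lambda>t. p n t - g t)" using cI[OF p] g by auto
      have "integral {a..x} (\<lambda>t. m n t * p n t) - integral {a..x} (\<lambda>t. k t * g t)
          = integral {a..x} (\<lambda>t. m n t * p n t - k t * g t)"
        using i' by (simp add: Henstock_Kurzweil_Integration.integral_diff)
      also have "norm \<dots> \<le> (LINT t|?M. norm (m n t * p n t - k t * g t))"
        by (rule norm_integral_le_L1) (use i x in auto)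
      also have "\<dots> \<le> (LINT t|?M. (B + 1) * norm (p n t - g t) + s * norm (g t))"
      proof (rule integral_mono)
        fix t assume "t \<in> space ?M"
        then have t: "t \<in> {a..b}" by simp
        have "norm (m n t) \<le> norm (k t) + dist (m n t) (k t)" 
          using norm_triangle_ineq2[of "m n t" "k t"] by (simp add: dist_norm)
        then have mB: "norm (m n t) \<le> B + 1" using B[OF t] mn t s(2) by fastforce
        have "m n t * p n t - k t * g t = m n t * (p n t - g t) + (m n t - k t) * g t"
          by (simp add: algebra_simps)
        also have "norm \<dots> \<le> norm (m n t) * norm (p n t - g t) + norm (m n t - k t) * norm (g t)"
          by (rule order_trans[OF norm_triangle_ineq]) (simp add: norm_mult)
        also have "\<dots> \<le> (B + 1) * norm (p n t - g t) + s * norm (g t)"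
          using mB mn t by (intro add_mono mult_right_mono) (auto simp: dist_norm intro: less_imp_le)
        finally show "norm (m n t * p n t - k t * g t) \<le> (B + 1) * norm (p n t - g t) + s * norm (g t)" .
      qed (use i i2 g in auto)
      also have "\<dots> = (B + 1) * \<epsilon> n + s * G" using i2 g by (simp add: \<epsilon>_def G_def)
      also have "\<dots> < r"
      proof -
        have "(B + 1) * \<epsilon> n < r / 2" using en B0 by (simp add: field_simps)
        moreover have "s * G \<le> r / 2" using s2 s(1) by (simp add: algebra_simps)
        ultimately show ?thesis by simp
      qed
      finally show "norm (integral {a..x} (\<lambda>t. m n t * p n t) - integral {a..x} (\<lambda>t. k t * g t)) < r" .
    qed
    then show "\<exists>no. \<forall>n\<ge>no. norm (integral {a..x} (\<lambda>t. m n t * p n t) - integral {a..x} (\<lambda>t. k t * g t) - 0) < r"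
      by (simp add: eventually_sequentially)
  qed
  then show ?thesis by (rule LIM_zero_cancel)
qed

text \<open>The product rule for the C^1 approximants of u and v, in integrated form, passes to the
  limit: the functions converge uniformly and their derivatives in L^1.\<close>

lemma primitive_on_mult:
  assumes u: "primitive_on a b u g" and v: "primitive_on a b v h"
  shows "primitive_on a b (\<lambda>x. u x * v x) (\<lambda>x. v x * g x + u x * h x)"
  unfolding primitive_on_def
proof safe
  have gL: "g \<in> L2_on {a..b}" and hL: "h \<in> L2_on {a..b}" using primitive_on_L2[OF u] primitive_on_L2[OF v] .
  note uc = primitive_on_continuous[OF u] and vc = primitive_on_continuous[OF v]
  show "(\<lambda>x. v x * g x + u x * h x) \<in> L2_on {a..b}"
    by (intro L2_on_add L2_on_continuous_mult gL hL uc vc)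
  fix x assume x: "x \<in> {a..b}"
  obtain p w where p: "\<And>n. continuous_on {a..b} (p n)"
    "\<And>n x. x \<in> {a..b} \<Longrightarrow> (w n has_vector_derivative p n x) (at x within {a..b})"
    "(\<lambda>n::nat. LINT x|lebesgue_on {a..b}. norm (p n x - g x)) \<longlonglongrightarrow> 0"
    "\<And>n. w n a = u a" "uniform_limit {a..b} w u sequentially"
    using primitive_on_approx[OF u] by blast
  obtain q z where q: "\<And>n. continuous_on {a..b} (q n)"
    "\<And>n x. x \<in> {a..b} \<Longrightarrow> (z n has_vector_derivative q n x) (at x within {a..b})"
    "(\<lambda>n::nat. LINT x|lebesgue_on {a..b}. norm (q n x - h x)) \<longlonglongrightarrow> 0"
    "\<And>n. z n a = v a" "uniform_limit {a..b} z v sequentially"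
    using primitive_on_approx[OF v] by blast
  have wc: "continuous_on {a..b} (w n)" and zc: "continuous_on {a..b} (z n)" for n
    using p(2) q(2) continuous_on_vector_derivative by blast+
  have eq: "w n x * z n x = u a * v a + (integral {a..x} (\<lambda>t. z n t * p n t) + integral {a..x} (\<lambda>t. w n t * q n t))" for n
  proof -
    have "primitive_on a b (\<lambda>x. w n x * z n x) (\<lambda>t. z n t * p n t + w n t * q n t)"
      by (rule primitive_on_has_vector_derivative)
         (auto intro!: continuous_intros wc zc p q derivative_eq_intros has_vector_derivative_mult[OF p(2) q(2), THEN has_vector_derivative_eq_rhs])
    then have "w n x * z n x = w n a * z n a + integral {a..x} (\<lambda>t. z n t * p n t + w n t * q n t)"
      using x by (rule primitive_on_eq)
    moreover have "(\<lambda>t. z n t * p n t) integrable_on {a..x}" "(\<lambda>t. w n t * q n t) integrable_on {a..x}"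
      by (rule integrable_continuous_real, rule continuous_on_subset[of "{a..b}"],
          use x in \<open>auto intro!: continuous_intros wc zc p q\<close>)+
    ultimately show ?thesis by (simp add: p(4) q(4) Henstock_Kurzweil_Integration.integral_add)
  qed
  have "(\<lambda>n. w n x * z n x) \<longlonglongrightarrow> u a * v a + (integral {a..x} (\<lambda>t. v t * g t) + integral {a..x} (\<lambda>t. u t * h t))"
    unfolding eq
    by (intro tendsto_intros tendsto_integral_L1_uniform[where b = b] p q L2_on_imp_integrable(1) gL hL wc zc x)
  moreover have "(\<lambda>n. w n x * z n x) \<longlonglongrightarrow> u x * v x"
    by (intro tendsto_intros tendsto_uniform_limitI[OF p(5)] tendsto_uniform_limitI[OF q(5)] x)
  ultimately have "u x * v x = u a * v a + (integral {a..x} (\<lambda>t. v t * g t) + integral {a..x} (\<lambda>t. u t * h t))"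
    using LIMSEQ_unique by blast
  moreover have "(\<lambda>t. v t * g t) integrable_on {a..x}" "(\<lambda>t. u t * h t) integrable_on {a..x}"
    using L2_on_imp_integrable(1)[OF L2_on_continuous_mult[OF gL vc]]
      L2_on_imp_integrable(1)[OF L2_on_continuous_mult[OF hL uc]] x
    by (auto intro!: integrable_lebesgue_on_Icc_integrable_on(1)[of a b])
  ultimately show "u x * v x = u a * v a + integral {a..x} (\<lambda>x. v x * g x + u x * h x)"
    by (simp add: Henstock_Kurzweil_Integration.integral_add)
qed

text \<open>As for products, but the reciprocals of the approximants must exist and converge
  uniformly. Compactness gives a positive minimum c of |u|, and late approximants stay above c/2 in
  absolute value.\<close>

lemma primitive_on_inverse:
  assumes u: "primitive_on a b u g" and nz: "\<And>x. x \<in> {a..b} \<Longrightarrow> u x \<noteq> 0"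
  shows "primitive_on a b (\<lambda>x. inverse (u x)) (\<lambda>x. - (inverse (u x))\<^sup>2 * g x)"
  unfolding primitive_on_def
proof safe
  have gL: "g \<in> L2_on {a..b}" by (rule primitive_on_L2[OF u])
  note uc = primitive_on_continuous[OF u]
  show "(\<lambda>x. - (inverse (u x))\<^sup>2 * g x) \<in> L2_on {a..b}"
    using nz by (intro L2_on_continuous_mult gL continuous_intros uc) auto
  fix x assume x: "x \<in> {a..b}"
  obtain p w where p: "\<And>n. continuous_on {a..b} (p n)"
    "\<And>n x. x \<in> {a..b} \<Longrightarrow> (w n has_vector_derivative p n x) (at x within {a..b})"
    "(\<lambda>n::nat. LINT x|lebesgue_on {a..b}. norm (p n x - g x)) \<longlonglongrightarrow> 0"
    "\<And>n. w n a = u a" "uniform_limit {a..b} w u sequentially"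
    using primitive_on_approx[OF u] by blast
  have "continuous_on {a..b} (\<lambda>x. norm (u x))" by (intro continuous_intros uc)
  then obtain y where y: "y \<in> {a..b}" "\<And>t. t \<in> {a..b} \<Longrightarrow> norm (u y) \<le> norm (u t)"
    using continuous_attains_inf[of "{a..b}" "\<lambda>x. norm (u x)"] x by auto
  define c where "c = norm (u y)"
  have c: "0 < c" "\<And>t. t \<in> {a..b} \<Longrightarrow> c \<le> norm (u t)" using y nz by (auto simp: c_def)
  have "\<forall>\<^sub>F n in sequentially. \<forall>t\<in>{a..b}. dist (w n t) (u t) < c / 2"
    using uniform_limitD[OF p(5), of "c / 2"] c by simp
  then obtain n0 where n0: "\<And>n t. n \<ge> n0 \<Longrightarrow> t \<in> {a..b} \<Longrightarrow> dist (w n t) (u t) < c / 2"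
    unfolding eventually_sequentially by blast
  \<comment> \<open>Dropping the first \<open>n0\<close> approximants makes every remaining one
    nonvanishing on the whole interval.\<close>
  define P W where "P n = p (n + n0)" and "W n = w (n + n0)" for n
  have wlow: "c / 2 \<le> norm (W n t)" if "t \<in> {a..b}" for n t
    using n0[of "n + n0" t] c(2)[OF that] norm_triangle_ineq2[of "u t" "W n t"] that
    by (simp add: dist_norm W_def norm_minus_commute)
  then have wnz: "W n t \<noteq> 0" if "t \<in> {a..b}" for n t using wlow[OF that, of n] c(1) by auto
  have Pc: "continuous_on {a..b} (P n)" for n unfolding P_def by (rule p)
  have WP: "(W n has_vector_derivative P n x) (at x within {a..b})" if "x \<in> {a..b}" for n x
    unfolding P_def W_def using that by (rule p)
  have Wc: "continuous_on {a..b} (W n)" for n using WP continuous_on_vector_derivative by blast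
  have Pg: "(\<lambda>n::nat. LINT x|lebesgue_on {a..b}. norm (P n x - g x)) \<longlonglongrightarrow> 0"
    unfolding P_def by (rule LIMSEQ_ignore_initial_segment[OF p(3)])
  have WU: "uniform_limit {a..b} W u sequentially"
  proof (rule uniform_limitI)
    fix e :: real assume "0 < e"
    then have "\<forall>\<^sub>F n in sequentially. \<forall>x\<in>{a..b}. dist (w n x) (u x) < e" by (rule uniform_limitD[OF p(5)])
    then show "\<forall>\<^sub>F n in sequentially. \<forall>x\<in>{a..b}. dist (W n x) (u x) < e"
      unfolding W_def by (simp add: eventually_sequentially_seg[where P = "\<lambda>n. \<forall>x\<in>{a..b}. dist (w n x) (u x) < e"])
  qed
  have bu: "bounded ((\<lambda>x. inverse (u x)) ` {a..b})"
    using nz by (intro compact_imp_bounded compact_continuous_image continuous_intros uc) auto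
  have WI: "uniform_limit {a..b} (\<lambda>n x. inverse (W n x)) (\<lambda>x. inverse (u x)) sequentially"
    using uniform_lim_inverse[OF WU, of c] c by (simp add: o_def)
  have WI2: "uniform_limit {a..b} (\<lambda>n x. - (inverse (W n x))\<^sup>2) (\<lambda>x. - (inverse (u x))\<^sup>2) sequentially"
    unfolding power2_eq_square by (intro uniform_limit_intros uniform_lim_mult WI bu)
  have eq: "inverse (W n x) = inverse (u a) + integral {a..x} (\<lambda>t. - (inverse (W n t))\<^sup>2 * P n t)" for n
  proof -
    have "primitive_on a b (\<lambda>x. inverse (W n x)) (\<lambda>t. - (inverse (W n t))\<^sup>2 * P n t)"
    proof (rule primitive_on_has_vector_derivative)
      show "continuous_on {a..b} (\<lambda>t. - (inverse (W n t))\<^sup>2 * P n t)"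
        using wnz by (intro continuous_intros Wc Pc) auto
      fix t assume t: "t \<in> {a..b}"
      have "(inverse has_field_derivative - (inverse (W n t))\<^sup>2) (at (W n t) within (W n ` {a..b}))"
        using DERIV_inverse[OF wnz[OF t, of n], of "W n ` {a..b}"] by (simp add: numeral_2_eq_2)
      from field_vector_diff_chain_within[OF WP[OF t] this]
      show "((\<lambda>x. inverse (W n x)) has_vector_derivative - (inverse (W n t))\<^sup>2 * P n t) (at t within {a..b})"
        by (simp add: o_def mult.commute)
    qed
    from primitive_on_eq[OF this x] show ?thesis by (simp add: W_def p(4))
  qed
  have "(\<lambda>n. inverse (W n x)) \<longlonglongrightarrow> inverse (u a) + integral {a..x} (\<lambda>t. - (inverse (u t))\<^sup>2 * g t)"
    unfolding eq using wnz
    by (intro tendsto_intros tendsto_integral_L1_uniform[OF Pc _ Pg _ WI2 x] L2_on_imp_integrable(1)[OF gL]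
          continuous_intros Wc) auto
  moreover have "(\<lambda>n. inverse (W n x)) \<longlonglongrightarrow> inverse (u x)"
    by (rule tendsto_uniform_limitI[OF WI x])
  ultimately show "inverse (u x) = inverse (u a) + integral {a..x} (\<lambda>x. - (inverse (u x))\<^sup>2 * g x)"
    using LIMSEQ_unique by blast
qed

section \<open>Smooth bump functions\<close>

text \<open>The smooth function exp(-1/x), continued by 0. The polynomial factor in 1/x makes the
  family stable under differentiation.\<close>

definition flat :: "(real \<Rightarrow> real) \<Rightarrow> real \<Rightarrow> real" where
  "flat p x = (if 0 < x then p (inverse x) * exp (- inverse x) else 0)"

lemma polynomial_times_exp_tendsto_0:
  assumes "real_polynomial_function (r :: real \<Rightarrow> real)"
  shows "((\<lambda>y. r y * exp (- y)) \<longlongrightarrow> 0) at_top"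
proof -
  obtain c n where r: "r = (\<lambda>x. \<Sum>i\<le>n. c i * x ^ i)"
    using assms real_polynomial_function_iff_sum by blast
  have "((\<lambda>y. \<Sum>i\<le>n. c i * (y ^ i / exp y)) \<longlongrightarrow> (\<Sum>i\<le>n. c i * 0)) at_top"
    by (intro tendsto_intros tendsto_power_div_exp_0)
  then show ?thesis
    unfolding r by (simp add: sum_distrib_right exp_minus divide_inverse mult.assoc)
qed

lemma flat_has_derivative_flat:
  assumes p: "real_polynomial_function p"
  shows "\<exists>q. real_polynomial_function q \<and> (\<forall>x. (flat p has_real_derivative flat q x) (at x))"
proof -
  obtain p' where p': "real_polynomial_function p'" "\<And>x. (p has_real_derivative p' x) (at x)"
    using has_real_derivative_polynomial_function[OF p] by blast
  have id: "real_polynomial_function (\<lambda>y::real. y)" by (intro real_polynomial_function.intros(1)) simp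
  \<comment> \<open>With y = 1/x, the chain rule turns the derivative of p(1/x) exp(-1/x) into y^2
    (p(y) - p'(y)) exp(-y).\<close>
  define q where "q y = (y * y) * (p y + (-1) * p' y)" for y
  have q: "real_polynomial_function q"
    unfolding q_def by (intro real_polynomial_function.intros(2-) id p p'(1))
  have "(flat p has_real_derivative flat q x) (at x)" for x
  proof (cases x "0::real" rule: linorder_cases)
    case greater
    have "((\<lambda>x. p (inverse x) * exp (- inverse x)) has_real_derivative flat q x) (at x)"
      using greater
      by (auto intro!: derivative_eq_intros DERIV_chain2[OF p'(2)] simp: flat_def q_def field_simps power2_eq_square)
    then show ?thesis
      by (rule has_field_derivative_transform_within_open[of _ _ _ "{0<..}"])
         (use greater in \<open>auto simp: flat_def\<close>)
  next
    case less
    have "((\<lambda>x. 0) has_real_derivative flat q x) (at x)" using less by (simp add: flat_def)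
    then show ?thesis
      by (rule has_field_derivative_transform_within_open[of _ _ _ "{..<0}"])
         (use less in \<open>auto simp: flat_def\<close>)
  next
    case equal
    have "((\<lambda>y. (flat p y - flat p 0) / (y - 0)) \<longlongrightarrow> 0) (at_left 0)"
    proof (rule tendsto_eventually)
      show "\<forall>\<^sub>F y in at_left 0. (flat p y - flat p 0) / (y - 0) = 0"
        unfolding eventually_at_filter by (simp add: flat_def)
    qed
    moreover have "((\<lambda>y. (flat p y - flat p 0) / (y - 0)) \<longlongrightarrow> 0) (at_right 0)"
    proof -
      \<comment> \<open>The right difference quotient at 0 is again a polynomial in the reciprocal
        times the decaying exponential, so it tends to 0.\<close>
      have "((\<lambda>y. (inverse y * p (inverse y)) * exp (- inverse y)) \<longlongrightarrow> 0) (at_right 0)"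
        by (rule filterlim_compose[OF polynomial_times_exp_tendsto_0 filterlim_inverse_at_top_right])
           (intro real_polynomial_function.intros(2-) id p)
      moreover have "\<forall>\<^sub>F y in at_right 0. (inverse y * p (inverse y)) * exp (- inverse y) = (flat p y - flat p 0) / (y - 0)"
        unfolding eventually_at_filter by (simp add: flat_def field_simps)
      ultimately show ?thesis by (rule Lim_transform_eventually)
    qed
    ultimately have "((\<lambda>y. (flat p y - flat p 0) / (y - 0)) \<longlongrightarrow> 0) (at 0)"
      by (simp add: filterlim_split_at)
    then show ?thesis using equal by (simp add: has_field_derivative_iff flat_def)
  qed
  with q show ?thesis by blast
qed

text \<open>Smoothness by construction: every member has a derivative in the same class, so all
  iterates of \<open>deriv\<close> are differentiable without any formula for them. The clause
  \<open>antideriv\<close> keeps antiderivatives of bumps inside the class.\<close>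

inductive smooth_gen :: "(real \<Rightarrow> real) \<Rightarrow> bool" where
  polynomial: "real_polynomial_function p \<Longrightarrow> smooth_gen p"
| flat: "real_polynomial_function p \<Longrightarrow> smooth_gen (\<lambda>x. flat p (c * x + d))"
| add: "smooth_gen u \<Longrightarrow> smooth_gen v \<Longrightarrow> smooth_gen (\<lambda>x. u x + v x)"
| mult: "smooth_gen u \<Longrightarrow> smooth_gen v \<Longrightarrow> smooth_gen (\<lambda>x. u x * v x)"
| antideriv: "smooth_gen u \<Longrightarrow> (\<And>x. (v has_real_derivative u x) (at x)) \<Longrightarrow> smooth_gen v"

lemma smooth_gen_has_derivative:
  assumes "smooth_gen u"
  shows "\<exists>v. smooth_gen v \<and> (\<forall>x. (u has_real_derivative v x) (at x))"
  using assms
proof induction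
  case (polynomial p)
  then show ?case using has_real_derivative_polynomial_function smooth_gen.polynomial by blast
next
  case (flat p c d)
  then obtain q where q: "real_polynomial_function q" "\<And>x. (flat p has_real_derivative flat q x) (at x)"
    using flat_has_derivative_flat by blast
  have "((\<lambda>x. flat p (c * x + d)) has_real_derivative c * flat q (c * x + d)) (at x)" for x
    by (rule DERIV_cong[OF DERIV_chain2[OF q(2)]]) (auto intro!: derivative_eq_intros)
  moreover have "smooth_gen (\<lambda>x. c * flat q (c * x + d))"
    by (intro smooth_gen.mult smooth_gen.flat smooth_gen.polynomial q) (rule real_polynomial_function.intros(2))
  ultimately show ?case by blast
next
  case (add u v)
  then obtain u' v' where "smooth_gen u'" "\<And>x. (u has_real_derivative u' x) (at x)"
    "smooth_gen v'" "\<And>x. (v has_real_derivative v' x) (at x)" by blast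
  then show ?case by (intro exI[of _ "\<lambda>x. u' x + v' x"]) (auto intro!: smooth_gen.add DERIV_add)
next
  case (mult u v)
  then obtain u' v' where "smooth_gen u'" "\<And>x. (u has_real_derivative u' x) (at x)"
    "smooth_gen v'" "\<And>x. (v has_real_derivative v' x) (at x)" by blast
  with mult.hyps show ?case by (intro exI[of _ "\<lambda>x. u' x * v x + v' x * u x"])
    (auto intro!: smooth_gen.intros(3,4) DERIV_mult)
qed blast

lemma smooth_gen_deriv_funpow: "smooth_gen u \<Longrightarrow> smooth_gen ((deriv ^^ n) u)"
proof (induction n arbitrary: u)
  case (Suc n)
  obtain v where v: "smooth_gen v" "\<And>x. (u has_real_derivative v x) (at x)"
    using smooth_gen_has_derivative[OF Suc.prems] by blast
  then have "deriv u = v" by (intro ext DERIV_imp_deriv)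
  then show ?case using Suc.IH[OF v(1)] by (simp del: funpow.simps add: funpow_Suc_right)
qed simp

lemma smooth_gen_continuous: "smooth_gen u \<Longrightarrow> continuous_on S u"
  using smooth_gen_has_derivative by (metis DERIV_continuous_on has_field_derivative_at_within)

text \<open>Test functions whose smoothness is known by construction; they suffice to detect
  functions that vanish almost everywhere and to recognise constants.\<close>

definition bump :: "real \<Rightarrow> real \<Rightarrow> (real \<Rightarrow> real) \<Rightarrow> bool" where
  "bump a b u \<longleftrightarrow> smooth_gen u \<and> (\<exists>c d. a < c \<and> d < b \<and> (\<forall>x. x \<notin> {c..d} \<longrightarrow> u x = 0))"

lemma bump_test_functions: "bump a b u \<Longrightarrow> u \<in> test_functions a b"
  unfolding bump_def test_functions_def
  using smooth_gen_deriv_funpow smooth_gen_has_derivative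
  by (auto simp: differentiable_on_def) (metis differentiableI has_field_derivative_imp_has_derivative has_derivative_at_withinI)

text \<open>The shift by 1 pushes the support to distance 1/n from both end points; the factor n
  makes both arguments tend to infinity inside the interval, so the values tend to 1 pointwise. No
  plateau is required, only this limit and the bounds 0 and 1.\<close>

definition cutoff :: "real \<Rightarrow> real \<Rightarrow> nat \<Rightarrow> real \<Rightarrow> real" where
  "cutoff a b n x = flat (\<lambda>_. 1) (real n * (x - a) - 1) * flat (\<lambda>_. 1) (real n * (b - x) - 1)"

lemma smooth_gen_cutoff: "smooth_gen (cutoff a b n)"
proof -
  have "smooth_gen (\<lambda>x. flat (\<lambda>_. 1) (real n * x + (- real n * a - 1)) * flat (\<lambda>_. 1) ((- real n) * x + (real n * b - 1)))"
    by (intro smooth_gen.intros(2,4) real_polynomial_function.intros(2))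
  moreover have "(\<lambda>x. flat (\<lambda>_. 1) (real n * x + (- real n * a - 1)) * flat (\<lambda>_. 1) ((- real n) * x + (real n * b - 1))) = cutoff a b n"
    by (simp add: cutoff_def[abs_def] algebra_simps)
  ultimately show ?thesis by simp
qed

lemma cutoff_bounds: "0 \<le> cutoff a b n x" "cutoff a b n x \<le> 1"
  unfolding cutoff_def by (auto simp: flat_def intro!: mult_le_one)

lemma cutoff_eq_0:
  assumes "0 < n" "x \<notin> {a + 1 / real n..b - 1 / real n}"
  shows "cutoff a b n x = 0"
  using assms by (auto simp: cutoff_def flat_def field_simps not_le)

lemma cutoff_pos:
  assumes "0 < n" "x \<in> {a + 1 / real n<..<b - 1 / real n}"
  shows "0 < cutoff a b n x"
  using assms by (auto simp: cutoff_def flat_def field_simps)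

lemma cutoff_tendsto:
  assumes "a < x" "x < b"
  shows "(\<lambda>n. cutoff a b n x) \<longlonglongrightarrow> 1"
proof -
  have *: "(\<lambda>n. flat (\<lambda>_. 1) (real n * s - 1)) \<longlonglongrightarrow> 1" if s: "0 < s" for s
  proof -
    have t: "filterlim (\<lambda>n. real n * s - 1) at_top sequentially"
      by (rule filterlim_tendsto_add_at_top[of "\<lambda>_. -1" "-1", simplified add.commute[of "-1"], simplified];
          rule filterlim_at_top_mult_tendsto_pos[OF tendsto_const s filterlim_real_sequentially, simplified] tendsto_const)
    have "((\<lambda>y::real. exp (- inverse y)) \<longlongrightarrow> exp (- 0)) at_top"
      by (intro tendsto_intros tendsto_inverse_0_at_top filterlim_ident)
    then have "(\<lambda>n. exp (- inverse (real n * s - 1))) \<longlonglongrightarrow> 1"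
      using filterlim_compose[OF _ t] by fastforce
    moreover have "\<forall>\<^sub>F n in sequentially. exp (- inverse (real n * s - 1)) = flat (\<lambda>_. 1) (real n * s - 1)"
      using filterlim_at_top_dense[THEN iffD1, OF t, THEN spec, of 0] by (rule eventually_mono) (simp add: flat_def)
    ultimately show ?thesis by (rule Lim_transform_eventually)
  qed
  show ?thesis
    unfolding cutoff_def using tendsto_mult[OF *[of "x - a"] *[of "b - x"]] assms by simp
qed

lemma bump_mult_cutoff:
  assumes "smooth_gen u" "0 < n"
  shows "bump a b (\<lambda>x. u x * cutoff a b n x)"
  unfolding bump_def
proof
  show "smooth_gen (\<lambda>x. u x * cutoff a b n x)" by (intro smooth_gen.mult assms smooth_gen_cutoff)
  have "a < a + 1 / real n" "b - 1 / real n < b" using assms(2) by auto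
  moreover have "\<forall>x. x \<notin> {a + 1 / real n..b - 1 / real n} \<longrightarrow> u x * cutoff a b n x = 0"
    using cutoff_eq_0[OF assms(2), of _ a b] by auto
  ultimately show "\<exists>c d. a < c \<and> d < b \<and> (\<forall>x. x \<notin> {c..d} \<longrightarrow> u x * cutoff a b n x = 0)" by blast
qed

section \<open>The fundamental lemma of the calculus of variations\<close>

lemma set_lebesgue_integral_eq_lebesgue_on:
  fixes F :: "real \<Rightarrow> complex"
  assumes "S \<in> sets lebesgue"
  shows "(LINT x:S|lebesgue. F x) = (LINT x|lebesgue_on S. F x)"
  unfolding set_lebesgue_integral_def using assms by (simp add: integral_restrict_space)

lemma set_lebesgue_integral_Ioo_eq:
  fixes F :: "real \<Rightarrow> complex"
  assumes "integrable (lebesgue_on {a..b}) F"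
  shows "(LINT x:{a<..<b}|lebesgue. F x) = (LINT x|lebesgue_on {a..b}. F x)"
  using assms integrable_lebesgue_on_Ioo_iff[of a b F]
  by (simp add: set_lebesgue_integral_eq_lebesgue_on lebesgue_integral_eq_integral integral_open_interval_real)

lemma integrable_lebesgue_on_continuous_mult:
  fixes v h :: "real \<Rightarrow> complex"
  assumes v: "continuous_on {a..b} v" and h: "integrable (lebesgue_on {a..b}) h"
  shows "integrable (lebesgue_on {a..b}) (\<lambda>x. v x * h x)"
proof -
  have "bounded (v ` {a..b})" by (intro compact_imp_bounded compact_continuous_image v) simp
  then show ?thesis
    using absolutely_integrable_bounded_measurable_product[OF bilinear_times L2_on_measurableD[OF L2_on_continuous[OF v]], of h] h
    by (simp add: integrable_lebesgue_on_iff_absolutely)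
qed

lemma locally_integrableD:
  "locally_integrable a b u \<Longrightarrow> a < c \<Longrightarrow> d < b \<Longrightarrow> integrable (lebesgue_on {c..d}) u"
  by (simp add: locally_integrable_def integrable_lebesgue_on_iff_absolutely)

lemma L2_on_locally_integrable:
  assumes "u \<in> L2_on {a..b}"
  shows "locally_integrable a b u"
  unfolding locally_integrable_def
proof (intro allI impI)
  fix c d assume "a < c" "d < b"
  then have "integrable (lebesgue_on {c..d}) u"
    by (intro integrable_lebesgue_on_Icc_integrable_on(2)[OF L2_on_imp_integrable(1)[OF assms]]) auto
  then show "u absolutely_integrable_on {c..d}" by (simp add: integrable_lebesgue_on_iff_absolutely)
qed

lemma set_integrable_mult_bump:
  fixes g :: "real \<Rightarrow> complex"
  assumes g: "integrable (lebesgue_on {c..d}) g" and cd: "a < c" "d < b"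
    and v: "continuous_on {c..d} v" "\<And>x. x \<notin> {c..d} \<Longrightarrow> v x = 0"
  shows "set_integrable lebesgue {a<..<b} (\<lambda>x. g x * of_real (v x))"
    and "(LINT x:{a<..<b}|lebesgue. g x * of_real (v x)) = (LINT x|lebesgue_on {c..d}. g x * of_real (v x))"
proof -
  have eq: "indicator {a<..<b} x *\<^sub>R (g x * of_real (v x)) = indicator {c..d} x *\<^sub>R (g x * of_real (v x))" for x
    using v(2)[of x] cd by (auto simp: indicator_def)
  have "integrable (lebesgue_on {c..d}) (\<lambda>x. of_real (v x) * g x)"
    by (intro integrable_lebesgue_on_continuous_mult continuous_intros v g)
  then have "set_integrable lebesgue {c..d} (\<lambda>x. g x * of_real (v x))"
    by (simp add: integrable_lebesgue_on_iff_absolutely mult.commute)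
  then show "set_integrable lebesgue {a<..<b} (\<lambda>x. g x * of_real (v x))"
    unfolding set_integrable_def by (simp only: eq)
  show "(LINT x:{a<..<b}|lebesgue. g x * of_real (v x)) = (LINT x|lebesgue_on {c..d}. g x * of_real (v x))"
    by (simp only: set_lebesgue_integral_def eq) (simp add: integral_restrict_space)
qed

text \<open>Test against s = cnj g / |g|, which is bounded by 1 and equals 0 where g does, as
  division by 0 gives 0. It is a bounded limit of continuous functions, so by dominated convergence
  the integral of g s = |g| vanishes.\<close>

lemma AE_eq_0_if_orthogonal_continuous:
  fixes g :: "real \<Rightarrow> complex"
  assumes g: "integrable (lebesgue_on {c..d}) g"
    and ortho: "\<And>h. continuous_on UNIV h \<Longrightarrow> (LINT x|lebesgue_on {c..d}. g x * h x) = 0"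
  shows "AE x in lebesgue_on {c..d}. g x = 0"
proof -
  let ?M = "lebesgue_on {c..d}"
  have gm [measurable]: "g \<in> borel_measurable ?M" using g by auto
  define s where "s x = cnj (g x) / of_real (norm (g x))" for x
  have [measurable]: "cnj \<in> borel_measurable borel"
    by (intro borel_measurable_continuous_onI continuous_intros)
  have sm [measurable]: "s \<in> borel_measurable ?M" unfolding s_def by measurable
  have "norm (s x) \<le> 1" for x by (simp add: s_def norm_divide)
  then obtain p where p: "\<And>n. continuous_on UNIV (p n)" "\<And>n x. norm (p n x) \<le> 1"
    "AE x in ?M. (\<lambda>n. p n x) \<longlonglongrightarrow> s x"
    using bounded_measurable_AE_lim_continuous[OF sm, of 1] by auto
  have pm [measurable]: "p n \<in> borel_measurable ?M" for n
    by (rule continuous_imp_measurable_on_sets_lebesgue) (use continuous_on_subset[OF p(1)[of n]] in auto)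
  have "(\<lambda>n. LINT x|?M. g x * p n x) \<longlonglongrightarrow> (LINT x|?M. g x * s x)"
  proof (rule integral_dominated_convergence)
    show "integrable ?M (\<lambda>x. norm (g x))" using g by simp
    show "AE x in ?M. (\<lambda>n. g x * p n x) \<longlonglongrightarrow> g x * s x"
      by (rule eventually_mono[OF p(3)]) (intro tendsto_intros)
    show "AE x in ?M. norm (g x * p n x) \<le> norm (g x)" for n
      using p(2) by (intro AE_I2) (simp add: norm_mult mult_left_le)
  qed measurable
  then have "(LINT x|?M. g x * s x) = 0"
    using ortho[OF p(1)] LIMSEQ_const_iff[of 0] LIMSEQ_unique by fastforce
  moreover have "g x * s x = of_real (norm (g x))" for x
    by (cases "g x = 0") (simp_all add: s_def complex_norm_square[symmetric] power2_eq_square)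
  ultimately have "(LINT x|?M. norm (g x)) = 0" by simp
  then have "AE x in ?M. norm (g x) = 0"
    using integral_nonneg_eq_0_iff_AE[of ?M "\<lambda>x. norm (g x)"] g by simp
  then show ?thesis by (rule eventually_mono) simp
qed

text \<open>Stone-Weierstrass reduces continuous test functions to polynomials; a complex polynomial
  is tested through its real and imaginary parts.\<close>

lemma AE_eq_0_if_orthogonal_polynomial:
  fixes g :: "real \<Rightarrow> complex"
  assumes g: "integrable (lebesgue_on {c..d}) g"
    and ortho: "\<And>h. real_polynomial_function h \<Longrightarrow> (LINT x|lebesgue_on {c..d}. g x * of_real (h x)) = 0"
  shows "AE x in lebesgue_on {c..d}. g x = 0"
proof (rule AE_eq_0_if_orthogonal_continuous[OF g])
  let ?M = "lebesgue_on {c..d}"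
  fix h :: "real \<Rightarrow> complex" assume h: "continuous_on UNIV h"
  have hc: "continuous_on {c..d} h" by (rule continuous_on_subset[OF h]) simp
  have int: "integrable ?M (\<lambda>x. g x * v x)" if "continuous_on {c..d} v" for v
    using integrable_lebesgue_on_continuous_mult[OF that g] by (simp add: mult.commute)
  define G where "G = (LINT x|?M. norm (g x))"
  have "norm (LINT x|?M. g x * h x) \<le> e" if e: "0 < e" for e
  proof -
    have G0: "0 \<le> G" by (simp add: G_def)
    then have "0 < e / (G + 1)" using e by simp
    from Stone_Weierstrass_polynomial_function[OF compact_Icc hc this]
    obtain p where p: "polynomial_function p" "\<And>x. x \<in> {c..d} \<Longrightarrow> norm (h x - p x) < e / (G + 1)"
      by auto
    have pr: "real_polynomial_function (\<lambda>x. Re (p x))" "real_polynomial_function (\<lambda>x. Im (p x))"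
      using p(1)[unfolded polynomial_function_def, rule_format, OF bounded_linear_Re]
        p(1)[unfolded polynomial_function_def, rule_format, OF bounded_linear_Im] by (simp_all add: o_def)
    have pc: "continuous_on {c..d} p"
      using p(1) continuous_on_polymonial_function by blast
    have "(LINT x|?M. g x * p x) = (LINT x|?M. g x * of_real (Re (p x)) + \<i> * (g x * of_real (Im (p x))))"
      by (intro Bochner_Integration.integral_cong refl, subst complex_eq) (simp add: algebra_simps)
    also have "\<dots> = (LINT x|?M. g x * of_real (Re (p x))) + \<i> * (LINT x|?M. g x * of_real (Im (p x)))"
      by (subst Bochner_Integration.integral_add) (auto intro!: int integrable_mult_right continuous_intros pc)
    also have "\<dots> = 0" by (simp add: ortho pr)
    finally have "(LINT x|?M. g x * h x) = (LINT x|?M. g x * h x - g x * p x)"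
      using int[OF hc] int[OF pc] by simp
    also have "norm \<dots> \<le> (LINT x|?M. e / (G + 1) * norm (g x))"
    proof (rule Bochner_Integration.integral_norm_bound_integral)
      fix x assume "x \<in> space ?M"
      then have "norm (h x - p x) \<le> e / (G + 1)" using p(2)[of x] by simp
      then show "norm (g x * h x - g x * p x) \<le> e / (G + 1) * norm (g x)"
        by (simp add: norm_mult flip: right_diff_distrib) (metis mult.commute mult_left_mono norm_ge_zero times_divide_eq_left)
    qed (use int[OF hc] int[OF pc] g in auto)
    also have "\<dots> = e / (G + 1) * G" by (simp add: G_def)
    also have "\<dots> \<le> e" using e G0 by (simp add: field_simps)
    finally show ?thesis .
  qed
  then have "norm (LINT x|?M. g x * h x) \<le> 0" by (rule field_le_epsilon) simp
  then show "(LINT x|?M. g x * h x) = 0" by simp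
qed

text \<open>As g is only locally integrable, the argument runs on compact subintervals: there
  polynomials times \<open>cutoff\<close> are bumps, and letting the cutoff tend to 1 gives
  orthogonality to the polynomials.\<close>

lemma AE_eq_0_if_orthogonal_bump:
  fixes g :: "real \<Rightarrow> complex"
  assumes g: "locally_integrable a b g"
    and ortho: "\<And>\<phi>. bump a b \<phi> \<Longrightarrow> (LINT x:{a<..<b}|lebesgue. g x * of_real (\<phi> x)) = 0"
  shows "AE x in lebesgue_on {a..b}. g x = 0"
proof -
  have *: "AE x in lebesgue_on {c..d}. g x = 0" if cd: "a < c" "d < b" for c d
  proof (rule AE_eq_0_if_orthogonal_polynomial)
    let ?M = "lebesgue_on {c..d}"
    show gi: "integrable ?M g" by (rule locally_integrableD[OF g cd])
    have gm [measurable]: "g \<in> borel_measurable ?M" using gi by auto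
    fix h :: "real \<Rightarrow> real" assume h: "real_polynomial_function h"
    have hs: "smooth_gen h" by (rule smooth_gen.polynomial[OF h])
    have hc: "continuous_on {c..d} h" and hcc: "continuous_on {c..d} (\<lambda>x. complex_of_real (h x))"
      by (intro smooth_gen_continuous[OF hs] continuous_intros)+
    have zc: "continuous_on {c..d} (cutoff c d n)" for n by (rule smooth_gen_continuous[OF smooth_gen_cutoff])
    have [measurable]: "h \<in> borel_measurable ?M" "cutoff c d n \<in> borel_measurable ?M" for n
      by (auto intro!: continuous_imp_measurable_on_sets_lebesgue hc zc)
    have z0: "(LINT x|?M. (g x * of_real (h x)) * of_real (cutoff c d (Suc n) x)) = 0" for n
    proof -
      have b: "bump c d (\<lambda>x. h x * cutoff c d (Suc n) x)" by (rule bump_mult_cutoff[OF hs]) simp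
      then have "bump a b (\<lambda>x. h x * cutoff c d (Suc n) x)"
        unfolding bump_def using cd by (meson dual_order.strict_trans)
      from ortho[OF this] have "(LINT x:{a<..<b}|lebesgue. g x * of_real (h x * cutoff c d (Suc n) x)) = 0" .
      moreover have "h x * cutoff c d (Suc n) x = 0" if "x \<notin> {c..d}" for x
      proof -
        have "x \<notin> {c + 1 / real (Suc n)..d - 1 / real (Suc n)}"
          using that by (auto simp: not_le) (smt (verit) divide_pos_pos of_nat_0_less_iff of_nat_Suc zero_less_Suc)+
        then show ?thesis using cutoff_eq_0[of "Suc n" x c d] by simp
      qed
      ultimately show ?thesis
        using set_integrable_mult_bump(2)[OF gi cd, of "\<lambda>x. h x * cutoff c d (Suc n) x"]
          continuous_on_mult[OF hc zc] by (simp add: mult.assoc)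
    qed
    \<comment> \<open>The cutoff converges to 1 only in the open interval, which is enough for an
      almost everywhere limit.\<close>
    have "(\<lambda>n. LINT x|?M. (g x * of_real (h x)) * of_real (cutoff c d (Suc n) x)) \<longlonglongrightarrow> (LINT x|?M. g x * of_real (h x))"
    proof (rule integral_dominated_convergence)
      show "integrable ?M (\<lambda>x. norm (g x * of_real (h x)))"
        using integrable_norm[OF integrable_lebesgue_on_continuous_mult[OF hcc gi]] by (simp add: mult.commute)
      show "AE x in ?M. (\<lambda>n. (g x * of_real (h x)) * of_real (cutoff c d (Suc n) x)) \<longlonglongrightarrow> g x * of_real (h x)"
        unfolding AE_lebesgue_on_Ioo_iff[symmetric]
      proof (intro AE_I2)
        fix x assume "x \<in> space (lebesgue_on {c<..<d})"
        then have x: "c < x" "x < d" by auto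
        then have "(\<lambda>n. cutoff c d (Suc n) x) \<longlonglongrightarrow> 1" by (rule LIMSEQ_Suc[OF cutoff_tendsto])
        then have "(\<lambda>n. (g x * of_real (h x)) * of_real (cutoff c d (Suc n) x)) \<longlonglongrightarrow> (g x * of_real (h x)) * of_real 1"
          by (intro tendsto_intros)
        then show "(\<lambda>n. (g x * of_real (h x)) * of_real (cutoff c d (Suc n) x)) \<longlonglongrightarrow> g x * of_real (h x)"
          using x by simp
      qed
      show "AE x in ?M. norm ((g x * of_real (h x)) * of_real (cutoff c d (Suc n) x)) \<le> norm (g x * of_real (h x))" for n
        using cutoff_bounds[of c d "Suc n"] by (intro AE_I2) (simp add: norm_mult mult_left_le)
    qed measurable
    then show "(LINT x|?M. g x * of_real (h x)) = 0"
      unfolding z0 using LIMSEQ_const_iff by metis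
  qed
  \<comment> \<open>Countably many compact intervals exhaust the open one, so the exceptional null
    sets can be united.\<close>
  have "AE x in lebesgue. x \<in> {a + 1 / real (Suc n)..b - 1 / real (Suc n)} \<longrightarrow> g x = 0" for n
  proof -
    have "AE x in lebesgue_on {a + 1 / real (Suc n)..b - 1 / real (Suc n)}. g x = 0" by (rule *) auto
    then show ?thesis by (subst (asm) AE_restrict_space_iff) auto
  qed
  then have "AE x in lebesgue. \<forall>n. x \<in> {a + 1 / real (Suc n)..b - 1 / real (Suc n)} \<longrightarrow> g x = 0"
    by (simp only: AE_all_countable) blast
  then have "AE x in lebesgue. x \<in> {a<..<b} \<longrightarrow> g x = 0"
  proof (rule eventually_mono, intro impI)
    fix x assume g0: "\<forall>n. x \<in> {a + 1 / real (Suc n)..b - 1 / real (Suc n)} \<longrightarrow> g x = 0" and x: "x \<in> {a<..<b}"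
    then have "0 < min (x - a) (b - x)" by simp
    then obtain n where "inverse (real (Suc n)) < min (x - a) (b - x)" using reals_Archimedean by blast
    then have "x \<in> {a + 1 / real (Suc n)..b - 1 / real (Suc n)}" by (simp add: inverse_eq_divide)
    then show "g x = 0" using g0 by blast
  qed
  then show ?thesis
    unfolding AE_lebesgue_on_Ioo_iff[symmetric] by (subst AE_restrict_space_iff) auto
qed

section \<open>Weak derivatives on an interval\<close>

text \<open>Integration by parts, that is, \<open>primitive_on_mult\<close> for v and the test
  function between a and b; the boundary terms vanish with the test function.\<close>

lemma primitive_on_imp_weak_deriv:
  assumes p: "primitive_on a b v g" and ae: "AE x in lebesgue_on {a..b}. u x = v x" and ab: "a \<le> b"
  shows "has_weak_deriv a b u g"
  unfolding has_weak_deriv_def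
proof (intro conjI ballI)
  note vc = primitive_on_continuous[OF p] and gL = primitive_on_L2[OF p]
  have uL: "u \<in> L2_on {a..b}"
    by (rule L2_on_cong_AE[OF _ L2_on_continuous[OF vc]]) (use ae in \<open>auto simp: eq_commute\<close>)
  show "locally_integrable a b u" "locally_integrable a b g"
    by (intro L2_on_locally_integrable uL gL)+
  fix \<phi> assume \<phi>: "\<phi> \<in> test_functions a b"
  then have d: "(deriv ^^ n) \<phi> differentiable_on UNIV" for n by (simp add: test_functions_def)
  from \<phi> obtain c d where cd: "a < c" "d < b" "\<And>x. x \<notin> {c..d} \<Longrightarrow> \<phi> x = 0"
    by (auto simp: test_functions_def)
  have D: "(\<phi> has_real_derivative deriv \<phi> x) (at x)" for x
    using d[of 0] by (auto simp: differentiable_on_def DERIV_deriv_iff_real_differentiable)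
  have dc: "continuous_on {a..b} (deriv \<phi>)"
    using differentiable_imp_continuous_on[OF d[of 1]] continuous_on_subset by auto
  have P: "primitive_on a b (\<lambda>x. complex_of_real (\<phi> x)) (\<lambda>x. of_real (deriv \<phi> x))"
    by (rule primitive_on_has_vector_derivative)
       (auto intro!: continuous_intros dc has_vector_derivative_of_real has_field_derivative_at_within[OF D]
         simp flip: has_real_derivative_iff_has_vector_derivative)
  have "\<phi> a = 0" "\<phi> b = 0" using cd by auto
  have i1: "integrable (lebesgue_on {a..b}) (\<lambda>x. of_real (\<phi> x) * g x)"
    and i2: "integrable (lebesgue_on {a..b}) (\<lambda>x. of_real (deriv \<phi> x) * v x)"
    and i3: "integrable (lebesgue_on {a..b}) (\<lambda>x. of_real (deriv \<phi> x) * u x)"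
    using L2_on_imp_integrable(1) gL uL L2_on_continuous[OF vc] dc primitive_on_continuous[OF P]
    by (auto intro!: integrable_lebesgue_on_continuous_mult continuous_intros)
  have "v b * of_real (\<phi> b) = v a * of_real (\<phi> a) + integral {a..b} (\<lambda>x. of_real (\<phi> x) * g x + v x * of_real (deriv \<phi> x))"
    using primitive_on_eq[OF primitive_on_mult[OF p P], of b] ab by simp
  then have "0 = integral {a..b} (\<lambda>x. of_real (\<phi> x) * g x + v x * of_real (deriv \<phi> x))"
    using \<open>\<phi> a = 0\<close> \<open>\<phi> b = 0\<close> by simp
  also have "\<dots> = (LINT x|lebesgue_on {a..b}. of_real (\<phi> x) * g x + v x * of_real (deriv \<phi> x))"
    by (rule lebesgue_integral_eq_integral[symmetric]) (use i1 i2 in \<open>auto simp: mult.commute\<close>)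
  also have "\<dots> = (LINT x|lebesgue_on {a..b}. g x * of_real (\<phi> x)) + (LINT x|lebesgue_on {a..b}. v x * of_real (deriv \<phi> x))"
    using i1 i2 by (simp add: mult.commute)
  also have "(LINT x|lebesgue_on {a..b}. v x * of_real (deriv \<phi> x)) = (LINT x|lebesgue_on {a..b}. u x * of_real (deriv \<phi> x))"
    by (rule integral_cong_AE) (use i2 i3 ae in \<open>auto simp: mult.commute elim: eventually_mono\<close>)
  finally show "(LINT x:{a<..<b}|lebesgue. u x * of_real (deriv \<phi> x)) = - (LINT x:{a<..<b}|lebesgue. g x * of_real (\<phi> x))"
    using i1 i3 by (simp add: set_lebesgue_integral_Ioo_eq mult.commute eq_neg_iff_add_eq_0 add.commute)
qed

lemma weak_deriv_bump:
  assumes "has_weak_deriv a b u g" "bump a b \<phi>" "\<And>x. (\<phi> has_real_derivative \<psi> x) (at x)"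
  shows "(LINT x:{a<..<b}|lebesgue. u x * of_real (\<psi> x)) = - (LINT x:{a<..<b}|lebesgue. g x * of_real (\<phi> x))"
proof -
  have "deriv \<phi> = \<psi>" by (intro ext DERIV_imp_deriv assms(3))
  then show ?thesis
    using assms(1) bump_test_functions[OF assms(2)] unfolding has_weak_deriv_def by auto
qed

lemma locally_integrable_diff:
  "locally_integrable a b u \<Longrightarrow> locally_integrable a b v \<Longrightarrow> locally_integrable a b (\<lambda>x. u x - v x)"
  unfolding locally_integrable_def by (auto intro: set_integral_diff)

lemma bump_set_integrable:
  assumes g: "locally_integrable a b g" and \<phi>: "bump a b \<phi>"
  shows "set_integrable lebesgue {a<..<b} (\<lambda>x. g x * of_real (\<phi> x))"
proof -
  from \<phi> obtain c d where cd: "a < c" "d < b" "\<And>x. x \<notin> {c..d} \<Longrightarrow> \<phi> x = 0"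
    by (auto simp: bump_def)
  then show ?thesis
    using set_integrable_mult_bump(1)[OF locally_integrableD[OF g cd(1,2)] cd(1,2), of \<phi>]
      smooth_gen_continuous \<phi> by (auto simp: bump_def)
qed

lemma weak_deriv_unique:
  assumes "has_weak_deriv a b u g" "has_weak_deriv a b u h"
  shows "AE x in lebesgue_on {a..b}. g x = h x"
proof -
  have l: "locally_integrable a b g" "locally_integrable a b h"
    using assms by (auto simp: has_weak_deriv_def)
  have "AE x in lebesgue_on {a..b}. g x - h x = 0"
  proof (rule AE_eq_0_if_orthogonal_bump)
    show "locally_integrable a b (\<lambda>x. g x - h x)" by (intro locally_integrable_diff l)
    fix \<phi> assume \<phi>: "bump a b \<phi>"
    have "(LINT x:{a<..<b}|lebesgue. g x * of_real (\<phi> x)) = (LINT x:{a<..<b}|lebesgue. h x * of_real (\<phi> x))"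
      using assms[unfolded has_weak_deriv_def, THEN conjunct2, THEN conjunct2, rule_format, OF bump_test_functions[OF \<phi>]]
      by simp
    then show "(LINT x:{a<..<b}|lebesgue. (g x - h x) * of_real (\<phi> x)) = 0"
      using bump_set_integrable[OF l(1) \<phi>] bump_set_integrable[OF l(2) \<phi>]
      by (simp add: left_diff_distrib set_integral_diff)
  qed
  then show ?thesis by (rule eventually_mono) simp
qed

text \<open>Zero mean makes an antiderivative F agree at a and b. F is constant on either side of
  the support of \<psi>, so F - F(a) vanishes there and has its own support inside the open
  interval.\<close>

lemma bump_antiderivative:
  assumes \<psi>: "bump a b \<psi>" and int: "integral {a..b} \<psi> = 0" and ab: "a < b"
  obtains \<phi> where "bump a b \<phi>" "\<And>x. (\<phi> has_real_derivative \<psi> x) (at x)"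
proof -
  from \<psi> obtain c d where s: "smooth_gen \<psi>" and cd: "a < c" "d < b" "\<And>x. x \<notin> {c..d} \<Longrightarrow> \<psi> x = 0"
    by (auto simp: bump_def)
  have "continuous_on UNIV \<psi>" by (rule smooth_gen_continuous[OF s])
  then have "isCont \<psi> x" for x by (simp add: continuous_on_eq_continuous_at)
  then obtain F where "\<And>x. (F has_vector_derivative \<psi> x) (at x)"
    using einterval_antiderivative[of "-\<infinity>" "\<infinity>" \<psi>] by auto
  then have F: "(F has_real_derivative \<psi> x) (at x)" for x
    by (simp add: has_real_derivative_iff_has_vector_derivative)
  define \<phi> where "\<phi> x = F x - F a" for x
  have D: "(\<phi> has_real_derivative \<psi> x) (at x)" for x
    unfolding \<phi>_def using F by (auto intro!: derivative_eq_intros)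
  have Fc: "continuous_on S F" for S using F DERIV_isCont continuous_at_imp_continuous_on by blast
  have "(\<psi> has_integral F b - F a) {a..b}"
    by (rule fundamental_theorem_of_calculus)
       (use ab F in \<open>auto simp flip: has_real_derivative_iff_has_vector_derivative intro: has_field_derivative_at_within\<close>)
  then have Fab: "F b = F a" using int by (simp add: integral_unique)
  have const: "F x = F y" if xy: "x < y" "y < c \<or> d < x" for x y
  proof -
    have "(F has_real_derivative 0) (at z)" if "x < z" "z < y" for z
      using F[of z] cd(3)[of z] that xy by force
    then show ?thesis using DERIV_isconst_end[OF xy(1) Fc] by simp
  qed
  define c' d' where "c' = (a + min b c) / 2" and "d' = (max a d + b) / 2"
  have c': "a < c'" "c' < c" "d < d'" "d' < b" using cd(1,2) ab by (auto simp: c'_def d'_def min_def max_def)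
  have "\<phi> x = 0" if x: "x \<notin> {c'..d'}" for x
  proof -
    from x consider "x < c'" | "d' < x" by force
    then show ?thesis
    proof cases
      case 1
      then have "F x = F a"
      proof (cases x a rule: linorder_cases)
        case less
        then show ?thesis by (rule const) (use cd(1) in simp)
      next
        case greater
        then have "F a = F x" by (rule const) (use 1 c'(2) in simp)
        then show ?thesis ..
      qed simp
      then show ?thesis by (simp add: \<phi>_def)
    next
      case 2
      then have "F x = F b"
      proof (cases x b rule: linorder_cases)
        case less
        then show ?thesis by (rule const) (use 2 c'(3) in simp)
      next
        case greater
        then have "F b = F x" by (rule const) (use cd(2) in simp)
        then show ?thesis ..
      qed simp
      then show ?thesis by (simp add: \<phi>_def Fab)
    qed
  qed
  then have "bump a b \<phi>"
    unfolding bump_def using smooth_gen.antideriv[OF s D] c'(1,4) by blast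
  then show thesis using that D by blast
qed

text \<open>
  The test function \<open>\<psi> - k \<theta>\<close>, with \<open>\<theta>\<close> a fixed bump and \<open>k\<close> chosen to give mean zero, is the derivative of
  a test function; so \<open>w - c\<close> is orthogonal to every \<open>\<psi>\<close>, where \<open>c\<close> is the \<open>\<theta>\<close>-average of \<open>w\<close>.
\<close>

lemma AE_const_if_weak_deriv_0:
  fixes w :: "real \<Rightarrow> complex"
  assumes w: "has_weak_deriv a b w (\<lambda>_. 0)" and ab: "a < b"
  shows "\<exists>c. AE x in lebesgue_on {a..b}. w x = c"
proof -
  have wl: "locally_integrable a b w" using w by (simp add: has_weak_deriv_def)
  have cl: "locally_integrable a b (\<lambda>_. c)" for c
    by (rule L2_on_locally_integrable[OF L2_on_continuous[OF continuous_on_const]])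
  \<comment> \<open>With 2/n < b - a the midpoint lies where \<open>cutoff\<close> is positive, so
    \<theta> has nonzero integral.\<close>
  obtain n :: nat where n: "0 < n" "2 / real n < b - a"
  proof -
    obtain m where "inverse (real (Suc m)) < (b - a) / 2" using reals_Archimedean[of "(b - a) / 2"] ab by auto
    then have "2 / real (Suc m) < b - a" by (simp add: field_simps)
    then show thesis using that[of "Suc m"] by simp
  qed
  define \<theta> where "\<theta> = cutoff a b n"
  have \<theta>: "bump a b \<theta>"
    using bump_mult_cutoff[OF smooth_gen.polynomial[OF real_polynomial_function.intros(2)[of 1]] n(1), of a b]
    by (simp add: \<theta>_def)
  have sc: "continuous_on S \<psi>" if "bump a b \<psi>" for S \<psi>
    using that smooth_gen_continuous by (auto simp: bump_def)
  define m where "m = integral {a..b} \<theta>"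
  have "m \<noteq> 0"
  proof
    assume "m = 0"
    then have "\<forall>x\<in>{a..b}. \<theta> x = 0"
      using integral_eq_0_iff[OF sc[OF \<theta>] ab] cutoff_bounds by (simp add: m_def \<theta>_def)
    moreover have "a \<le> (a + b) / 2" "(a + b) / 2 \<le> b" using ab by auto
    moreover have "0 < \<theta> ((a + b) / 2)"
      unfolding \<theta>_def using n by (intro cutoff_pos) (auto simp: field_simps)
    ultimately show False by fastforce
  qed
  define I where "I \<psi> = (LINT x:{a<..<b}|lebesgue. w x * of_real (\<psi> x))" for \<psi> :: "real \<Rightarrow> real"
  define c where "c = I \<theta> / of_real m"
  have "AE x in lebesgue_on {a..b}. w x - c = 0"
  proof (rule AE_eq_0_if_orthogonal_bump)
    show "locally_integrable a b (\<lambda>x. w x - c)" by (intro locally_integrable_diff wl cl)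
    fix \<psi> assume \<psi>: "bump a b \<psi>"
    define k where "k = integral {a..b} \<psi> / m"
    define \<eta> where "\<eta> x = \<psi> x + (- k) * \<theta> x" for x
    have \<eta>: "bump a b \<eta>"
    proof -
      obtain c1 d1 where 1: "smooth_gen \<psi>" "a < c1" "d1 < b" "\<And>x. x \<notin> {c1..d1} \<Longrightarrow> \<psi> x = 0"
        using \<psi> by (auto simp: bump_def)
      obtain c2 d2 where 2: "smooth_gen \<theta>" "a < c2" "d2 < b" "\<And>x. x \<notin> {c2..d2} \<Longrightarrow> \<theta> x = 0"
        using \<theta> by (auto simp: bump_def)
      have "smooth_gen \<eta>" unfolding \<eta>_def
        by (intro smooth_gen.add smooth_gen.mult 1 2 smooth_gen.polynomial real_polynomial_function.intros(2))
      moreover have "\<eta> x = 0" if "x \<notin> {min c1 c2..max d1 d2}" for x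
      proof -
        have "\<psi> x = 0" "\<theta> x = 0" using that by (auto intro!: 1(4) 2(4))
        then show ?thesis by (simp add: \<eta>_def)
      qed
      ultimately show ?thesis
        unfolding bump_def using 1(2,3) 2(2,3)
        by (intro conjI exI[of _ "min c1 c2"] exI[of _ "max d1 d2"]) (auto simp: min_def max_def)
    qed
    have ii: "\<psi> integrable_on {a..b}" "\<theta> integrable_on {a..b}"
      by (intro integrable_continuous_real sc \<psi> \<theta>)+
    then have "integral {a..b} \<eta> = integral {a..b} \<psi> + (- k) * m"
      unfolding \<eta>_def m_def
      by (subst Henstock_Kurzweil_Integration.integral_add[OF _ integrable_on_mult_right]) simp_all
    also have "\<dots> = 0" using \<open>m \<noteq> 0\<close> by (simp add: k_def)
    finally obtain \<phi> where "bump a b \<phi>" "\<And>x. (\<phi> has_real_derivative \<eta> x) (at x)"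
      using bump_antiderivative[OF \<eta> _ ab] by blast
    from weak_deriv_bump[OF w this] have "I \<eta> = 0" by (simp add: I_def set_lebesgue_integral_def)
    moreover have "I \<eta> = I \<psi> - of_real k * I \<theta>"
    proof -
      have "I \<eta> = (LINT x:{a<..<b}|lebesgue. w x * of_real (\<psi> x) - of_real k * (w x * of_real (\<theta> x)))"
        unfolding I_def \<eta>_def by (simp add: algebra_simps)
      also have "\<dots> = I \<psi> - of_real k * I \<theta>"
        unfolding I_def by (subst set_integral_diff(2)) (auto intro!: bump_set_integrable wl \<psi> \<theta> set_integrable_mult_right)
      finally show ?thesis .
    qed
    ultimately have "I \<psi> = of_real k * I \<theta>" by simp
    moreover have "(LINT x:{a<..<b}|lebesgue. c * of_real (\<psi> x)) = c * of_real (integral {a..b} \<psi>)"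
    proof -
      have "(LINT x:{a<..<b}|lebesgue. of_real (\<psi> x)) = integral {a..b} (\<lambda>x. complex_of_real (\<psi> x))"
      proof -
        note i = L2_on_imp_integrable(1)[OF L2_on_continuous[OF continuous_on_of_real[OF sc[OF \<psi>]]]]
        have "{a..b} \<in> sets lebesgue" by simp
        from lebesgue_integral_eq_integral[OF i this] show ?thesis
          by (rule trans[OF set_lebesgue_integral_Ioo_eq[OF i]])
      qed
      also have "\<dots> = of_real (integral {a..b} \<psi>)"
        using integral_linear[OF ii(1) bounded_linear_of_real] by (simp add: o_def)
      finally show ?thesis by simp
    qed
    ultimately show "(LINT x:{a<..<b}|lebesgue. (w x - c) * of_real (\<psi> x)) = 0"
      using bump_set_integrable[OF wl \<psi>] bump_set_integrable[OF cl[of c] \<psi>] \<open>m \<noteq> 0\<close>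
      by (auto simp: left_diff_distrib set_integral_diff I_def[symmetric] c_def k_def)
  qed
  then show ?thesis by (intro exI[of _ c]) (rule eventually_mono, auto)
qed

text \<open>Subtracting the indefinite integral G of g leaves a function with weak derivative 0,
  hence almost everywhere a constant c; the representative is c + G.\<close>

lemma weak_deriv_imp_primitive_on:
  assumes u: "u \<in> L2_on {a..b}" and g: "g \<in> L2_on {a..b}" and w: "has_weak_deriv a b u g" and ab: "a < b"
  obtains v where "primitive_on a b v g" "AE x in lebesgue_on {a..b}. u x = v x"
proof -
  define G where "G x = integral {a..x} g" for x
  have G: "primitive_on a b G g" by (rule primitive_onI[of _ _ _ _ 0]) (simp_all add: g G_def)
  then have wG: "has_weak_deriv a b G g" by (rule primitive_on_imp_weak_deriv) (use ab in auto)
  have l: "locally_integrable a b u" "locally_integrable a b G"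
    using w wG by (auto simp: has_weak_deriv_def)
  have "has_weak_deriv a b (\<lambda>x. u x - G x) (\<lambda>_. 0)"
    unfolding has_weak_deriv_def
  proof (intro conjI ballI)
    show "locally_integrable a b (\<lambda>x. u x - G x)" by (intro locally_integrable_diff l)
    show "locally_integrable a b (\<lambda>_. 0)"
      by (rule L2_on_locally_integrable[OF L2_on_continuous[OF continuous_on_const]])
    fix \<phi> assume \<phi>: "\<phi> \<in> test_functions a b"
    then obtain c d where cd: "a < c" "d < b" "\<And>x. x \<notin> {c..d} \<Longrightarrow> \<phi> x = 0"
      by (auto simp: test_functions_def)
    have d: "(deriv ^^ n) \<phi> differentiable_on UNIV" for n using \<phi> by (simp add: test_functions_def)
    have dc: "continuous_on S (deriv \<phi>)" for S
      using differentiable_imp_continuous_on[OF d[of 1]] continuous_on_subset by auto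
    \<comment> \<open>The derivative also vanishes off [c,d]. Local integrability of u and G is then
      enough to split the integral of their difference.\<close>
    have dz: "deriv \<phi> x = 0" if "x \<notin> {c..d}" for x
    proof -
      have "((\<lambda>_. 0) has_real_derivative 0) (at x)" by simp
      then have "(\<phi> has_real_derivative 0) (at x)"
        by (rule has_field_derivative_transform_within_open[of _ _ _ "- {c..d}"])
           (use that cd(3) in \<open>auto intro: open_Compl\<close>)
      then show ?thesis by (rule DERIV_imp_deriv)
    qed
    note i = set_integrable_mult_bump(1)[OF locally_integrableD[OF l(1) cd(1,2)] cd(1,2) dc dz]
      set_integrable_mult_bump(1)[OF locally_integrableD[OF l(2) cd(1,2)] cd(1,2) dc dz]
    show "(LINT x:{a<..<b}|lebesgue. (u x - G x) * of_real (deriv \<phi> x)) = - (LINT x:{a<..<b}|lebesgue. 0 * of_real (\<phi> x))"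
      using w wG \<phi> i by (simp add: left_diff_distrib set_integral_diff has_weak_deriv_def)
  qed
  from AE_const_if_weak_deriv_0[OF this ab] obtain c where c: "AE x in lebesgue_on {a..b}. u x - G x = c" by blast
  show thesis
  proof
    show "primitive_on a b (\<lambda>x. c + G x) g"
      by (rule primitive_onI[of _ _ _ _ c]) (simp_all add: g G_def)
    show "AE x in lebesgue_on {a..b}. u x = c + G x" by (rule eventually_mono[OF c]) auto
  qed
qed

text \<open>The bridge out of distribution theory: together with \<open>weak_deriv_AE\<close> it
  lets the differential operator be handled through primitives.\<close>

lemma sobolev_1_iff:
  assumes "a < b"
  shows "u \<in> sobolev 1 a b \<longleftrightarrow> (\<exists>v g. primitive_on a b v g \<and> (AE x in lebesgue_on {a..b}. u x = v x))"
proof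
  assume "u \<in> sobolev 1 a b"
  then obtain g where "u \<in> L2_on {a..b}" "g \<in> L2_on {a..b}" "has_weak_deriv a b u g"
    by (auto simp: L2_on_Ioo_eq)
  then show "\<exists>v g. primitive_on a b v g \<and> (AE x in lebesgue_on {a..b}. u x = v x)"
    using weak_deriv_imp_primitive_on[OF _ _ _ assms] by metis
next
  assume "\<exists>v g. primitive_on a b v g \<and> (AE x in lebesgue_on {a..b}. u x = v x)"
  then obtain v g where p: "primitive_on a b v g" and ae: "AE x in lebesgue_on {a..b}. u x = v x" by blast
  have "u \<in> L2_on {a..b}"
    by (rule L2_on_cong_AE[OF _ L2_on_continuous[OF primitive_on_continuous[OF p]]])
       (use ae in \<open>auto simp: eq_commute\<close>)
  then show "u \<in> sobolev 1 a b"
    using primitive_on_imp_weak_deriv[OF p ae] primitive_on_L2[OF p] assms by (auto simp: L2_on_Ioo_eq)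
qed

text \<open>A weak derivative exists, so the \<open>SOME\<close> choice is one, and uniqueness
  identifies it with g up to a null set.\<close>

lemma weak_deriv_AE:
  assumes "primitive_on a b v g" "AE x in lebesgue_on {a..b}. u x = v x" "a \<le> b"
  shows "AE x in lebesgue_on {a..b}. weak_deriv a b u x = g x"
proof -
  have "has_weak_deriv a b u g" by (rule primitive_on_imp_weak_deriv[OF assms])
  then have "has_weak_deriv a b u (weak_deriv a b u)"
    unfolding weak_deriv_def by (rule someI[where P = "has_weak_deriv a b u"])
  then show ?thesis using \<open>has_weak_deriv a b u g\<close> by (rule weak_deriv_unique)
qed

text \<open>The integral of the continuous function |u - v| is zero. This is how almost everywhere
  information yields values at points, including the initial values at 0.\<close>

lemma continuous_AE_eq_imp_eq:
  fixes u v :: "real \<Rightarrow> complex"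
  assumes u: "continuous_on {a..b} u" and v: "continuous_on {a..b} v" and ab: "a < b"
    and ae: "AE x in lebesgue_on {a..b}. u x = v x" and x: "x \<in> {a..b}"
  shows "u x = v x"
proof -
  let ?w = "\<lambda>x. norm (u x - v x)"
  have wc: "continuous_on {a..b} ?w" by (intro continuous_intros u v)
  have "(LINT x|lebesgue_on {a..b}. ?w x) = (LINT x|lebesgue_on {a..b}. 0)"
    by (rule integral_cong_AE)
       (use continuous_imp_measurable_on_sets_lebesgue[OF wc] ae in \<open>auto elim: eventually_mono\<close>)
  then have "\<forall>x\<in>{a..b}. ?w x = 0" using integralL_eq_0_iff[OF wc ab] by simp
  then show ?thesis using x by simp
qed

section \<open>The Volterra form of the eigenvalue equation\<close>

lemma sobolev_1_continuous_imp_primitive_on: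
  assumes "a < b" "u \<in> sobolev 1 a b" "continuous_on {a..b} u"
  obtains g where "primitive_on a b u g"
proof -
  obtain v g where p: "primitive_on a b v g" and ae: "AE x in lebesgue_on {a..b}. u x = v x"
    using assms(1,2) sobolev_1_iff by blast
  have "u x = v x" if "x \<in> {a..b}" for x
    by (rule continuous_AE_eq_imp_eq[OF assms(3) primitive_on_continuous[OF p] assms(1) ae that])
  then have "primitive_on a b u g" by (intro primitive_on_cong[OF p]) auto
  then show thesis by (rule that)
qed

text \<open>For u solving -\<open>S_f\<close> u = w this is f \<open>D_f\<close> u = f^2 (u/f)',
  whose derivative is f w; the constant \<open>b\<close> is its value at 0.\<close>

definition sl_flux :: "(real \<Rightarrow> complex) \<Rightarrow> complex \<Rightarrow> (real \<Rightarrow> complex) \<Rightarrow> real \<Rightarrow> complex" where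
  "sl_flux f b w s = b + integral {0..s} (\<lambda>r. f r * w r)"

text \<open>The quotient u/f for the same u, obtained by integrating the flux divided by f^2;
  \<open>a\<close> is its value at 0.\<close>

definition sl_ratio :: "(real \<Rightarrow> complex) \<Rightarrow> complex \<Rightarrow> complex \<Rightarrow> (real \<Rightarrow> complex) \<Rightarrow> real \<Rightarrow> complex" where
  "sl_ratio f a b w x = a + integral {0..x} (\<lambda>s. inverse (f s) ^ 2 * sl_flux f b w s)"

locale nonvanishing_primitive =
  fixes l :: real and f f' :: "real \<Rightarrow> complex"
  assumes l_pos: "0 < l" and f_prim: "primitive_on 0 l f f'" and f_nz: "\<And>x. x \<in> {0..l} \<Longrightarrow> f x \<noteq> 0"
begin

lemma f_cont: "continuous_on {0..l} f" by (rule primitive_on_continuous[OF f_prim])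

lemma inverse_f_cont: "continuous_on {0..l} (\<lambda>x. inverse (f x))"
  using f_nz by (intro continuous_intros f_cont) auto

lemma sl_flux_primitive:
  assumes "w \<in> L2_on {0..l}"
  shows "primitive_on 0 l (sl_flux f b w) (\<lambda>r. f r * w r)"
  by (rule primitive_onI[of _ _ _ _ b]) (auto simp: sl_flux_def intro!: L2_on_continuous_mult assms f_cont)

lemma sl_ratio_primitive:
  assumes "w \<in> L2_on {0..l}"
  shows "primitive_on 0 l (sl_ratio f a b w) (\<lambda>s. inverse (f s) ^ 2 * sl_flux f b w s)"
  by (rule primitive_onI[of _ _ _ _ a])
     (auto simp: sl_ratio_def intro!: L2_on_continuous continuous_intros inverse_f_cont
        primitive_on_continuous[OF sl_flux_primitive[OF assms]])

lemma darboux_AE: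
  assumes v: "primitive_on 0 l v q" and ae: "AE x in lebesgue_on {0..l}. y x = f x * v x"
  shows "AE x in lebesgue_on {0..l}. darboux l f y x = f x * q x"
proof -
  have "AE x in lebesgue_on {0..l}. y x / f x = v x"
    using ae AE_space by (rule eventually_elim2) (use f_nz in auto)
  from weak_deriv_AE[OF v this] l_pos
  have "AE x in lebesgue_on {0..l}. weak_deriv 0 l (\<lambda>t. y t / f t) x = q x" by simp
  then show ?thesis unfolding darboux_def by (rule eventually_mono) simp
qed

lemma darboux_inverse_AE:
  assumes v: "primitive_on 0 l v q" and ae: "AE x in lebesgue_on {0..l}. f x * y x = v x"
  shows "AE x in lebesgue_on {0..l}. darboux l (\<lambda>t. 1 / f t) y x = inverse (f x) * q x"
proof -
  have "AE x in lebesgue_on {0..l}. y x / (1 / f x) = v x"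
    using ae by (rule eventually_mono) (simp add: mult.commute)
  from weak_deriv_AE[OF v this] l_pos
  have "AE x in lebesgue_on {0..l}. weak_deriv 0 l (\<lambda>t. y t / (1 / f t)) x = q x" by simp
  then show ?thesis unfolding darboux_def by (rule eventually_mono) (simp only: divide_inverse mult_1)
qed

text \<open>The two first-order factors undo the two integrations. From u/f =
  \<open>sl_ratio\<close> one gets \<open>D_f\<close> u = flux / f, which is in W^{1,2} by the
  product and reciprocal rules; multiplied by f it is the flux again, with derivative f w.\<close>

lemma schroedinger_sl_ratio:
  assumes w: "w \<in> L2_on {0..l}" and ae: "AE x in lebesgue_on {0..l}. y x = f x * sl_ratio f a b w x"
  shows "y \<in> schroedinger_dom l f" and "AE x in lebesgue_on {0..l}. schroedinger l f y x = - w x"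
proof -
  note P1 = sl_flux_primitive[OF w, of b] and P2 = sl_ratio_primitive[OF w, of a b]
  have "AE x in lebesgue_on {0..l}. darboux l f y x = f x * (inverse (f x) ^ 2 * sl_flux f b w x)"
    by (rule darboux_AE[OF P2 ae])
  then have D: "AE x in lebesgue_on {0..l}. darboux l f y x = inverse (f x) * sl_flux f b w x"
    using AE_space by (rule eventually_elim2) (use f_nz in \<open>auto simp: power2_eq_square\<close>)
  have "y \<in> sobolev 1 0 l"
    using sobolev_1_iff[OF l_pos] primitive_on_mult[OF f_prim P2] ae by blast
  moreover have "darboux l f y \<in> sobolev 1 0 l"
    using sobolev_1_iff[OF l_pos] primitive_on_mult[OF primitive_on_inverse[OF f_prim f_nz] P1] D by blast
  ultimately show "y \<in> schroedinger_dom l f" by (simp add: schroedinger_dom_def)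
  have "AE x in lebesgue_on {0..l}. f x * darboux l f y x = sl_flux f b w x"
    using D AE_space by (rule eventually_elim2) (use f_nz in auto)
  from darboux_inverse_AE[OF P1 this]
  show "AE x in lebesgue_on {0..l}. schroedinger l f y x = - w x"
    unfolding schroedinger_def using AE_space
    by (rule eventually_elim2) (use f_nz in auto)
qed

text \<open>The converse direction, for w = -\<rho>^2 y: each first-order factor is integrated from
  0, with the initial data as constants. The unknown stands on both sides, so this is an integral
  equation and not a solution formula.\<close>

lemma exp_solution_sl_ratio:
  assumes f0: "f 0 = 1" and y: "is_exp_solution l f \<rho> y" and x: "x \<in> {0..l}"
  shows "y x = f x * sl_ratio f 1 (\<i> * \<rho>) (\<lambda>r. - \<rho>\<^sup>2 * y r) x"
proof -
  have yS: "y \<in> sobolev 1 0 l" and dS: "darboux l f y \<in> sobolev 1 0 l" and yc: "continuous_on {0..l} y"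
    and y0: "y 0 = 1" and eig: "AE x in lebesgue_on {0..l}. schroedinger l f y x = \<rho>\<^sup>2 * y x"
    using y unfolding is_exp_solution_def schroedinger_dom_def AE_lebesgue_on_Ioo_iff by blast+
  obtain v where vc: "continuous_on {0..l} v" and v: "AE x in lebesgue_on {0..l}. v x = darboux l f y x"
    and v0: "v 0 = \<i> * \<rho>"
    using y unfolding is_exp_solution_def AE_lebesgue_on_Ioo_iff by blast
  obtain y' where y': "primitive_on 0 l y y'"
    using sobolev_1_continuous_imp_primitive_on[OF l_pos yS yc] by blast
  \<comment> \<open>The derivative of y/f by the product and reciprocal rules, so that
    \<open>darboux l f y\<close> is f q almost everywhere.\<close>
  define q where "q = (\<lambda>x. inverse (f x) * y' x + y x * (- (inverse (f x))\<^sup>2 * f' x))"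
  have Q: "primitive_on 0 l (\<lambda>x. y x * inverse (f x)) q"
    unfolding q_def by (rule primitive_on_mult[OF y' primitive_on_inverse[OF f_prim f_nz]])
  have "AE x in lebesgue_on {0..l}. y x = f x * (y x * inverse (f x))"
    using f_nz by (intro AE_I2) auto
  from darboux_AE[OF Q this] have dq: "AE x in lebesgue_on {0..l}. darboux l f y x = f x * q x" .
  obtain z h where zh: "primitive_on 0 l z h" "AE x in lebesgue_on {0..l}. darboux l f y x = z x"
    using dS sobolev_1_iff[OF l_pos] by blast
  \<comment> \<open>The initial value belongs to \<open>v\<close>, the Sobolev regularity to
    \<open>z\<close>. As continuous representatives of one function they coincide, so
    \<open>v\<close> has both.\<close>
  have "v t = z t" if "t \<in> {0..l}" for t
  proof (rule continuous_AE_eq_imp_eq[OF vc primitive_on_continuous[OF zh(1)] l_pos _ that])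
    show "AE x in lebesgue_on {0..l}. v x = z x" using v zh(2) by (rule eventually_elim2) simp
  qed
  then have vh: "primitive_on 0 l v h" by (intro primitive_on_cong[OF zh(1)]) auto
  define r where "r = (\<lambda>x. v x * f' x + f x * h x)"
  have R: "primitive_on 0 l (\<lambda>x. f x * v x) r"
    unfolding r_def by (rule primitive_on_mult[OF f_prim vh])
  have "AE x in lebesgue_on {0..l}. f x * darboux l f y x = f x * v x"
    using v by (rule eventually_mono) simp
  from darboux_inverse_AE[OF R this]
  have "AE x in lebesgue_on {0..l}. schroedinger l f y x = - (inverse (f x) * r x)"
    unfolding schroedinger_def by (rule eventually_mono) simp
  then have "AE x in lebesgue_on {0..l}. \<rho>\<^sup>2 * y x = - (inverse (f x) * r x)"
    using eig by (rule eventually_elim2) simp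
  then have r: "AE x in lebesgue_on {0..l}. r x = f x * (- \<rho>\<^sup>2 * y x)"
    using AE_space
  proof (rule eventually_elim2)
    fix x assume e: "\<rho>\<^sup>2 * y x = - (inverse (f x) * r x)" and "x \<in> space (lebesgue_on {0..l})"
    then have "f x \<noteq> 0" using f_nz by simp
    have "f x * (- \<rho>\<^sup>2 * y x) = - (f x * (\<rho>\<^sup>2 * y x))" by simp
    also have "\<dots> = r x" unfolding e using \<open>f x \<noteq> 0\<close> by simp
    finally show "r x = f x * (- \<rho>\<^sup>2 * y x)" by simp
  qed
  \<comment> \<open>First integration of the equation; f(0) = 1 and v(0) = i\<rho> provide the
    constant.\<close>
  have flux: "f t * v t = sl_flux f (\<i> * \<rho>) (\<lambda>r. - \<rho>\<^sup>2 * y r) t" if t: "t \<in> {0..l}" for t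
  proof -
    have "f t * v t = f 0 * v 0 + integral {0..t} r" by (rule primitive_on_eq[OF R t])
    also have "integral {0..t} r = integral {0..t} (\<lambda>x. f x * (- \<rho>\<^sup>2 * y x))"
      by (rule integral_cong_AE_lebesgue_on[OF r]) (use t in auto)
    finally show ?thesis by (simp add: sl_flux_def f0 v0)
  qed
  have "AE x in lebesgue_on {0..l}. f x * q x = v x"
    using dq v by (rule eventually_elim2) simp
  then have q: "AE x in lebesgue_on {0..l}. q x = inverse (f x) ^ 2 * sl_flux f (\<i> * \<rho>) (\<lambda>r. - \<rho>\<^sup>2 * y r) x"
    using AE_space
  proof (rule eventually_elim2)
    fix x assume e: "f x * q x = v x" and "x \<in> space (lebesgue_on {0..l})"
    then have x: "x \<in> {0..l}" by simp
    have "q x = inverse (f x) ^ 2 * (f x * (f x * q x))"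
      using f_nz[OF x] by (simp add: power2_eq_square field_simps)
    then show "q x = inverse (f x) ^ 2 * sl_flux f (\<i> * \<rho>) (\<lambda>r. - \<rho>\<^sup>2 * y r) x"
      unfolding e flux[OF x] .
  qed
  have "y x * inverse (f x) = y 0 * inverse (f 0) + integral {0..x} q" by (rule primitive_on_eq[OF Q x])
  also have "integral {0..x} q = integral {0..x} (\<lambda>s. inverse (f s) ^ 2 * sl_flux f (\<i> * \<rho>) (\<lambda>r. - \<rho>\<^sup>2 * y r) s)"
    by (rule integral_cong_AE_lebesgue_on[OF q]) (use x in auto)
  finally have "y x * inverse (f x) = sl_ratio f 1 (\<i> * \<rho>) (\<lambda>r. - \<rho>\<^sup>2 * y r) x"
    by (simp add: sl_ratio_def f0 y0)
  moreover have "f x * (y x * inverse (f x)) = y x" using f_nz[OF x] by simp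
  ultimately show ?thesis by simp
qed

text \<open>Integrals do not see null sets, so transforms that are known only almost everywhere may
  stand for w while the conclusion holds at every x.\<close>

lemma sl_ratio_cong_AE:
  assumes ae: "AE x in lebesgue_on {0..l}. w x = w' x" and x: "x \<in> {0..l}"
  shows "sl_ratio f a b w x = sl_ratio f a b w' x"
proof -
  have fl: "sl_flux f b w s = sl_flux f b w' s" if "s \<in> {0..l}" for s
  proof -
    have "AE x in lebesgue_on {0..l}. f x * w x = f x * w' x" by (rule eventually_mono[OF ae]) simp
    from integral_cong_AE_lebesgue_on[OF this, of 0 s] show ?thesis
      using that unfolding sl_flux_def by simp
  qed
  have "integral {0..x} (\<lambda>s. inverse (f s) ^ 2 * sl_flux f b w s) = integral {0..x} (\<lambda>s. inverse (f s) ^ 2 * sl_flux f b w' s)"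
    by (rule Henstock_Kurzweil_Integration.integral_cong) (use x fl in auto)
  then show ?thesis by (simp add: sl_ratio_def)
qed

lemma sl_ratio_linear:
  assumes w: "w \<in> L2_on {0..l}" and w': "w' \<in> L2_on {0..l}" and x: "x \<in> {0..l}"
  shows "sl_ratio f (c * a + a') (c * b + b') (\<lambda>r. c * w r + w' r) x = c * sl_ratio f a b w x + sl_ratio f a' b' w' x"
proof -
  have fl: "sl_flux f (c * b + b') (\<lambda>r. c * w r + w' r) s = c * sl_flux f b w s + sl_flux f b' w' s" if s: "s \<in> {0..l}" for s
  proof -
    have "{0..s} \<subseteq> {0..l}" using s by simp
    then have "(\<lambda>r. f r * w r) integrable_on {0..s}" "(\<lambda>r. f r * w' r) integrable_on {0..s}"
      using integrable_lebesgue_on_Icc_integrable_on(1) L2_on_imp_integrable(1)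
        L2_on_continuous_mult[OF w f_cont] L2_on_continuous_mult[OF w' f_cont] by blast+
    then have "integral {0..s} (\<lambda>r. c * (f r * w r) + f r * w' r) = c * integral {0..s} (\<lambda>r. f r * w r) + integral {0..s} (\<lambda>r. f r * w' r)"
      by (subst Henstock_Kurzweil_Integration.integral_add[OF integrable_on_mult_right]) simp_all
    moreover have "(\<lambda>r. f r * (c * w r + w' r)) = (\<lambda>r. c * (f r * w r) + f r * w' r)"
      by (simp add: algebra_simps)
    ultimately show ?thesis by (simp add: sl_flux_def distrib_left)
  qed
  have i: "(\<lambda>s. inverse (f s) ^ 2 * sl_flux f b w s) integrable_on {0..x}" if "w \<in> L2_on {0..l}" for b w
    by (rule integrable_lebesgue_on_Icc_integrable_on(1)[OF L2_on_imp_integrable(1)[OF primitive_on_L2[OF sl_ratio_primitive[OF that]]]])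
       (use x in auto)
  have "integral {0..x} (\<lambda>s. inverse (f s) ^ 2 * sl_flux f (c * b + b') (\<lambda>r. c * w r + w' r) s)
      = integral {0..x} (\<lambda>s. c * (inverse (f s) ^ 2 * sl_flux f b w s) + inverse (f s) ^ 2 * sl_flux f b' w' s)"
    by (rule Henstock_Kurzweil_Integration.integral_cong) (use x fl in \<open>simp add: algebra_simps\<close>)
  also have "\<dots> = c * integral {0..x} (\<lambda>s. inverse (f s) ^ 2 * sl_flux f b w s) + integral {0..x} (\<lambda>s. inverse (f s) ^ 2 * sl_flux f b' w' s)"
    using i[OF w] i[OF w'] by (subst Henstock_Kurzweil_Integration.integral_add[OF integrable_on_mult_right]) simp_all
  finally show ?thesis by (simp add: sl_ratio_def algebra_simps)
qed

text \<open>L^1 convergence of w suffices: f is bounded by some B, so the inner integrals differ by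
  at most B times the L^1 distance. The flux therefore converges uniformly, and the outer integral
  with it.\<close>

lemma sl_ratio_tendsto:
  assumes w: "\<And>n::nat. w n \<in> L2_on {0..l}" and v: "v \<in> L2_on {0..l}" and x: "x \<in> {0..l}"
    and wv: "(\<lambda>n. LINT r|lebesgue_on {0..l}. norm (w n r - v r)) \<longlonglongrightarrow> 0"
    and a: "a \<longlonglongrightarrow> a'" and b: "b \<longlonglongrightarrow> b'"
  shows "(\<lambda>n. sl_ratio f (a n) (b n) (w n) x) \<longlonglongrightarrow> sl_ratio f a' b' v x"
proof -
  let ?M = "lebesgue_on {0..l}"
  have "bounded (f ` {0..l})" by (intro compact_imp_bounded compact_continuous_image f_cont) simp
  then obtain B where B: "\<And>x. x \<in> {0..l} \<Longrightarrow> norm (f x) \<le> B" unfolding bounded_iff by blast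
  have fc: "continuous_on {0..l} (sl_flux f b w)" if "w \<in> L2_on {0..l}" for b w
    by (rule primitive_on_continuous[OF sl_flux_primitive[OF that]])
  have bd: "bounded (h ` {0..l})" if "continuous_on {0..l} h" for h :: "real \<Rightarrow> complex"
    by (intro compact_imp_bounded compact_continuous_image that) simp
  have ic: "continuous_on {0..l} (\<lambda>s. inverse (f s) ^ 2)" by (intro continuous_intros inverse_f_cont)
  have U: "uniform_limit {0..l} (\<lambda>n. sl_flux f (b n) (w n)) (sl_flux f b' v) sequentially"
  proof (rule uniform_limitI)
    fix e :: real assume e: "0 < e"
    have "(\<lambda>n. norm (b n - b') + B * (LINT r|?M. norm (w n r - v r))) \<longlonglongrightarrow> norm (b' - b') + B * 0"
      by (intro tendsto_intros b wv)
    then have "\<forall>\<^sub>F n in sequentially. norm (b n - b') + B * (LINT r|?M. norm (w n r - v r)) < e"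
      using e by (intro order_tendstoD(2)[where y = "norm (b' - b') + B * 0"]) simp_all
    then show "\<forall>\<^sub>F n in sequentially. \<forall>s\<in>{0..l}. dist (sl_flux f (b n) (w n) s) (sl_flux f b' v s) < e"
    proof (rule eventually_mono, intro ballI)
      fix n s assume n: "norm (b n - b') + B * (LINT r|?M. norm (w n r - v r)) < e" and s: "s \<in> {0..l}"
      note i = L2_on_imp_integrable(1)[OF L2_on_continuous_mult[OF w[of n] f_cont]]
        L2_on_imp_integrable(1)[OF L2_on_continuous_mult[OF v f_cont]]
      have s': "{0..s} \<subseteq> {0..l}" using s by simp
      note i' = i[THEN integrable_lebesgue_on_Icc_integrable_on(1), OF s']
      have wvi: "integrable ?M (\<lambda>r. w n r - v r)" by (rule L2_on_imp_integrable(1)[OF L2_on_diff[OF w v]])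
      have "sl_flux f (b n) (w n) s - sl_flux f b' v s = (b n - b') + integral {0..s} (\<lambda>r. f r * w n r - f r * v r)"
        using i' by (simp add: sl_flux_def Henstock_Kurzweil_Integration.integral_diff)
      then have "norm (sl_flux f (b n) (w n) s - sl_flux f b' v s) \<le> norm (b n - b') + norm (integral {0..s} (\<lambda>r. f r * w n r - f r * v r))"
        using norm_triangle_ineq by metis
      also have "norm (integral {0..s} (\<lambda>r. f r * w n r - f r * v r)) \<le> (LINT r|?M. norm (f r * w n r - f r * v r))"
        by (rule norm_integral_le_L1[OF Bochner_Integration.integrable_diff[OF i] s'])
      also have "\<dots> \<le> (LINT r|?M. B * norm (w n r - v r))"
      proof (rule integral_mono)
        fix r assume "r \<in> space ?M"
        then have "norm (f r) * norm (w n r - v r) \<le> B * norm (w n r - v r)"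
          by (intro mult_right_mono B) simp_all
        then show "norm (f r * w n r - f r * v r) \<le> B * norm (w n r - v r)"
          by (simp add: norm_mult flip: right_diff_distrib)
      qed (use i wvi in auto)
      also have "\<dots> = B * (LINT r|?M. norm (w n r - v r))" by simp
      finally show "dist (sl_flux f (b n) (w n) s) (sl_flux f b' v s) < e" using n by (simp add: dist_norm)
    qed
  qed
  have U2: "uniform_limit {0..l} (\<lambda>n s. inverse (f s) ^ 2 * sl_flux f (b n) (w n) s) (\<lambda>s. inverse (f s) ^ 2 * sl_flux f b' v s) sequentially"
    by (rule uniform_lim_mult[OF uniform_limit_const U bd[OF ic] bd[OF fc[OF v]]])
  \<comment> \<open>The factor 1 plays the integrable function in
    \<open>tendsto_integral_L1_uniform\<close>; all the convergence sits in the uniform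
    factor.\<close>
  have "(\<lambda>n. integral {0..x} (\<lambda>s. inverse (f s) ^ 2 * sl_flux f (b n) (w n) s * 1)) \<longlonglongrightarrow> integral {0..x} (\<lambda>s. inverse (f s) ^ 2 * sl_flux f b' v s * 1)"
  proof (rule tendsto_integral_L1_uniform[OF _ _ _ _ U2 x])
    show "continuous_on {0..l} (\<lambda>s. inverse (f s) ^ 2 * sl_flux f (b n) (w n) s)" for n
      by (intro continuous_on_mult ic fc w)
  qed simp_all
  then show ?thesis unfolding sl_ratio_def by (intro tendsto_intros a) simp
qed

end

section \<open>Integral operators with a square integrable kernel\<close>

text \<open>Sections of a Lebesgue measurable function of two variables may fail to be measurable,
  whereas those of a Borel function are Borel. Iterated integrals are therefore taken of Borel
  representatives.\<close>

lemma borel_representative: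
  fixes u :: "'a::euclidean_space \<Rightarrow> complex"
  assumes u: "u \<in> borel_measurable lebesgue"
  obtains v where "v \<in> borel_measurable borel" "AE z in lborel. u z = v z"
proof -
  have "(\<lambda>z. Re (u z)) \<in> borel_measurable lebesgue" "(\<lambda>z. Im (u z)) \<in> borel_measurable lebesgue"
    using u by measurable
  from this[THEN completion_ex_borel_measurable_real]
  obtain r i where m: "r \<in> borel_measurable lborel" "i \<in> borel_measurable lborel"
    and ae: "AE z in lborel. Re (u z) = r z" "AE z in lborel. Im (u z) = i z" by blast
  show thesis
  proof (rule that)
    have [measurable]: "r \<in> borel_measurable borel" "i \<in> borel_measurable borel" using m by simp_all
    show "(\<lambda>z. Complex (r z) (i z)) \<in> borel_measurable borel" unfolding Complex_eq by measurable
    show "AE z in lborel. u z = Complex (r z) (i z)"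
      using ae by (rule eventually_elim2) (simp add: complex_eq_iff)
  qed
qed

lemma borel_representative_on:
  fixes u :: "real \<Rightarrow> complex"
  assumes "u \<in> borel_measurable (lebesgue_on {a..b})"
  obtains v where "v \<in> borel_measurable borel" "AE x in lebesgue_on {a..b}. u x = v x"
proof -
  have "(\<lambda>x. if x \<in> {a..b} then u x else 0) \<in> borel_measurable lebesgue"
    by (rule borel_measurable_if[THEN iffD2, OF _ assms]) simp
  from borel_representative[OF this] obtain v where v: "v \<in> borel_measurable borel"
    and "AE x in lborel. (if x \<in> {a..b} then u x else 0) = v x" by blast
  then have "AE x in lebesgue. (if x \<in> {a..b} then u x else 0) = v x" by (intro AE_completion)
  then have "AE x in lebesgue. x \<in> {a..b} \<longrightarrow> u x = v x" by (rule eventually_mono) auto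
  then have "AE x in lebesgue_on {a..b}. u x = v x" by (subst AE_restrict_space_iff) auto
  with v show thesis by (rule that)
qed

lemma borel_measurable_imp_lebesgue_on:
  "u \<in> borel_measurable borel \<Longrightarrow> u \<in> borel_measurable (lebesgue_on S)"
  by (intro measurable_restrict_space1 measurable_completion) simp

lemma lebesgue_on_integral_eq_lborel:
  fixes h :: "real \<Rightarrow> 'b::{banach, second_countable_topology}"
  assumes "h \<in> borel_measurable borel"
  shows "(LINT t|lebesgue_on {a..b}. h t) = (LINT t|lborel. indicator {a..b} t *\<^sub>R h t)"
    and "integrable (lebesgue_on {a..b}) h \<longleftrightarrow> integrable lborel (\<lambda>t. indicator {a..b} t *\<^sub>R h t)"
proof -
  have m: "(\<lambda>t. indicator {a..b} t *\<^sub>R h t) \<in> borel_measurable lborel" using assms by simp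
  show "(LINT t|lebesgue_on {a..b}. h t) = (LINT t|lborel. indicator {a..b} t *\<^sub>R h t)"
    using integral_completion[OF m] by (simp add: integral_restrict_space)
  show "integrable (lebesgue_on {a..b}) h \<longleftrightarrow> integrable lborel (\<lambda>t. indicator {a..b} t *\<^sub>R h t)"
    using integrable_completion[OF m] by (simp add: integrable_restrict_space)
qed

section \<open>The Hilbert-Schmidt operator of a Borel kernel\<close>

locale L2_kernel =
  fixes l :: real and k :: "real \<Rightarrow> real \<Rightarrow> complex"
  assumes k_meas: "(\<lambda>z. k (fst z) (snd z)) \<in> borel_measurable borel"
    and k_L2: "integrable lborel (\<lambda>z. (norm (k (fst z) (snd z)))\<^sup>2)"
begin

text \<open>The range of integration does not depend on x: the kernel of interest is extended by 0
  off the triangle, so the Volterra operator becomes one over a rectangle.\<close>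

definition kint :: "(real \<Rightarrow> complex) \<Rightarrow> real \<Rightarrow> complex" where
  "kint y x = (LINT t|lebesgue_on {-l..l}. k x t * y t)"

definition ksec :: "real \<Rightarrow> real" where
  "ksec x = (LINT t|lebesgue_on {-l..l}. (norm (k x t))\<^sup>2)"

definition sqn :: "(real \<Rightarrow> complex) \<Rightarrow> real" where
  "sqn y = (LINT t|lebesgue_on {-l..l}. (norm (y t))\<^sup>2)"

lemma k_pair_meas [measurable]: "(\<lambda>(x, t). k x t) \<in> borel_measurable (borel \<Otimes>\<^sub>M borel)"
  using k_meas by (simp add: borel_prod case_prod_beta)

lemma k_sec_meas: "k x \<in> borel_measurable borel"
proof -
  have "(\<lambda>t. (\<lambda>(x, t). k x t) (x, t)) \<in> borel_measurable borel" by measurable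
  then show ?thesis by simp
qed

lemma k_cut_integrable:
  "integrable (lborel \<Otimes>\<^sub>M lborel) (\<lambda>(x, t). indicator {-l..l} t *\<^sub>R (norm (k x t))\<^sup>2)"
proof -
  have "integrable (lborel \<Otimes>\<^sub>M lborel) (\<lambda>(x, t). (norm (k x t))\<^sup>2)"
    using k_L2 by (simp add: lborel_prod case_prod_beta')
  then show ?thesis
  proof (rule Bochner_Integration.integrable_bound)
    show "(\<lambda>(x, t). indicator {-l..l} t *\<^sub>R (norm (k x t))\<^sup>2) \<in> borel_measurable (lborel \<Otimes>\<^sub>M lborel)"
      by measurable
  qed (auto intro!: AE_I2 simp: indicator_def)
qed

text \<open>Fubini for |k|^2. Only almost every section is square integrable, which is why linearity
  and convergence of \<open>kint\<close> carry this condition on x.\<close>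

lemma AE_k_L2: "AE x in lebesgue_on {0..l}. k x \<in> L2_on {-l..l}"
proof -
  have "AE x in lborel. integrable lborel (\<lambda>t. indicator {-l..l} t *\<^sub>R (norm (k x t))\<^sup>2)"
    by (rule lborel_pair.AE_integrable_fst[OF k_cut_integrable])
  then have "AE x in lborel. k x \<in> L2_on {-l..l}"
  proof (rule eventually_mono)
    fix x assume i: "integrable lborel (\<lambda>t. indicator {-l..l} t *\<^sub>R (norm (k x t))\<^sup>2)"
    have "(\<lambda>t. (norm (k x t))\<^sup>2) \<in> borel_measurable borel" using k_sec_meas by measurable
    from lebesgue_on_integral_eq_lborel(2)[OF this, of "-l" l] i
    show "k x \<in> L2_on {-l..l}"
      unfolding L2_on_def using borel_measurable_imp_lebesgue_on[OF k_sec_meas] by auto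
  qed
  then have "AE x in lebesgue. k x \<in> L2_on {-l..l}" by (rule AE_completion)
  then have "AE x in lebesgue. x \<in> {0..l} \<longrightarrow> k x \<in> L2_on {-l..l}" by (rule eventually_mono) simp
  then show ?thesis by (subst AE_restrict_space_iff) auto
qed

lemma ksec_integrable: "integrable (lebesgue_on {0..l}) ksec"
proof -
  have "(\<lambda>t. (norm (k x t))\<^sup>2) \<in> borel_measurable borel" for x using k_sec_meas by measurable
  then have eq: "ksec = (\<lambda>x. LINT t|lborel. indicator {-l..l} t *\<^sub>R (norm (k x t))\<^sup>2)"
    unfolding ksec_def by (intro ext lebesgue_on_integral_eq_lborel(1))
  have i: "integrable lborel ksec"
    unfolding eq by (rule lborel_pair.integrable_fst[OF k_cut_integrable])
  then have m: "ksec \<in> borel_measurable borel" by auto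
  have "integrable lborel (\<lambda>t. indicator {0..l} t *\<^sub>R ksec t)"
    using i by (intro integrable_mult_indicator) auto
  then show ?thesis by (simp add: lebesgue_on_integral_eq_lborel(2)[OF m])
qed

lemma kint_cong_AE:
  assumes y: "y \<in> borel_measurable (lebesgue_on {-l..l})" and z: "z \<in> borel_measurable (lebesgue_on {-l..l})"
    and ae: "AE t in lebesgue_on {-l..l}. y t = z t"
  shows "kint y x = kint z x"
  unfolding kint_def
proof (rule integral_cong_AE)
  show "AE t in lebesgue_on {-l..l}. k x t * y t = k x t * z t" by (rule eventually_mono[OF ae]) simp
qed (intro borel_measurable_times y z borel_measurable_imp_lebesgue_on k_sec_meas)+

text \<open>Replacing y by a Borel function changes no value of \<open>kint\<close>, at any x; the
  integrand is then jointly Borel and the integral depends measurably on x.\<close>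

lemma kint_measurable:
  assumes y: "y \<in> borel_measurable (lebesgue_on {-l..l})"
  shows "kint y \<in> borel_measurable (lebesgue_on {0..l})"
proof -
  obtain z where z [measurable]: "z \<in> borel_measurable borel" and ae: "AE t in lebesgue_on {-l..l}. y t = z t"
    using borel_representative_on[OF y] by blast
  have "kint y x = (LINT t|lborel. indicator {-l..l} t *\<^sub>R (k x t * z t))" for x
  proof -
    have "kint y x = kint z x" by (rule kint_cong_AE[OF y borel_measurable_imp_lebesgue_on[OF z] ae])
    also have "\<dots> = (LINT t|lborel. indicator {-l..l} t *\<^sub>R (k x t * z t))"
      unfolding kint_def by (rule lebesgue_on_integral_eq_lborel(1)) (intro borel_measurable_times k_sec_meas z)
    finally show ?thesis .
  qed
  then have "kint y = (\<lambda>x. LINT t|lborel. indicator {-l..l} t *\<^sub>R (k x t * z t))" by blast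
  moreover have "(\<lambda>x. LINT t|lborel. indicator {-l..l} t *\<^sub>R (k x t * z t)) \<in> borel_measurable borel"
    by (rule lborel.borel_measurable_lebesgue_integral) measurable
  ultimately show ?thesis by (simp add: borel_measurable_imp_lebesgue_on)
qed

lemma kint_bound:
  assumes k: "k x \<in> L2_on {-l..l}" and y: "y \<in> L2_on {-l..l}"
  shows "integrable (lebesgue_on {-l..l}) (\<lambda>t. k x t * y t)"
    and "(norm (kint y x))\<^sup>2 \<le> ksec x * sqn y"
proof -
  note C = Cauchy_Schwarz_integral[of "k x" "lebesgue_on {-l..l}" y]
  show i: "integrable (lebesgue_on {-l..l}) (\<lambda>t. k x t * y t)"
    using C(1) k y by (simp add: L2_on_def)
  have "(norm (kint y x))\<^sup>2 \<le> (LINT t|lebesgue_on {-l..l}. norm (k x t * y t))\<^sup>2"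
    unfolding kint_def by (intro power_mono integral_norm_bound) simp
  also have "\<dots> \<le> ksec x * sqn y"
    unfolding ksec_def sqn_def using C(2) k y by (simp add: L2_on_def)
  finally show "(norm (kint y x))\<^sup>2 \<le> ksec x * sqn y" .
qed

text \<open>The Hilbert-Schmidt bound: the Cauchy-Schwarz estimate on each section is integrated
  over x.\<close>

lemma kint_L2:
  assumes y: "y \<in> L2_on {-l..l}"
  shows "kint y \<in> L2_on {0..l}"
    and "(LINT x|lebesgue_on {0..l}. (norm (kint y x))\<^sup>2) \<le> (LINT x|lebesgue_on {0..l}. ksec x) * sqn y"
proof -
  have m: "kint y \<in> borel_measurable (lebesgue_on {0..l})" by (rule kint_measurable) (use y in auto)
  have b: "AE x in lebesgue_on {0..l}. (norm (kint y x))\<^sup>2 \<le> ksec x * sqn y"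
    using AE_k_L2 by (rule eventually_mono) (rule kint_bound(2)[OF _ y])
  have i: "integrable (lebesgue_on {0..l}) (\<lambda>x. ksec x * sqn y)" using ksec_integrable by simp
  then have i2: "integrable (lebesgue_on {0..l}) (\<lambda>x. (norm (kint y x))\<^sup>2)"
  proof (rule Bochner_Integration.integrable_bound)
    show "AE x in lebesgue_on {0..l}. norm ((norm (kint y x))\<^sup>2) \<le> norm (ksec x * sqn y)"
      using b by (rule eventually_mono) (smt (verit) real_norm_def zero_le_power2)
  qed (use m in measurable)
  with m show "kint y \<in> L2_on {0..l}" by (simp add: L2_on_def)
  show "(LINT x|lebesgue_on {0..l}. (norm (kint y x))\<^sup>2) \<le> (LINT x|lebesgue_on {0..l}. ksec x) * sqn y"
    using integral_mono_AE[OF i2 i b] by simp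
qed

lemma kint_linear:
  assumes "k x \<in> L2_on {-l..l}" "y \<in> L2_on {-l..l}" "z \<in> L2_on {-l..l}"
  shows "kint (\<lambda>t. c * y t + z t) x = c * kint y x + kint z x"
proof -
  note i = kint_bound(1)[OF assms(1,2)] kint_bound(1)[OF assms(1,3)]
  have "kint (\<lambda>t. c * y t + z t) x = (LINT t|lebesgue_on {-l..l}. c * (k x t * y t) + k x t * z t)"
    unfolding kint_def by (intro Bochner_Integration.integral_cong) (auto simp: algebra_simps)
  also have "\<dots> = c * kint y x + kint z x"
    unfolding kint_def using i by (subst Bochner_Integration.integral_add) auto
  finally show ?thesis .
qed

lemma kint_diff:
  assumes "k x \<in> L2_on {-l..l}" "y \<in> L2_on {-l..l}" "z \<in> L2_on {-l..l}"
  shows "kint (\<lambda>t. y t - z t) x = kint y x - kint z x"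
  using kint_linear[OF assms(1,3,2), of "-1"] by (simp add: algebra_simps)

text \<open>Convergence at a point with square integrable section; it handles the left-hand side of
  the Volterra identity.\<close>

lemma kint_tendsto:
  assumes k: "k x \<in> L2_on {-l..l}" and y: "\<And>n. y n \<in> L2_on {-l..l}" and z: "z \<in> L2_on {-l..l}"
    and lim: "(\<lambda>n::nat. sqn (\<lambda>t. y n t - z t)) \<longlonglongrightarrow> 0"
  shows "(\<lambda>n. kint (y n) x) \<longlonglongrightarrow> kint z x"
proof -
  have "(\<lambda>n. (norm (kint (y n) x - kint z x))\<^sup>2) \<longlonglongrightarrow> 0"
  proof (rule tendsto_sandwich[of "\<lambda>_. 0" _ _ "\<lambda>n. ksec x * sqn (\<lambda>t. y n t - z t)"])
    show "(\<lambda>n. ksec x * sqn (\<lambda>t. y n t - z t)) \<longlonglongrightarrow> 0"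
      using tendsto_mult_left[OF lim, of "ksec x"] by simp
    show "\<forall>\<^sub>F n in sequentially. (norm (kint (y n) x - kint z x))\<^sup>2 \<le> ksec x * sqn (\<lambda>t. y n t - z t)"
      using kint_bound(2)[OF k L2_on_diff[OF y z]] kint_diff[OF k y z] by (intro always_eventually) simp
  qed simp_all
  from tendsto_real_sqrt[OF this] have "(\<lambda>n. norm (kint (y n) x - kint z x)) \<longlonglongrightarrow> 0" by simp
  then show ?thesis by (simp add: LIM_zero_iff tendsto_norm_zero_iff)
qed

text \<open>Convergence in mean, from the Hilbert-Schmidt bound for the difference; it is the form
  that \<open>sl_ratio_tendsto\<close> asks of the right-hand side.\<close>

lemma kint_tendsto_L1:
  assumes y: "\<And>n. y n \<in> L2_on {-l..l}" and z: "z \<in> L2_on {-l..l}"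
    and lim: "(\<lambda>n::nat. sqn (\<lambda>t. y n t - z t)) \<longlonglongrightarrow> 0"
  shows "(\<lambda>n. LINT x|lebesgue_on {0..l}. norm (kint (y n) x - kint z x)) \<longlonglongrightarrow> 0"
proof -
  let ?I = "\<lambda>n. LINT x|lebesgue_on {0..l}. norm (kint (y n) x - kint z x)"
  define C where "C = \<bar>l\<bar> * (LINT x|lebesgue_on {0..l}. ksec x)"
  have "(\<lambda>n. (?I n)\<^sup>2) \<longlonglongrightarrow> 0"
  proof (rule tendsto_sandwich[of "\<lambda>_. 0" _ _ "\<lambda>n. C * sqn (\<lambda>t. y n t - z t)"])
    show "(\<lambda>n. C * sqn (\<lambda>t. y n t - z t)) \<longlonglongrightarrow> 0"
      using tendsto_mult_left[OF lim, of C] by simp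
    have "(?I n)\<^sup>2 \<le> C * sqn (\<lambda>t. y n t - z t)" for n
    proof -
      let ?d = "\<lambda>t. y n t - z t"
      have d: "?d \<in> L2_on {-l..l}" by (intro L2_on_diff y z)
      have "?I n = (LINT x|lebesgue_on {0..l}. norm (kint ?d x))"
      proof (rule integral_cong_AE)
        show "AE x in lebesgue_on {0..l}. norm (kint (y n) x - kint z x) = norm (kint ?d x)"
          using AE_k_L2 by (rule eventually_mono) (simp add: kint_diff y z)
        have [measurable]: "kint (y n) \<in> borel_measurable (lebesgue_on {0..l})"
          "kint z \<in> borel_measurable (lebesgue_on {0..l})" "kint ?d \<in> borel_measurable (lebesgue_on {0..l})"
          by (intro L2_on_measurableD kint_L2(1) y z d)+
        show "(\<lambda>x. norm (kint (y n) x - kint z x)) \<in> borel_measurable (lebesgue_on {0..l})"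
          "(\<lambda>x. norm (kint ?d x)) \<in> borel_measurable (lebesgue_on {0..l})" by measurable
      qed
      then have "(?I n)\<^sup>2 \<le> \<bar>l - 0\<bar> * (LINT x|lebesgue_on {0..l}. (norm (kint ?d x))\<^sup>2)"
        using L2_on_imp_integrable(2)[OF kint_L2(1)[OF d]] by simp
      also have "\<dots> \<le> \<bar>l - 0\<bar> * ((LINT x|lebesgue_on {0..l}. ksec x) * sqn ?d)"
        by (intro mult_left_mono kint_L2(2) d) simp
      finally show ?thesis by (simp add: C_def mult.assoc)
    qed
    then show "\<forall>\<^sub>F n in sequentially. (?I n)\<^sup>2 \<le> C * sqn (\<lambda>t. y n t - z t)" by simp
  qed simp_all
  from tendsto_real_sqrt[OF this] show ?thesis by simp
qed

end

text \<open>The kernel is extended by 0 off the triangle and replaced by a Borel function equal to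
  it almost everywhere in the plane. By Fubini almost every section is then unchanged up to a null
  set in t, so the integrals against y agree for almost every x.\<close>

lemma transmutation_kernel_borel_version:
  assumes K: "K \<in> L2_on (triangle l)"
  obtains k where "L2_kernel k"
    and "\<And>y. y \<in> L2_on {-l..l} \<Longrightarrow>
      AE x in lebesgue_on {0..l}. (LINT t:{-x..x}|lebesgue. K (x, t) * y t) = L2_kernel.kint l k y x"
proof -
  have "triangle l = {z. 0 \<le> fst z \<and> fst z \<le> l \<and> \<bar>snd z\<bar> \<le> fst z}" by (auto simp: triangle_def)
  also have "closed \<dots>" by (intro closed_Collect_conj closed_Collect_le continuous_intros)
  finally have tri: "triangle l \<in> sets lebesgue" by (simp add: borel_closed)
  define Kt where "Kt z = (if z \<in> triangle l then K z else 0)" for z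
  have Ktm: "Kt \<in> borel_measurable lebesgue"
    unfolding Kt_def[abs_def] using K tri by (subst borel_measurable_if) (auto simp: L2_on_def)
  obtain K' where K'm: "K' \<in> borel_measurable borel" and ae: "AE z in lborel. Kt z = K' z"
    using borel_representative[OF Ktm] by blast
  define k where "k x t = K' (x, t)" for x t
  have "integrable lebesgue (\<lambda>z. if z \<in> triangle l then (norm (K z))\<^sup>2 else 0)"
    using K tri by (subst Lebesgue_Measure.integrable_restrict_UNIV) (auto simp: L2_on_def)
  moreover have "(\<lambda>z. if z \<in> triangle l then (norm (K z))\<^sup>2 else 0) = (\<lambda>z. (norm (Kt z))\<^sup>2)"
    by (auto simp: Kt_def)
  ultimately have i: "integrable lebesgue (\<lambda>z. (norm (Kt z))\<^sup>2)" by simp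
  have K'2: "(\<lambda>z. (norm (K' z))\<^sup>2) \<in> borel_measurable borel" using K'm by measurable
  have "integrable lebesgue (\<lambda>z. (norm (K' z))\<^sup>2)"
  proof (rule integrable_cong_AE_imp[OF i])
    show "(\<lambda>z. (norm (K' z))\<^sup>2) \<in> borel_measurable lebesgue"
      by (rule measurable_completion) (use K'2 in simp)
    show "AE z in lebesgue. (norm (Kt z))\<^sup>2 = (norm (K' z))\<^sup>2"
      by (rule AE_completion, rule eventually_mono[OF ae]) simp
  qed
  then have "integrable lborel (\<lambda>z. (norm (K' z))\<^sup>2)"
    by (subst (asm) integrable_completion) (use K'2 in simp_all)
  then interpret k: L2_kernel l k
    by unfold_locales (use K'm in \<open>simp_all add: k_def\<close>)
  show thesis
  proof (rule that)
    show "L2_kernel k" by unfold_locales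
    fix y :: "real \<Rightarrow> complex" assume y: "y \<in> L2_on {-l..l}"
    have "AE z in lborel \<Otimes>\<^sub>M lborel. Kt z = K' z" using ae by (subst lborel_prod)
    then have "AE x in lborel. AE t in lborel. Kt (x, t) = K' (x, t)" by (rule lborel_pair.AE_pair)
    then have "AE x in lebesgue. AE t in lborel. Kt (x, t) = K' (x, t)" by (rule AE_completion)
    then have "AE x in lebesgue. x \<in> {0..l} \<longrightarrow> (LINT t:{-x..x}|lebesgue. K (x, t) * y t) = k.kint y x"
    proof (rule eventually_mono, intro impI)
      fix x assume *: "AE t in lborel. Kt (x, t) = K' (x, t)" and x: "x \<in> {0..l}"
      have aet: "AE t in lebesgue. indicator {-l..l} t *\<^sub>R (k x t * y t) = indicator {-x..x} t *\<^sub>R (K (x, t) * y t)"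
        using AE_completion[OF *]
      proof (rule eventually_mono)
        fix t assume e: "Kt (x, t) = K' (x, t)"
        show "indicator {-l..l} t *\<^sub>R (k x t * y t) = indicator {-x..x} t *\<^sub>R (K (x, t) * y t)"
        proof (cases "t \<in> {-x..x}")
          case True
          then have "(x, t) \<in> triangle l" using x by (auto simp: triangle_def)
          then show ?thesis using e True x by (simp add: Kt_def k_def)
        next
          case False
          then have "(x, t) \<notin> triangle l" by (auto simp: triangle_def)
          then show ?thesis using e False by (simp add: Kt_def k_def)
        qed
      qed
      have "(\<lambda>t. if t \<in> {-l..l} then k x t * y t else 0) \<in> borel_measurable lebesgue"
        using borel_measurable_times[OF borel_measurable_imp_lebesgue_on[OF k.k_sec_meas] L2_on_measurableD[OF y]]
        by (subst borel_measurable_if) auto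
      moreover have "(\<lambda>t. if t \<in> {-l..l} then k x t * y t else 0) = (\<lambda>t. indicator {-l..l} t *\<^sub>R (k x t * y t))"
        by (auto simp: indicator_def)
      ultimately have m: "(\<lambda>t. indicator {-l..l} t *\<^sub>R (k x t * y t)) \<in> borel_measurable lebesgue" by simp
      have "k.kint y x = (LINT t|lebesgue. indicator {-l..l} t *\<^sub>R (k x t * y t))"
        unfolding k.kint_def by (rule integral_restrict_space) simp
      also have "\<dots> = (LINT t|lebesgue. indicator {-x..x} t *\<^sub>R (K (x, t) * y t))"
        by (rule integral_cong_AE[OF m borel_measurable_AE[OF m aet] aet])
      finally show "(LINT t:{-x..x}|lebesgue. K (x, t) * y t) = k.kint y x"
        by (simp add: set_lebesgue_integral_def)
    qed
    then show "AE x in lebesgue_on {0..l}. (LINT t:{-x..x}|lebesgue. K (x, t) * y t) = k.kint y x"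
      by (subst AE_restrict_space_iff) auto
  qed
qed

section \<open>The intertwining relation\<close>

lemma AE_lebesgue_on_subset:
  fixes S T :: "real set"
  assumes "AE x in lebesgue_on T. P x" "S \<subseteq> T" "S \<in> sets lebesgue" "T \<in> sets lebesgue"
  shows "AE x in lebesgue_on S. P x"
proof -
  have "AE x in lebesgue. x \<in> T \<longrightarrow> P x"
    using assms(1,4) by (subst (asm) AE_restrict_space_iff) auto
  then have "AE x in lebesgue. x \<in> S \<longrightarrow> P x" by (rule eventually_mono) (use assms(2) in auto)
  then show ?thesis using assms(3) by (subst AE_restrict_space_iff) auto
qed

lemma L2_on_subinterval:
  assumes u: "u \<in> L2_on {a..b}" and cd: "{c..d} \<subseteq> {a..b::real}"
  shows "u \<in> L2_on {c..d}"
  unfolding L2_on_def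
proof safe
  show "u \<in> borel_measurable (lebesgue_on {c..d})"
    using integrable_lebesgue_on_Icc_integrable_on(2)[OF L2_on_imp_integrable(1)[OF u] cd] by auto
  have "(\<lambda>x. (norm (u x))\<^sup>2) absolutely_integrable_on {a..b}"
    using u by (simp add: L2_on_def flip: integrable_lebesgue_on_iff_absolutely)
  then have "(\<lambda>x. (norm (u x))\<^sup>2) absolutely_integrable_on {c..d}"
    using absolutely_integrable_on_subinterval cd by blast
  then show "integrable (lebesgue_on {c..d}) (\<lambda>x. (norm (u x))\<^sup>2)"
    by (simp add: integrable_lebesgue_on_iff_absolutely)
qed

lemma L1_norm_subinterval:
  fixes h :: "real \<Rightarrow> complex"
  assumes h: "integrable (lebesgue_on {a..b}) h" and cd: "{c..d} \<subseteq> {a..b}"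
  shows "(LINT x|lebesgue_on {c..d}. norm (h x)) \<le> (LINT x|lebesgue_on {a..b}. norm (h x))"
proof -
  note h' = integrable_lebesgue_on_Icc_integrable_on(2)[OF h cd]
  \<comment> \<open>The estimate for complex integrals is applied to the norm of h, read as a
    complex function.\<close>
  have n: "integrable (lebesgue_on {a..b}) (\<lambda>x. complex_of_real (norm (h x)))" using h by auto
  have "complex_of_real (LINT x|lebesgue_on {c..d}. norm (h x)) = (LINT x|lebesgue_on {c..d}. complex_of_real (norm (h x)))"
    by simp
  also have "\<dots> = integral {c..d} (\<lambda>x. complex_of_real (norm (h x)))"
    by (rule lebesgue_integral_eq_integral) (use h' in auto)
  finally have "norm (complex_of_real (LINT x|lebesgue_on {c..d}. norm (h x))) \<le> (LINT x|lebesgue_on {a..b}. norm (complex_of_real (norm (h x))))"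
    using norm_integral_le_L1[OF n cd] by (simp only:)
  then show ?thesis by simp
qed

text \<open>Initial values are prescribed at 0, inside [-l,l], while primitives start at the left
  end; comparing both points through that end costs the factor 2.\<close>

lemma primitive_on_norm_diff_le:
  assumes p: "primitive_on a b u g" and s: "s \<in> {a..b}" and t: "t \<in> {a..b}"
  shows "norm (u t - u s) \<le> 2 * (LINT x|lebesgue_on {a..b}. norm (g x))"
proof -
  note i = L2_on_imp_integrable(1)[OF primitive_on_L2[OF p]]
  have "u t - u s = integral {a..t} g - integral {a..s} g"
    by (subst primitive_on_eq[OF p t], subst primitive_on_eq[OF p s]) simp
  then have "norm (u t - u s) \<le> norm (integral {a..t} g) + norm (integral {a..s} g)"
    by (simp add: norm_triangle_ineq4)
  also have "\<dots> \<le> (LINT x|lebesgue_on {a..b}. norm (g x)) + (LINT x|lebesgue_on {a..b}. norm (g x))"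
    by (intro add_mono norm_integral_le_L1 i) (use s t in auto)
  finally show ?thesis by simp
qed

locale transmutation_setting = nonvanishing_primitive l f f' + L2_kernel l k
  for l f f' k
begin

text \<open>
  The Volterra form of \<open>\<^bold>S\<^sub>f \<^bold>T\<^sub>f y = - \<^bold>T\<^sub>f g\<close> with \<open>z = y'\<close>, \<open>g = y''\<close>: it involves no derivative
  of \<open>\<^bold>T\<^sub>f y\<close>, hence survives limits in \<open>y\<close>.
\<close>

definition intertwined :: "(real \<Rightarrow> complex) \<Rightarrow> (real \<Rightarrow> complex) \<Rightarrow> (real \<Rightarrow> complex) \<Rightarrow> bool" where
  "intertwined y z g \<longleftrightarrow> primitive_on (-l) l y z \<and> primitive_on (-l) l z g \<and>
    (AE x in lebesgue_on {0..l}.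
      y x + kint y x = f x * sl_ratio f (y 0) (z 0) (\<lambda>r. g r + kint g r) x)"

lemma intertwined_L2:
  assumes "intertwined y z g"
  shows "y \<in> L2_on {-l..l}" "z \<in> L2_on {-l..l}" "g \<in> L2_on {-l..l}"
  using assms L2_on_continuous primitive_on_continuous primitive_on_L2
  unfolding intertwined_def by blast+

lemma transform_L2:
  assumes "g \<in> L2_on {-l..l}"
  shows "(\<lambda>r. g r + kint g r) \<in> L2_on {0..l}"
  by (intro L2_on_add kint_L2(1) assms L2_on_subinterval[OF assms]) (use l_pos in auto)

lemma intertwined_linear:
  assumes 1: "intertwined y z g" and 2: "intertwined y' z' g'"
  shows "intertwined (\<lambda>t. c * y t + y' t) (\<lambda>t. c * z t + z' t) (\<lambda>t. c * g t + g' t)"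
  unfolding intertwined_def
proof (intro conjI)
  note L1 = intertwined_L2[OF 1] and L2 = intertwined_L2[OF 2]
  show "primitive_on (-l) l (\<lambda>t. c * y t + y' t) (\<lambda>t. c * z t + z' t)"
    "primitive_on (-l) l (\<lambda>t. c * z t + z' t) (\<lambda>t. c * g t + g' t)"
    using 1 2 by (auto simp: intertwined_def intro!: primitive_on_add primitive_on_cmult)
  \<comment> \<open>Linearity of \<open>kint\<close> holds at almost every r only; under the
    integrals of \<open>sl_ratio\<close> this is enough.\<close>
  have T: "AE r in lebesgue_on {0..l}. c * g r + g' r + kint (\<lambda>t. c * g t + g' t) r
      = c * (g r + kint g r) + (g' r + kint g' r)"
    using AE_k_L2 by (rule eventually_mono) (subst kint_linear[OF _ L1(3) L2(3)], simp_all add: algebra_simps)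
  have "AE x in lebesgue_on {0..l}. k x \<in> L2_on {-l..l} \<and> x \<in> {0..l} \<and>
      y x + kint y x = f x * sl_ratio f (y 0) (z 0) (\<lambda>r. g r + kint g r) x \<and>
      y' x + kint y' x = f x * sl_ratio f (y' 0) (z' 0) (\<lambda>r. g' r + kint g' r) x"
    using 1 2 AE_k_L2 AE_space[of "lebesgue_on {0..l}"] unfolding intertwined_def
    by (intro AE_conjI) simp_all
  then show "AE x in lebesgue_on {0..l}. c * y x + y' x + kint (\<lambda>t. c * y t + y' t) x
      = f x * sl_ratio f (c * y 0 + y' 0) (c * z 0 + z' 0) (\<lambda>r. c * g r + g' r + kint (\<lambda>t. c * g t + g' t) r) x"
  proof (rule eventually_mono, elim conjE)
    fix x assume k: "k x \<in> L2_on {-l..l}" and x: "x \<in> {0..l}"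
      and e1: "y x + kint y x = f x * sl_ratio f (y 0) (z 0) (\<lambda>r. g r + kint g r) x"
      and e2: "y' x + kint y' x = f x * sl_ratio f (y' 0) (z' 0) (\<lambda>r. g' r + kint g' r) x"
    have "c * y x + y' x + kint (\<lambda>t. c * y t + y' t) x = c * (y x + kint y x) + (y' x + kint y' x)"
      by (subst kint_linear[OF k L1(1) L2(1)]) (simp add: algebra_simps)
    also have "\<dots> = f x * (c * sl_ratio f (y 0) (z 0) (\<lambda>r. g r + kint g r) x
        + sl_ratio f (y' 0) (z' 0) (\<lambda>r. g' r + kint g' r) x)"
      unfolding e1 e2 by (simp add: algebra_simps)
    also have "\<dots> = f x * sl_ratio f (c * y 0 + y' 0) (c * z 0 + z' 0) (\<lambda>r. c * (g r + kint g r) + (g' r + kint g' r)) x"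
      by (subst sl_ratio_linear[OF transform_L2[OF L1(3)] transform_L2[OF L2(3)] x]) simp
    finally show "c * y x + y' x + kint (\<lambda>t. c * y t + y' t) x
      = f x * sl_ratio f (c * y 0 + y' 0) (c * z 0 + z' 0) (\<lambda>r. c * g r + g' r + kint (\<lambda>t. c * g t + g' t) r) x"
      using sl_ratio_cong_AE[OF T x] by simp
  qed
qed

lemma sqn_le:
  assumes h: "h \<in> L2_on {-l..l}" and B: "\<And>t. t \<in> {-l..l} \<Longrightarrow> norm (h t) \<le> B"
  shows "sqn h \<le> measure (lebesgue_on {-l..l}) {-l..l} * B\<^sup>2"
proof -
  have "sqn h \<le> (LINT t|lebesgue_on {-l..l}. B\<^sup>2)"
    unfolding sqn_def
  proof (rule integral_mono)
    show "integrable (lebesgue_on {-l..l}) (\<lambda>t. (norm (h t))\<^sup>2)" using h by (simp add: L2_on_def)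
    show "integrable (lebesgue_on {-l..l}) (\<lambda>t. B\<^sup>2)" by (rule Lebesgue_Measure.integrable_const_ivl)
  qed (use B in \<open>auto intro!: power_mono\<close>)
  then show ?thesis by simp
qed

lemma L1_norm_le:
  fixes h :: "real \<Rightarrow> complex"
  assumes h: "h \<in> L2_on {-l..l}" and B: "\<And>t. t \<in> {-l..l} \<Longrightarrow> norm (h t) \<le> B"
  shows "(LINT t|lebesgue_on {-l..l}. norm (h t)) \<le> measure (lebesgue_on {-l..l}) {-l..l} * B"
proof -
  have "(LINT t|lebesgue_on {-l..l}. norm (h t)) \<le> (LINT t|lebesgue_on {-l..l}. B)"
  proof (rule integral_mono)
    show "integrable (lebesgue_on {-l..l}) (\<lambda>t. norm (h t))" using L2_on_imp_integrable(1)[OF h] by simp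
    show "integrable (lebesgue_on {-l..l}) (\<lambda>t. B)" by (rule Lebesgue_Measure.integrable_const_ivl)
  qed (use B in auto)
  then show ?thesis by simp
qed

text \<open>Convergence of the second derivatives in L^2 and of the data at 0 controls first z, then
  y, uniformly on [-l,l]. The left-hand side then converges at almost every x, and the right-hand
  side because the transforms of \<open>g n\<close> converge in L^1.\<close>

lemma intertwined_limit:
  assumes n: "\<And>n::nat. intertwined (y n) (z n) (g n)"
    and yz: "primitive_on (-l) l y' z'" and zg: "primitive_on (-l) l z' g'"
    and y0: "(\<lambda>n. y n 0) \<longlonglongrightarrow> y' 0" and z0: "(\<lambda>n. z n 0) \<longlonglongrightarrow> z' 0"
    and g: "(\<lambda>n. sqn (\<lambda>t. g n t - g' t)) \<longlonglongrightarrow> 0"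
  shows "intertwined y' z' g'"
proof -
  define m where "m = measure (lebesgue_on {-l..l}) {-l..l}"
  note L = intertwined_L2[OF n]
  have g'L: "g' \<in> L2_on {-l..l}" and z'L: "z' \<in> L2_on {-l..l}" and y'L: "y' \<in> L2_on {-l..l}"
    using primitive_on_L2[OF zg] primitive_on_L2[OF yz] L2_on_continuous[OF primitive_on_continuous[OF yz]] .
  define \<delta> where "\<delta> n = (LINT t|lebesgue_on {-l..l}. norm (g n t - g' t))" for n
  have "(\<lambda>n. (\<delta> n)\<^sup>2) \<longlonglongrightarrow> 0"
  proof (rule tendsto_sandwich[of "\<lambda>_. 0" _ _ "\<lambda>n. \<bar>l - (- l)\<bar> * sqn (\<lambda>t. g n t - g' t)"])
    show "(\<lambda>n. \<bar>l - (- l)\<bar> * sqn (\<lambda>t. g n t - g' t)) \<longlonglongrightarrow> 0"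
      using tendsto_mult_left[OF g, of "\<bar>l - (- l)\<bar>"] by simp
    have "(\<delta> n)\<^sup>2 \<le> \<bar>l - (- l)\<bar> * sqn (\<lambda>t. g n t - g' t)" for n
      unfolding \<delta>_def sqn_def by (rule L2_on_imp_integrable(2)) (intro L2_on_diff L g'L)
    then show "\<forall>\<^sub>F n in sequentially. (\<delta> n)\<^sup>2 \<le> \<bar>l - (- l)\<bar> * sqn (\<lambda>t. g n t - g' t)" by (intro always_eventually allI)
  qed simp_all
  moreover have "0 \<le> \<delta> n" for n by (simp add: \<delta>_def)
  ultimately have \<delta>: "\<delta> \<longlonglongrightarrow> 0"
    using tendsto_real_sqrt[of "\<lambda>n. (\<delta> n)\<^sup>2" 0 sequentially] by simp
  have diff: "primitive_on (-l) l (\<lambda>t. u t - v t) (\<lambda>t. p t - q t)"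
    if "primitive_on (-l) l u p" "primitive_on (-l) l v q" for u v p q
    using primitive_on_add[OF that(1) primitive_on_cmult[OF that(2), of "-1"]] by simp
  have in0: "(0::real) \<in> {-l..l}" using l_pos by simp
  have tri: "norm d \<le> norm c + B" if "norm (d - c) \<le> B" for c d :: complex and B
    using that norm_triangle_ineq2[of d c] by linarith
  \<comment> \<open>A uniform bound for z n - z': its value at 0 plus twice the L^1 norm of its
    derivative.\<close>
  define \<beta> where "\<beta> n = norm (z n 0 - z' 0) + 2 * \<delta> n" for n
  have "\<beta> \<longlonglongrightarrow> norm (z' 0 - z' 0) + 2 * 0"
    unfolding \<beta>_def by (intro tendsto_intros z0 \<delta>)
  then have \<beta>: "\<beta> \<longlonglongrightarrow> 0" by simp
  have zb: "norm (z n t - z' t) \<le> \<beta> n" if "t \<in> {-l..l}" for n t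
    unfolding \<beta>_def \<delta>_def
    by (rule tri[OF primitive_on_norm_diff_le[OF diff in0 that]])
       (use n[of n] zg in \<open>auto simp: intertwined_def\<close>)
  \<comment> \<open>The same estimate one level up, the L^1 norm of z n - z' being at most the
    length m of the interval times \<beta>.\<close>
  define \<alpha> where "\<alpha> n = norm (y n 0 - y' 0) + 2 * (m * \<beta> n)" for n
  have "\<alpha> \<longlonglongrightarrow> norm (y' 0 - y' 0) + 2 * (m * 0)"
    unfolding \<alpha>_def by (intro tendsto_intros y0 \<beta>)
  then have \<alpha>: "\<alpha> \<longlonglongrightarrow> 0" by simp
  have yb: "norm (y n t - y' t) \<le> \<alpha> n" if t: "t \<in> {-l..l}" for n t
  proof -
    have "primitive_on (-l) l (\<lambda>t. y n t - y' t) (\<lambda>t. z n t - z' t)"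
      using n[of n] yz by (intro diff) (auto simp: intertwined_def)
    from tri[OF primitive_on_norm_diff_le[OF this in0 t]]
    have "norm (y n t - y' t) \<le> norm (y n 0 - y' 0) + 2 * (LINT t|lebesgue_on {-l..l}. norm (z n t - z' t))" .
    also have "\<dots> \<le> \<alpha> n"
      unfolding \<alpha>_def m_def by (intro add_left_mono mult_left_mono L1_norm_le zb L2_on_diff L z'L) auto
    finally show ?thesis .
  qed
  have sy: "(\<lambda>n. sqn (\<lambda>t. y n t - y' t)) \<longlonglongrightarrow> 0"
  proof (rule tendsto_sandwich[of "\<lambda>_. 0" _ _ "\<lambda>n. m * (\<alpha> n)\<^sup>2"])
    have "(\<lambda>n. m * (\<alpha> n)\<^sup>2) \<longlonglongrightarrow> m * 0\<^sup>2" by (intro tendsto_intros \<alpha>)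
    then show "(\<lambda>n. m * (\<alpha> n)\<^sup>2) \<longlonglongrightarrow> 0" by simp
    have "sqn (\<lambda>t. y n t - y' t) \<le> m * (\<alpha> n)\<^sup>2" for n
      unfolding m_def by (intro sqn_le yb L2_on_diff L y'L)
    then show "\<forall>\<^sub>F n in sequentially. sqn (\<lambda>t. y n t - y' t) \<le> m * (\<alpha> n)\<^sup>2" by simp
  qed (simp_all add: sqn_def)
  have wL: "(\<lambda>n. LINT r|lebesgue_on {0..l}. norm ((g n r + kint (g n) r) - (g' r + kint g' r))) \<longlonglongrightarrow> 0"
  proof (rule tendsto_sandwich[of "\<lambda>_. 0" _ _ "\<lambda>n. \<delta> n + (LINT r|lebesgue_on {0..l}. norm (kint (g n) r - kint g' r))"])
    have "(\<lambda>n. \<delta> n + (LINT r|lebesgue_on {0..l}. norm (kint (g n) r - kint g' r))) \<longlonglongrightarrow> 0 + 0"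
      by (intro tendsto_add \<delta> kint_tendsto_L1 L g'L g)
    then show "(\<lambda>n. \<delta> n + (LINT r|lebesgue_on {0..l}. norm (kint (g n) r - kint g' r))) \<longlonglongrightarrow> 0" by simp
    have "(LINT r|lebesgue_on {0..l}. norm ((g n r + kint (g n) r) - (g' r + kint g' r)))
        \<le> \<delta> n + (LINT r|lebesgue_on {0..l}. norm (kint (g n) r - kint g' r))" for n
    proof -
      have sub: "{0..l} \<subseteq> {-l..l}" using l_pos by simp
      have gi: "integrable (lebesgue_on {-l..l}) (\<lambda>r. g n r - g' r)"
        by (intro L2_on_imp_integrable(1) L2_on_diff L g'L)
      note gi0 = integrable_lebesgue_on_Icc_integrable_on(2)[OF gi sub]
      have ki: "integrable (lebesgue_on {0..l}) (\<lambda>r. kint (g n) r - kint g' r)"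
        by (intro L2_on_imp_integrable(1) L2_on_diff kint_L2(1) L g'L)
      have "(LINT r|lebesgue_on {0..l}. norm ((g n r + kint (g n) r) - (g' r + kint g' r)))
        \<le> (LINT r|lebesgue_on {0..l}. norm (g n r - g' r) + norm (kint (g n) r - kint g' r))"
      proof (rule integral_mono)
        have "(\<lambda>r. (g n r + kint (g n) r) - (g' r + kint g' r)) = (\<lambda>r. (g n r - g' r) + (kint (g n) r - kint g' r))"
          by (simp add: algebra_simps)
        then show "integrable (lebesgue_on {0..l}) (\<lambda>r. norm ((g n r + kint (g n) r) - (g' r + kint g' r)))"
          using Bochner_Integration.integrable_add[OF gi0 ki] by (intro integrable_norm) simp
        show "norm ((g n r + kint (g n) r) - (g' r + kint g' r)) \<le> norm (g n r - g' r) + norm (kint (g n) r - kint g' r)" for r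
          using norm_triangle_ineq[of "g n r - g' r" "kint (g n) r - kint g' r"] by (simp add: algebra_simps)
      qed (intro Bochner_Integration.integrable_add integrable_norm gi0 ki)
      also have "\<dots> = (LINT r|lebesgue_on {0..l}. norm (g n r - g' r)) + (LINT r|lebesgue_on {0..l}. norm (kint (g n) r - kint g' r))"
        by (intro Bochner_Integration.integral_add integrable_norm gi0 ki)
      finally show ?thesis using L1_norm_subinterval[OF gi sub] by (simp add: \<delta>_def)
    qed
    then show "\<forall>\<^sub>F n in sequentially. (LINT r|lebesgue_on {0..l}. norm ((g n r + kint (g n) r) - (g' r + kint g' r)))
        \<le> \<delta> n + (LINT r|lebesgue_on {0..l}. norm (kint (g n) r - kint g' r))" by (intro always_eventually allI)
  qed simp_all
  \<comment> \<open>One null set for all n, so that the limit can be taken at a fixed x.\<close>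
  have "AE x in lebesgue_on {0..l}. \<forall>n. y n x + kint (y n) x = f x * sl_ratio f (y n 0) (z n 0) (\<lambda>r. g n r + kint (g n) r) x"
    using n by (simp add: AE_all_countable intertwined_def)
  then have "AE x in lebesgue_on {0..l}. k x \<in> L2_on {-l..l} \<and> x \<in> {0..l} \<and>
      (\<forall>n. y n x + kint (y n) x = f x * sl_ratio f (y n 0) (z n 0) (\<lambda>r. g n r + kint (g n) r) x)"
    using AE_k_L2 AE_space[of "lebesgue_on {0..l}"] by (intro AE_conjI) simp_all
  then have "AE x in lebesgue_on {0..l}. y' x + kint y' x = f x * sl_ratio f (y' 0) (z' 0) (\<lambda>r. g' r + kint g' r) x"
  proof (rule eventually_mono, elim conjE)
    fix x assume k: "k x \<in> L2_on {-l..l}" and x: "x \<in> {0..l}"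
      and e: "\<forall>n. y n x + kint (y n) x = f x * sl_ratio f (y n 0) (z n 0) (\<lambda>r. g n r + kint (g n) r) x"
    have "(\<lambda>n. y n x - y' x) \<longlonglongrightarrow> 0"
    proof (rule Lim_null_comparison[OF _ \<alpha>])
      show "\<forall>\<^sub>F n in sequentially. norm (y n x - y' x) \<le> \<alpha> n" using yb[of x] x by simp
    qed
    then have "(\<lambda>n. y n x) \<longlonglongrightarrow> y' x" by (rule LIM_zero_cancel)
    then have "(\<lambda>n. y n x + kint (y n) x) \<longlonglongrightarrow> y' x + kint y' x"
      by (intro tendsto_add kint_tendsto k L y'L sy)
    moreover have "(\<lambda>n. y n x + kint (y n) x) \<longlonglongrightarrow> f x * sl_ratio f (y' 0) (z' 0) (\<lambda>r. g' r + kint g' r) x"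
      unfolding e[rule_format]
      by (intro tendsto_mult tendsto_const sl_ratio_tendsto transform_L2 L g'L x wL y0 z0)
    ultimately show "y' x + kint y' x = f x * sl_ratio f (y' 0) (z' 0) (\<lambda>r. g' r + kint g' r) x"
      by (rule LIMSEQ_unique)
  qed
  with yz zg show ?thesis by (simp add: intertwined_def)
qed

section \<open>From real exponentials to all second derivatives in L^2\<close>

context
  assumes exps: "\<And>c::real. intertwined (\<lambda>t. of_real (exp (c * t))) (\<lambda>t. of_real c * of_real (exp (c * t)))
    (\<lambda>t. (of_real c)\<^sup>2 * of_real (exp (c * t)))"
begin

lemma intertwined_0: "intertwined (\<lambda>_. 0) (\<lambda>_. 0) (\<lambda>_. 0)"
  using intertwined_linear[OF exps exps, of "-1" 0 0] by simp

lemma intertwined_1: "intertwined (\<lambda>_. 1) (\<lambda>_. 0) (\<lambda>_. 0)"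
  using exps[of 0] by simp

lemma intertwined_cmult:
  "intertwined y z g \<Longrightarrow> intertwined (\<lambda>t. c * y t) (\<lambda>t. c * z t) (\<lambda>t. c * g t)"
  using intertwined_linear[OF _ intertwined_0, of y z g c] by simp

text \<open>The approximants N (exp(t/N) - 1) have value 0 and slope 1 at 0 exactly, so only their
  second derivatives exp(t/N)/N have to converge; on [-l,l] these are at most exp(l)/N, as N >=
  1.\<close>

lemma intertwined_id: "intertwined (\<lambda>t. of_real t) (\<lambda>_. 1) (\<lambda>_. 0)"
proof (rule intertwined_limit)
  define N where "N n = real (Suc n)" for n
  have N: "N n > 0" "N n \<ge> 1" for n by (simp_all add: N_def)
  let ?y = "\<lambda>n t. of_real (N n) * complex_of_real (exp (inverse (N n) * t)) + of_real (- N n) * 1"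
  let ?z = "\<lambda>n t. complex_of_real (exp (inverse (N n) * t))"
  let ?g = "\<lambda>n t. of_real (inverse (N n)) * complex_of_real (exp (inverse (N n) * t))"
  show "intertwined (?y n) (?z n) (?g n)" for n
  proof -
    have "intertwined (?y n) (\<lambda>t. of_real (N n) * (of_real (inverse (N n)) * complex_of_real (exp (inverse (N n) * t))) + of_real (- N n) * 0)
       (\<lambda>t. of_real (N n) * ((of_real (inverse (N n)))\<^sup>2 * complex_of_real (exp (inverse (N n) * t))) + of_real (- N n) * 0)"
      by (intro intertwined_linear exps intertwined_cmult intertwined_1)
    then show ?thesis using N(1)[of n] by (simp add: power2_eq_square field_simps)
  qed
  show "primitive_on (- l) l complex_of_real (\<lambda>_. 1)"
    by (rule primitive_on_has_vector_derivative) (auto intro!: derivative_eq_intros)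
  show "primitive_on (- l) l (\<lambda>_. 1) (\<lambda>_. 0)"
    by (rule primitive_on_has_vector_derivative) auto
  show "(\<lambda>n. ?y n 0) \<longlonglongrightarrow> complex_of_real 0" "(\<lambda>n. ?z n 0) \<longlonglongrightarrow> 1" by simp_all
  define m where "m = measure (lebesgue_on {-l..l}) {-l..l}"
  have Nlim: "(\<lambda>n. inverse (N n)) \<longlonglongrightarrow> 0" unfolding N_def by (rule LIMSEQ_inverse_real_of_nat)
  show "(\<lambda>n. sqn (\<lambda>t. ?g n t - 0)) \<longlonglongrightarrow> 0"
  proof (rule tendsto_sandwich[of "\<lambda>_. 0" _ _ "\<lambda>n. m * (inverse (N n) * exp l)\<^sup>2"])
    have "(\<lambda>n. m * (inverse (N n) * exp l)\<^sup>2) \<longlonglongrightarrow> m * (0 * exp l)\<^sup>2" by (intro tendsto_intros Nlim)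
    then show "(\<lambda>n. m * (inverse (N n) * exp l)\<^sup>2) \<longlonglongrightarrow> 0" by simp
    have "sqn (\<lambda>t. ?g n t - 0) \<le> m * (inverse (N n) * exp l)\<^sup>2" for n
      unfolding m_def
    proof (rule sqn_le)
      show "(\<lambda>t. ?g n t - 0) \<in> L2_on {-l..l}" by (intro L2_on_continuous continuous_intros)
      fix t assume t: "t \<in> {-l..l}"
      have "inverse (N n) * t \<le> inverse (N n) * l" using t N(1)[of n] by (intro mult_left_mono) auto
      also have "\<dots> \<le> 1 * l" using l_pos N(2)[of n] by (intro mult_right_mono) (auto simp: inverse_le_1_iff)
      finally show "norm (?g n t - 0) \<le> inverse (N n) * exp l"
        using N(1)[of n] by (simp add: norm_mult del: of_real_inverse)
    qed
    then show "\<forall>\<^sub>F n in sequentially. sqn (\<lambda>t. ?g n t - 0) \<le> m * (inverse (N n) * exp l)\<^sup>2"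
      by (intro always_eventually allI)
  qed (simp_all add: sqn_def)
qed

text \<open>The second derivatives for which the relation is known with some initial values; the
  next step shows that these values can be prescribed at will.\<close>

definition dense_class :: "(real \<Rightarrow> complex) set" where
  "dense_class = {g. \<exists>y z. intertwined y z g}"

lemma dense_class_linear:
  "g \<in> dense_class \<Longrightarrow> h \<in> dense_class \<Longrightarrow> (\<lambda>t. c * g t + h t) \<in> dense_class"
  unfolding dense_class_def using intertwined_linear by blast

text \<open>Adding a constant and a multiple of t corrects y(0) and y'(0) without touching the
  second derivative.\<close>

lemma dense_class_initial_values:
  assumes "g \<in> dense_class"
  obtains y z where "intertwined y z g" "y 0 = a" "z 0 = b"
proof -
  obtain y z where yz: "intertwined y z g" using assms by (auto simp: dense_class_def)
  have "intertwined (\<lambda>t. (a - y 0) * 1 + ((b - z 0) * of_real t + y t)) (\<lambda>t. (a - y 0) * 0 + ((b - z 0) * 1 + z t))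
    (\<lambda>t. (a - y 0) * 0 + ((b - z 0) * 0 + g t))"
    by (intro intertwined_linear intertwined_1 intertwined_id yz)
  then have "intertwined (\<lambda>t. (a - y 0) + ((b - z 0) * of_real t + y t)) (\<lambda>t. (b - z 0) + z t) g" by simp
  then show thesis by (rule that) simp_all
qed

text \<open>The factor exp t removes the constant term, leaving exponents j >= 1; then exp(jt)/j^2
  has second derivative exp(jt), so the relation for exponentials applies.\<close>

lemma dense_class_polynomial:
  assumes "real_polynomial_function r"
  shows "(\<lambda>t. of_real (exp t * r (exp t))) \<in> dense_class"
proof -
  obtain a n where r: "r = (\<lambda>x. \<Sum>i\<le>n. a i * x ^ i)"
    using assms real_polynomial_function_iff_sum by blast
  have mon: "(\<lambda>t. complex_of_real (exp (real (Suc i) * t))) \<in> dense_class" for i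
  proof -
    let ?c = "complex_of_real (real (Suc i))"
    have "intertwined (\<lambda>t. inverse (?c\<^sup>2) * of_real (exp (real (Suc i) * t))) (\<lambda>t. inverse (?c\<^sup>2) * (?c * of_real (exp (real (Suc i) * t))))
      (\<lambda>t. inverse (?c\<^sup>2) * (?c\<^sup>2 * of_real (exp (real (Suc i) * t))))"
      by (intro intertwined_cmult exps)
    moreover have "?c\<^sup>2 \<noteq> 0" by (simp del: of_nat_Suc)
    then have "inverse (?c\<^sup>2) * (?c\<^sup>2 * v) = v" for v by (simp add: mult.assoc[symmetric] del: of_nat_Suc)
    ultimately show ?thesis unfolding dense_class_def by (simp only:) blast
  qed
  have "(\<lambda>t. \<Sum>i<m. complex_of_real (a i) * complex_of_real (exp (real (Suc i) * t))) \<in> dense_class" for m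
  proof (induction m)
    case 0
    then show ?case using intertwined_0 by (auto simp: dense_class_def)
  next
    case (Suc m)
    then show ?case
      using dense_class_linear[OF mon Suc, of "complex_of_real (a m)"] by (simp add: add.commute)
  qed
  from this[of "Suc n"] have "(\<lambda>t. \<Sum>i\<le>n. complex_of_real (a i) * complex_of_real (exp (real (Suc i) * t))) \<in> dense_class"
    by (simp only: lessThan_Suc_atMost)
  moreover have "complex_of_real (exp t * r (exp t)) = (\<Sum>i\<le>n. complex_of_real (a i) * complex_of_real (exp (real (Suc i) * t)))" for t
  proof -
    have "exp t * r (exp t) = (\<Sum>i\<le>n. a i * exp (real (Suc i) * t))"
      unfolding r sum_distrib_left
      by (intro sum.cong refl) (simp add: exp_of_nat_mult[symmetric] distrib_right exp_add)
    then show ?thesis by simp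
  qed
  ultimately show ?thesis by simp
qed

text \<open>A continuous p close to g is to be approximated by e^t q(e^t). In the variable s = e^t
  this asks for a polynomial q close to p(ln s)/s, which is continuous because s stays away from
  0.\<close>

lemma dense_class_dense:
  assumes g: "g \<in> L2_on {-l..l}" and e: "0 < e"
  obtains h where "h \<in> dense_class" "sqn (\<lambda>t. h t - g t) < e"
proof -
  obtain p where p: "continuous_on UNIV p" and pe: "sqn (\<lambda>t. p t - g t) < e / 4"
    using L2_on_approx_continuous[OF g, of "e / 4"] e unfolding sqn_def by auto
  have pc: "continuous_on {-l..l} p" by (rule continuous_on_subset[OF p]) simp
  define m where "m = measure (lebesgue_on {-l..l}) {-l..l}"
  have m0: "0 \<le> m" by (simp add: m_def)
  \<comment> \<open>Chosen so that m d^2 < e/4; m + 1 instead of m keeps the quotient meaningful and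
    the inequality strict.\<close>
  define d where "d = sqrt (e / (4 * (m + 1)))"
  have d: "0 < d" "d\<^sup>2 = e / (4 * (m + 1))" using e m0 by (simp_all add: d_def)
  have lc: "continuous_on {exp (-l)..exp l} (\<lambda>s. ln s)"
    by (intro continuous_intros) (auto simp: less_le_trans[OF exp_gt_zero] dest: less_le_trans[OF exp_gt_zero])
  have "continuous_on {exp (-l)..exp l} (\<lambda>s. p (ln s) / of_real s)"
  proof (intro continuous_intros)
    show "continuous_on {exp (-l)..exp l} (\<lambda>s. p (ln s))"
      by (rule continuous_on_compose2[OF p lc]) simp
    show "\<forall>x\<in>{exp (-l)..exp l}. complex_of_real x \<noteq> 0"
      by (auto dest: less_le_trans[OF exp_gt_zero])
  qed
  \<comment> \<open>Multiplying back by e^t <= e^l enlarges the error by at most e^l; the tolerance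
    d e^(-l) compensates.\<close>
  from Stone_Weierstrass_polynomial_function[OF compact_Icc this, of "d * exp (-l)"] d(1)
  obtain q where q: "polynomial_function q"
    and qd: "\<And>s. s \<in> {exp (-l)..exp l} \<Longrightarrow> norm (p (ln s) / of_real s - q s) < d * exp (-l)"
    by auto
  define h where "h t = of_real (exp t) * q (exp t)" for t
  have qr: "real_polynomial_function (\<lambda>x. Re (q x))" "real_polynomial_function (\<lambda>x. Im (q x))"
    using q[unfolded polynomial_function_def, rule_format, OF bounded_linear_Re]
      q[unfolded polynomial_function_def, rule_format, OF bounded_linear_Im] by (simp_all add: o_def)
  have hd: "h \<in> dense_class"
  proof -
    have "h = (\<lambda>t. \<i> * of_real (exp t * Im (q (exp t))) + of_real (exp t * Re (q (exp t))))"
      by (auto simp: h_def fun_eq_iff complex_eq_iff)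
    then show ?thesis
      using dense_class_linear[OF dense_class_polynomial[OF qr(2)] dense_class_polynomial[OF qr(1)], of \<i>] by simp
  qed
  then have hL: "h \<in> L2_on {-l..l}" using intertwined_L2(3) by (auto simp: dense_class_def)
  have pL: "p \<in> L2_on {-l..l}" by (rule L2_on_continuous[OF pc])
  have hp: "norm (h t - p t) \<le> d" if t: "t \<in> {-l..l}" for t
  proof -
    have "exp t \<in> {exp (-l)..exp l}" using t by simp
    from qd[OF this] have qt: "norm (p t / of_real (exp t) - q (exp t)) < d * exp (-l)" by simp
    have "h t - p t = - (of_real (exp t) * (p t / of_real (exp t) - q (exp t)))"
      by (simp add: h_def field_simps)
    then have "norm (h t - p t) = exp t * norm (p t / of_real (exp t) - q (exp t))"
      by (simp only: norm_minus_cancel norm_mult norm_of_real abs_exp_cancel)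
    also have "\<dots> \<le> exp l * (d * exp (-l))"
      using t qt by (intro mult_mono) auto
    also have "\<dots> = d" by (simp add: exp_minus field_simps)
    finally show ?thesis .
  qed
  have "sqn (\<lambda>t. h t - p t) \<le> m * d\<^sup>2"
    unfolding m_def by (intro sqn_le L2_on_diff hL pL hp)
  also have "\<dots> < e / 2 * (1 / 2)" using e m0 by (simp add: d(2) field_simps)
  finally have he: "sqn (\<lambda>t. h t - p t) < e / 4" by simp
  have i: "integrable (lebesgue_on {-l..l}) (\<lambda>t. (norm (h t - p t))\<^sup>2)" "integrable (lebesgue_on {-l..l}) (\<lambda>t. (norm (p t - g t))\<^sup>2)"
    "integrable (lebesgue_on {-l..l}) (\<lambda>t. (norm (h t - g t))\<^sup>2)"
    using L2_on_diff[OF hL pL] L2_on_diff[OF pL g] L2_on_diff[OF hL g] by (simp_all add: L2_on_def)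
  have "sqn (\<lambda>t. h t - g t) \<le> (LINT t|lebesgue_on {-l..l}. 2 * (norm (h t - p t))\<^sup>2 + 2 * (norm (p t - g t))\<^sup>2)"
    unfolding sqn_def
  proof (rule integral_mono)
    fix t
    have "(norm (h t - g t))\<^sup>2 \<le> (norm (h t - p t) + norm (p t - g t))\<^sup>2"
      using norm_triangle_ineq[of "h t - p t" "p t - g t"] by (intro power_mono) auto
    also have "\<dots> \<le> 2 * (norm (h t - p t))\<^sup>2 + 2 * (norm (p t - g t))\<^sup>2"
      using zero_le_power2[of "norm (h t - p t) - norm (p t - g t)"] by (simp add: power2_sum power2_diff)
    finally show "(norm (h t - g t))\<^sup>2 \<le> 2 * (norm (h t - p t))\<^sup>2 + 2 * (norm (p t - g t))\<^sup>2" .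
  qed (use i in auto)
  also have "\<dots> = 2 * sqn (\<lambda>t. h t - p t) + 2 * sqn (\<lambda>t. p t - g t)"
    using i by (simp add: sqn_def)
  also have "\<dots> < e" using he pe by simp
  finally show thesis by (rule that[OF hd])
qed

text \<open>The approximants are given the exact initial values of y and z, so only the second
  derivatives vary in the limit.\<close>

lemma intertwined_all:
  assumes yz: "primitive_on (-l) l y z" and zg: "primitive_on (-l) l z g"
  shows "intertwined y z g"
proof -
  have "\<exists>u v h. intertwined u v h \<and> u 0 = y 0 \<and> v 0 = z 0 \<and> sqn (\<lambda>t. h t - g t) < inverse (real (Suc n))" for n
  proof -
    obtain h where "h \<in> dense_class" "sqn (\<lambda>t. h t - g t) < inverse (real (Suc n))"
      using dense_class_dense[OF primitive_on_L2[OF zg], of "inverse (real (Suc n))"] by auto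
    then show ?thesis using dense_class_initial_values[of h "y 0" "z 0"] by metis
  qed
  then obtain u v h where 1: "\<And>n. intertwined (u n) (v n) (h n)" "\<And>n. u n 0 = y 0" "\<And>n. v n 0 = z 0"
    and 2: "\<And>n. sqn (\<lambda>t. h n t - g t) < inverse (real (Suc n))" by metis
  have "(\<lambda>n. sqn (\<lambda>t. h n t - g t)) \<longlonglongrightarrow> 0"
  proof (rule tendsto_sandwich[OF _ _ tendsto_const LIMSEQ_inverse_real_of_nat])
    show "\<forall>\<^sub>F n in sequentially. sqn (\<lambda>t. h n t - g t) \<le> inverse (real (Suc n))"
      using 2 by (intro always_eventually allI less_imp_le)
  qed (simp add: sqn_def)
  then show ?thesis
    by (intro intertwined_limit[OF 1(1) yz zg]) (simp_all add: 1)
qed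

end

end

theorem theorem26:
  fixes l :: real
    and f :: "real \<Rightarrow> complex"
    and e :: "complex \<Rightarrow> real \<Rightarrow> complex"
    and K :: "real \<times> real \<Rightarrow> complex"
  assumes "l > 0"
    and "f \<in> sobolev 1 0 l"
    and "continuous_on {0..l} f"
    and "\<And>x. x \<in> {0..l} \<Longrightarrow> f x \<noteq> 0"
    and "f 0 = 1"
    and "\<And>\<rho>. is_exp_solution l f \<rho> (e \<rho>)"
    and "is_transmutation_kernel l e K"
  shows "transmutation K ` sobolev 2 (-l) l \<subseteq> schroedinger_dom l f \<and>
    (\<forall>y\<in>sobolev 2 (-l) l.
       AE x in lebesgue_on {0<..<l}.
         schroedinger l f (transmutation K y) x =
         - transmutation K (weak_deriv (-l) l (weak_deriv (-l) l y)) x)"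
proof -
  obtain f' where f': "primitive_on 0 l f f'"
    using sobolev_1_continuous_imp_primitive_on[OF assms(1-3)] by blast
  obtain k where k: "L2_kernel k" and Kk: "\<And>y. y \<in> L2_on {-l..l} \<Longrightarrow>
      AE x in lebesgue_on {0..l}. (LINT t:{-x..x}|lebesgue. K (x, t) * y t) = L2_kernel.kint l k y x"
    using transmutation_kernel_borel_version[of K l] assms(7) unfolding is_transmutation_kernel_def by blast
  interpret transmutation_setting l f f' k
    by (intro transmutation_setting.intro k nonvanishing_primitive.intro assms(1,4) f')
  have T: "AE x in lebesgue_on {0..l}. transmutation K y x = y x + kint y x" if "y \<in> L2_on {-l..l}" for y
    using Kk[OF that] by (rule eventually_mono) (simp add: transmutation_def)
  have exps: "intertwined (\<lambda>t. of_real (exp (c * t))) (\<lambda>t. of_real c * of_real (exp (c * t)))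
    (\<lambda>t. (of_real c)\<^sup>2 * of_real (exp (c * t)))" for c :: real
    unfolding intertwined_def
  proof (intro conjI)
    show "primitive_on (-l) l (\<lambda>t. complex_of_real (exp (c * t))) (\<lambda>t. of_real c * of_real (exp (c * t)))"
      "primitive_on (-l) l (\<lambda>t. of_real c * complex_of_real (exp (c * t))) (\<lambda>t. (of_real c)\<^sup>2 * of_real (exp (c * t)))"
      by (rule primitive_on_has_vector_derivative,
          auto intro!: continuous_intros derivative_eq_intros has_vector_derivative_real_field
            simp: power2_eq_square exp_of_real[symmetric])+
    \<comment> \<open>An imaginary spectral parameter: i\<rho> = c gives the real exponential and
      its slope at 0, and -\<rho>^2 = c^2 the factor of its second derivative.\<close>
    define \<rho> where "\<rho> = - \<i> * of_real c"
    have \<rho>: "\<i> * \<rho> = of_real c" "- \<rho>\<^sup>2 = (of_real c)\<^sup>2"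
      by (simp_all add: \<rho>_def power2_eq_square algebra_simps)
    let ?E = "\<lambda>t. complex_of_real (exp (c * t))"
    have ex: "exp (\<i> * \<rho> * of_real t) = ?E t" for t by (simp add: \<rho> exp_of_real[symmetric])
    have E: "?E \<in> L2_on {-l..l}" by (intro L2_on_continuous continuous_intros)
    have eE: "AE x in lebesgue_on {0..l}. e \<rho> x = ?E x + kint ?E x"
    proof -
      \<comment> \<open>The kernel identity is available for x > 0 only, hence the passage through
        the open interval.\<close>
      have "AE x in lebesgue_on {0<..<l}. (LINT t:{-x..x}|lebesgue. K (x, t) * ?E t) = kint ?E x"
        using Kk[OF E] by (simp only: AE_lebesgue_on_Ioo_iff)
      then have "AE x in lebesgue_on {0<..<l}. e \<rho> x = ?E x + kint ?E x"
        using AE_space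
      proof (rule eventually_elim2)
        fix x assume eq: "(LINT t:{-x..x}|lebesgue. K (x, t) * ?E t) = kint ?E x"
          and "x \<in> space (lebesgue_on {0<..<l})"
        then have "x \<in> {0<..l}" by auto
        then have "e \<rho> x = exp (\<i> * \<rho> * of_real x) + (LINT t:{-x..x}|lebesgue. K (x, t) * exp (\<i> * \<rho> * of_real t))"
          using assms(7) unfolding is_transmutation_kernel_def by blast
        then show "e \<rho> x = ?E x + kint ?E x" unfolding ex eq .
      qed
      then show ?thesis by (simp only: AE_lebesgue_on_Ioo_iff)
    qed
    have kc: "kint (\<lambda>t. b * ?E t) x = b * kint ?E x" for b x
      unfolding kint_def by (simp add: mult.left_commute)
    \<comment> \<open>The term -\<rho>^2 e of the eigenvalue equation becomes the transform of the
      second derivative of e^(ct), by linearity of the transform.\<close>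
    have "AE r in lebesgue_on {0..l}. - \<rho>\<^sup>2 * e \<rho> r = (of_real c)\<^sup>2 * ?E r + kint (\<lambda>t. (of_real c)\<^sup>2 * ?E t) r"
      using eE by (rule eventually_mono) (simp only: kc \<rho> distrib_left)
    note cong = sl_ratio_cong_AE[OF this]
    show "AE x in lebesgue_on {0..l}. ?E x + kint ?E x = f x * sl_ratio f (?E 0) (of_real c * ?E 0)
        (\<lambda>r. (of_real c)\<^sup>2 * ?E r + kint (\<lambda>t. (of_real c)\<^sup>2 * ?E t) r) x"
      using eE AE_space
    proof (rule eventually_elim2)
      fix x assume eq: "e \<rho> x = ?E x + kint ?E x" and "x \<in> space (lebesgue_on {0..l})"
      then have x: "x \<in> {0..l}" by simp
      show "?E x + kint ?E x = f x * sl_ratio f (?E 0) (of_real c * ?E 0)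
          (\<lambda>r. (of_real c)\<^sup>2 * ?E r + kint (\<lambda>t. (of_real c)\<^sup>2 * ?E t) r) x"
        using exp_solution_sl_ratio[OF assms(5,6) x, of \<rho>] cong[OF x, of 1 "of_real c"]
        by (simp add: eq[symmetric] \<rho>(1))
    qed
  qed
  have main: "transmutation K y \<in> schroedinger_dom l f \<and> (AE x in lebesgue_on {0<..<l}.
         schroedinger l f (transmutation K y) x = - transmutation K (weak_deriv (-l) l (weak_deriv (-l) l y)) x)"
    if y: "y \<in> sobolev 2 (-l) l" for y
  proof -
    have ll: "- l < l" "- l \<le> l" and sub: "{0..l} \<subseteq> {-l..l}" using assms(1) by auto
    \<comment> \<open>Continuous representatives v of y and z of y' are chosen; y'' is represented
      by h. The values v(0) and z(0) are the initial data, which y itself, known up to null sets,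
      does not determine pointwise.\<close>
    obtain g where g: "g \<in> sobolev 1 (-l) l" "has_weak_deriv (-l) l y g" and yL: "y \<in> L2_on {-l..l}"
      using y by (auto simp: numeral_2_eq_2 L2_on_Ioo_eq)
    have gL: "g \<in> L2_on {-l..l}" using g(1) by (simp add: L2_on_Ioo_eq)
    obtain z h where zh: "primitive_on (-l) l z h" and gz: "AE x in lebesgue_on {-l..l}. g x = z x"
      using g(1) sobolev_1_iff[OF ll(1)] by blast
    obtain v where "primitive_on (-l) l v g" and yv: "AE x in lebesgue_on {-l..l}. y x = v x"
      using weak_deriv_imp_primitive_on[OF yL gL g(2) ll(1)] by blast
    then have vz: "primitive_on (-l) l v z" by (intro primitive_on_cong[OF _ _ gz]) auto
    have "intertwined v z h" by (rule intertwined_all[OF exps vz zh])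
    then have V: "AE x in lebesgue_on {0..l}. v x + kint v x = f x * sl_ratio f (v 0) (z 0) (\<lambda>r. h r + kint h r) x"
      by (simp add: intertwined_def)
    have vL: "v \<in> L2_on {-l..l}" by (rule L2_on_continuous[OF primitive_on_continuous[OF vz]])
    have hL: "h \<in> L2_on {-l..l}" by (rule primitive_on_L2[OF zh])
    have "AE x in lebesgue_on {0..l}. transmutation K y x = v x + kint v x"
      using T[OF yL] AE_lebesgue_on_subset[OF yv sub]
      by (rule eventually_elim2)
         (simp_all add: kint_cong_AE[OF L2_on_measurableD[OF yL] L2_on_measurableD[OF vL] yv])
    then have TV: "AE x in lebesgue_on {0..l}. transmutation K y x = f x * sl_ratio f (v 0) (z 0) (\<lambda>r. h r + kint h r) x"
      using V by (rule eventually_elim2) simp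
    note S = schroedinger_sl_ratio[OF transform_L2[OF hL] TV]
    \<comment> \<open>This representative of y'' stems from two arbitrary choices; it agrees with h
      almost everywhere, and \<open>kint\<close> does not distinguish them.\<close>
    define w where "w = weak_deriv (-l) l (weak_deriv (-l) l y)"
    have "AE x in lebesgue_on {-l..l}. weak_deriv (-l) l y x = z x" by (rule weak_deriv_AE[OF vz yv ll(2)])
    then have wh: "AE x in lebesgue_on {-l..l}. w x = h x"
      unfolding w_def by (rule weak_deriv_AE[OF zh _ ll(2)])
    have wL: "w \<in> L2_on {-l..l}"
    proof (rule L2_on_cong_AE[OF _ hL])
      show "AE x in lebesgue_on {-l..l}. h x = w x" by (rule eventually_mono[OF wh]) simp
    qed simp
    have "AE x in lebesgue_on {0..l}. transmutation K w x = h x + kint h x"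
      using T[OF wL] AE_lebesgue_on_subset[OF wh sub]
      by (rule eventually_elim2)
         (simp_all add: kint_cong_AE[OF L2_on_measurableD[OF wL] L2_on_measurableD[OF hL] wh])
    with S(2) have "AE x in lebesgue_on {0..l}. schroedinger l f (transmutation K y) x = - transmutation K w x"
      by (rule eventually_elim2) simp
    then show ?thesis using S(1) by (simp only: AE_lebesgue_on_Ioo_iff w_def)
  qed
  then show ?thesis by blast
qed

end
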